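(* Let $G$ be a non-cyclic group of odd order $n=mq^{\alpha}$, where $q$ is the smallest prime divisor of $n$, $\alpha$ is a positive integer and $(m,q)=1$. Moreover, let $p$ be the smallest prime bigger than $q$. Then the following statements hold. (1) If $\alpha=1$ and $q=3$, then $\frac{\psi(G)}{\psi(C_n)}\leq \frac{85}{301}=\frac{\psi(C_7\rtimes C_3)}{\psi(C_{21})}$. (2) If $\alpha=1$ and $q>3$, then $\frac{\psi(G)}{\psi(C_n)}\leq \frac{p^4+p^3-p^2+1}{p^5+1}=\frac{\psi(C_p\times C_p)}{\psi(C_{p^2})}$. (3) If $\alpha=2$, then $\frac{\psi(G)}{\psi(C_n)}\leq \frac{q^4+q^3-q^2+1}{q^5+1}=\frac{\psi(C_q\times C_q)}{\psi(C_{q^2})}$. (4) If $\alpha=3$, then $\frac{\psi(G)}{\psi(C_n)}\leq \frac{q^6+q^3-q^2+1}{q^7+1}=\frac{\psi(C_q\times C_{q^2})}{\psi(C_{q^3})}=\frac{\psi(M(q^3))}{\psi(C_{q^3})}$, where $M(q^3)=\langle a,b\mid a^{q^2}=b^q=1,\ a^b=a^{q+1}\rangle$. (5) If $\alpha\geq 4$, then $\frac{\psi(G)}{\psi(C_n)}\leq \frac{q^{2\alpha}+q^3-q^2+1}{q^{2\alpha+1}+1}=\frac{\psi(C_q\times C_{q^{\alpha-1}})}{\psi(C_{q^{\alpha}})}$. These upper bounds are best possible, i.e. in each case, for each admissible $q$ and $\alpha$, the bound is attained by some group $G$ satisfying the hypotheses.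
   Context: For a finite group $G$, $\psi(G)=\sum_{x\in G}o(x)$, where $o(x)$ is the order of $x$. $C_t$ denotes the cyclic group of order $t$. $(a,b)$ denotes the greatest common divisor of integers $a,b$. $C_7\rtimes C_3$ denotes the non-abelian group of order $21$. $a^b=b^{-1}ab$. *)

theory Defs
  imports "HOL-Algebra.Algebra"
begin

definition psi :: "('a, 'b) monoid_scheme \<Rightarrow> nat" where
  "psi G = (\<Sum>x\<in>carrier G. group.ord G x)"

abbreviation Cyc :: "nat \<Rightarrow> int monoid" where
  "Cyc t \<equiv> integer_mod_group t"

definition psi_ratio :: "('a, 'b) monoid_scheme \<Rightarrow> nat \<Rightarrow> real" where
  "psi_ratio G n = real (psi G) / real (psi (Cyc n))"

definition smallest_prime_divisor :: "nat \<Rightarrow> nat \<Rightarrow> bool" where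
  "smallest_prime_divisor q n \<longleftrightarrow>
     Factorial_Ring.prime q \<and> q dvd n \<and> (\<forall>r. Factorial_Ring.prime r \<and> r dvd n \<longrightarrow> q \<le> r)"

definition next_prime :: "nat \<Rightarrow> nat \<Rightarrow> bool" where
  "next_prime q p \<longleftrightarrow> Factorial_Ring.prime p \<and> q < p \<and> (\<forall>r. Factorial_Ring.prime r \<and> q < r \<longrightarrow> p \<le> r)"

definition odd_noncyclic ::
    "('a, 'b) monoid_scheme \<Rightarrow> nat \<Rightarrow> nat \<Rightarrow> nat \<Rightarrow> nat \<Rightarrow> bool" where
  "odd_noncyclic G n m q \<alpha> \<longleftrightarrow>
     group G \<and> finite (carrier G) \<and> \<not> cyclic_group G \<and>
     order G = n \<and> odd n \<and> n = m * q ^ \<alpha> \<and>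
     smallest_prime_divisor q n \<and> 0 < \<alpha> \<and> coprime m q"

definition nonabelian_of_order_21 :: "('a, 'b) monoid_scheme \<Rightarrow> bool" where
  "nonabelian_of_order_21 H \<longleftrightarrow> group H \<and> order H = 21 \<and> \<not> comm_group H"

subsection \<open>Groups given by generators and relations\<close>

text \<open>A letter \<open>(g, True)\<close> stands for the generator \<open>g\<close>, and \<open>(g, False)\<close> for its formal
  inverse. A pair \<open>(u, v)\<close> in a set of relations stands for the relation \<open>u = v\<close>. The presented
  group consists of all words over the type of generators modulo the least congruence that
  contains the relations and in which formal inverses cancel.\<close>

type_synonym 'g word = "('g \<times> bool) list"

inductive pres_cong :: "('g word \<times> 'g word) set \<Rightarrow> 'g word \<Rightarrow> 'g word \<Rightarrow> bool"
  for R :: "('g word \<times> 'g word) set" where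
  rel: "(u, v) \<in> R \<Longrightarrow> pres_cong R u v"
| cancel: "pres_cong R [(g, e), (g, \<not> e)] []"
| refl: "pres_cong R u u"
| sym: "pres_cong R u v \<Longrightarrow> pres_cong R v u"
| trans: "pres_cong R u v \<Longrightarrow> pres_cong R v w \<Longrightarrow> pres_cong R u w"
| append: "pres_cong R u u' \<Longrightarrow> pres_cong R v v' \<Longrightarrow> pres_cong R (u @ v) (u' @ v')"

definition pres_class :: "('g word \<times> 'g word) set \<Rightarrow> 'g word \<Rightarrow> 'g word set" where
  "pres_class R u = {v. pres_cong R u v}"

definition presented_group :: "('g word \<times> 'g word) set \<Rightarrow> 'g word set monoid" where
  "presented_group R =
     \<lparr>carrier = range (pres_class R),
      monoid.mult = (\<lambda>U V. {w. \<exists>u\<in>U. \<exists>v\<in>V. pres_cong R (u @ v) w}),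
      one = pres_class R []\<rparr>"

lemma pres_class_eq_iff: "pres_class R u = pres_class R v \<longleftrightarrow> pres_cong R u v"
  unfolding pres_class_def using pres_cong.refl pres_cong.sym pres_cong.trans by blast

lemma presented_group_mult:
  "pres_class R u \<otimes>\<^bsub>presented_group R\<^esub> pres_class R v = pres_class R (u @ v)"
  unfolding presented_group_def pres_class_def
  by (auto intro: pres_cong.refl pres_cong.append pres_cong.trans)

lemma pres_cong_inverse:
  "pres_cong R (rev (map (\<lambda>(g, e). (g, \<not> e)) u) @ u) []"
proof (induction u)
  case Nil
  show ?case by (simp add: pres_cong.refl)
next
  case (Cons x u)
  obtain g e where x: "x = (g, e)" by (cases x)
  let ?w = "rev (map (\<lambda>(g, e). (g, \<not> e)) u)"
  have "pres_cong R ([(g, \<not> e), (g, e)] @ u) ([] @ u)"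
    using pres_cong.cancel[of R g "\<not> e"] by (intro pres_cong.append pres_cong.refl) simp
  then have "pres_cong R (?w @ [(g, \<not> e), (g, e)] @ u) (?w @ u)"
    by (intro pres_cong.append pres_cong.refl) simp
  then show ?case using Cons.IH x by (auto intro: pres_cong.trans)
qed

lemma group_presented_group: "group (presented_group R)"
proof (rule groupI)
  show "\<exists>y\<in>carrier (presented_group R). y \<otimes>\<^bsub>presented_group R\<^esub> x = \<one>\<^bsub>presented_group R\<^esub>"
    if "x \<in> carrier (presented_group R)" for x
  proof -
    from that obtain u where u: "x = pres_class R u"
      by (auto simp: presented_group_def)
    let ?y = "pres_class R (rev (map (\<lambda>(g, e). (g, \<not> e)) u))"
    have "?y \<otimes>\<^bsub>presented_group R\<^esub> x = \<one>\<^bsub>presented_group R\<^esub>"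
      unfolding u presented_group_mult
      using pres_cong_inverse[of R u] by (simp add: presented_group_def pres_class_eq_iff)
    then show ?thesis by (intro bexI[of _ ?y]) (simp_all add: presented_group_def)
  qed
next
  fix x y assume "x \<in> carrier (presented_group R)" "y \<in> carrier (presented_group R)"
  then obtain u v where "x = pres_class R u" "y = pres_class R v"
    by (auto simp: presented_group_def)
  then show "x \<otimes>\<^bsub>presented_group R\<^esub> y \<in> carrier (presented_group R)"
    by (simp add: presented_group_mult) (simp add: presented_group_def)
next
  fix x y z
  assume "x \<in> carrier (presented_group R)" "y \<in> carrier (presented_group R)"
    "z \<in> carrier (presented_group R)"
  then obtain u v w where "x = pres_class R u" "y = pres_class R v" "z = pres_class R w"
    by (auto simp: presented_group_def)
  then show "x \<otimes>\<^bsub>presented_group R\<^esub> y \<otimes>\<^bsub>presented_group R\<^esub> z =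
      x \<otimes>\<^bsub>presented_group R\<^esub> (y \<otimes>\<^bsub>presented_group R\<^esub> z)"
    by (simp add: presented_group_mult)
next
  fix x assume "x \<in> carrier (presented_group R)"
  then obtain u where u: "x = pres_class R u"
    by (auto simp: presented_group_def)
  have "pres_class R [] \<otimes>\<^bsub>presented_group R\<^esub> x = x"
    unfolding u presented_group_mult by simp
  then show "\<one>\<^bsub>presented_group R\<^esub> \<otimes>\<^bsub>presented_group R\<^esub> x = x"
    by (simp add: presented_group_def)
qed (simp add: presented_group_def)

datatype gen = Gen_a | Gen_b

text \<open>The relations are \<open>a\<^bsup>q\<^sup>2\<^esup> = 1\<close>, \<open>b\<^bsup>q\<^esup> = 1\<close> and \<open>b\<^bsup>-1\<^esup> a b = a\<^bsup>q+1\<^esup>\<close>.\<close>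

definition M_cubed :: "nat \<Rightarrow> gen word set monoid" where
  "M_cubed q = presented_group
     {(replicate (q ^ 2) (Gen_a, True), []),
      (replicate q (Gen_b, True), []),
      ([(Gen_b, False), (Gen_a, True), (Gen_b, True)], replicate (q + 1) (Gen_a, True))}"

end

(* Let P be the largest prime divisor of n = |G|. Some element has order at least psi(G)/n, so if
   psi(G)/psi(C_n) exceeds the bound, then some cyclic subgroup has index less than P. Such a
   subgroup contains every P-element, so the Sylow P-subgroup S is cyclic and normal. Then
   psi(G) <= psi(S) psi(G/S), and one inducts on G/S unless G/S is cyclic. If G/S is cyclic, some
   g in G does not centralize S, and every element of such a coset gS has only the order of gS in
   G/S; this bounds psi(G)/psi(C_n) by the value for a Frobenius group of order Pq with q dividing
   P - 1. Comparing that value with the one for C_p x C_p needs Bertrand's postulate.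

   The index estimate is too weak in two cases. When n = q p^k, the Sylow p-subgroup is normal and
   psi is summed over the centralizers of the elements of order q. When q divides n exactly once
   and P = p + 2, the estimate is sharpened by a special case of Frobenius' theorem. *)


theory Submission
  imports Defs "HOL-Number_Theory.Residues"
begin

text \<open>The passage from psi(G) to a small index rests on n^2 <= psi(C_n) R, where R is the
  product of (r+1)/r over the primes r dividing n: an index below P appears as soon as R is at most
  P times the bound. Over odd r the square of R is controlled, because ((r+1)/r)^2 <= (r+1)/(r-1)
  telescopes in steps of 2. For \<alpha> \<ge> 2 the bound exceeds 1/q, and R <= P/q is enough. For
  \<alpha> = 1 and q > 3 the bound is only about 1/p + 1/p^2, while Bertrand's postulate just places
  q between p/2 and p. With P = p + d, P times the bound is about 1 + (d+1)/p, but R may be close to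
  1 + 3/p for d = 0 and to 1 + 4/p for d = 2; this is the origin of the two exceptional cases. For d
  = 4 the number p + 2 cannot be prime, so R stays near 1 + 4/p at most, below 1 + 5/p. If G/S is
  cyclic, an odd prime r >= q divides P - 1, so P >= 2q + 1. Against p < 2q this leaves so little
  room that P = 2q + 1 with p = 2q - 1 has to be excluded modulo 3.\<close>

abbreviation nprime :: "nat \<Rightarrow> bool" where "nprime \<equiv> Factorial_Ring.prime"

section \<open>Element orders, and psi of cyclic groups and direct products\<close>

lemma ord_iso:
  assumes h: "h \<in> iso G H" and "group G" "group H" and x: "x \<in> carrier G"
  shows "group.ord H (h x) = group.ord G x"
proof -
  interpret G: group G by fact
  interpret H: group H by fact
  interpret hom: group_hom G H h
    using h by unfold_locales (auto simp: iso_def)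
  have "h (x [^]\<^bsub>G\<^esub> n) = \<one>\<^bsub>H\<^esub> \<longleftrightarrow> x [^]\<^bsub>G\<^esub> n = \<one>\<^bsub>G\<^esub>" for n :: nat
    using h x by (metis (no_types, lifting) G.nat_pow_closed G.one_closed bij_betw_def hom.hom_one inj_on_eq_iff iso_def mem_Collect_eq)
  then have "h x [^]\<^bsub>H\<^esub> n = \<one>\<^bsub>H\<^esub> \<longleftrightarrow> G.ord x dvd n" for n :: nat
    using x G.pow_eq_id by (metis hom.hom_nat_pow)
  then show ?thesis
    by (meson H.ord_unique hom.hom_closed x)
qed

lemma psi_iso:
  assumes h: "h \<in> iso G H" and "group G" "group H"
  shows "psi H = psi G"
proof -
  have "bij_betw h (carrier G) (carrier H)" using h by (simp add: iso_def)
  then have "psi H = (\<Sum>x\<in>carrier G. group.ord H (h x))"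
    unfolding psi_def by (rule sum.reindex_bij_betw [symmetric])
  then show ?thesis
    unfolding psi_def using ord_iso assms by (metis (no_types, lifting) sum.cong)
qed

text \<open>The elements of a quotient are sets, so an induction that passes to
  \<open>G Mod S\<close> would change the carrier type at each step. A copy on \<open>nat\<close>
  keeps the type fixed.\<close>

lemma (in group) finite_group_iso_nat:
  assumes fin: "finite (carrier G)"
  obtains H :: "nat monoid" and h where "group H" "h \<in> iso G H"
proof -
  obtain h :: "'a \<Rightarrow> nat" where inj: "inj_on h (carrier G)"
    using finite_imp_inj_to_nat_seg [OF fin] by metis
  define k where "k = inv_into (carrier G) h"
  have k: "k (h x) = x" if "x \<in> carrier G" for x
    using inj that by (simp add: k_def)
  define H :: "nat monoid" where
    "H = \<lparr>carrier = h ` carrier G, monoid.mult = (\<lambda>x y. h (k x \<otimes> k y)), one = h \<one>\<rparr>"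
  have "h \<in> hom G H" by (auto simp: hom_def H_def k)
  moreover have "bij_betw h (carrier G) (carrier H)"
    using inj by (auto simp: H_def bij_betw_def)
  ultimately have iso: "h \<in> iso G H" by (simp add: iso_def)
  have "group H"
  proof (rule groupI)
    fix x assume "x \<in> carrier H"
    then obtain a where a: "a \<in> carrier G" "x = h a" by (auto simp: H_def)
    then show "\<exists>y\<in>carrier H. y \<otimes>\<^bsub>H\<^esub> x = \<one>\<^bsub>H\<^esub>"
      by (intro bexI[of _ "h (inv a)"]) (auto simp: H_def k)
  qed (auto simp: H_def k m_assoc)
  with iso show ?thesis using that by blast
qed

lemma (in group) pow_eq_iff:
  assumes "x \<in> carrier G"
  shows "x [^] (i::nat) = x [^] (j::nat) \<longleftrightarrow> int (ord x) dvd int i - int j"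
  using int_pow_eq [OF assms, of "int j" "int i"] by (auto simp: int_pow_int)

lemma (in group) pow_inj:
  assumes "x \<in> carrier G"
  shows "inj_on (\<lambda>i::nat. x [^] i) {..<ord x}"
proof (rule inj_onI)
  fix i j assume "i \<in> {..<ord x}" "j \<in> {..<ord x}" "x [^] i = x [^] j"
  then have "int (ord x) dvd int i - int j" "\<bar>int i - int j\<bar> < int (ord x)"
    using pow_eq_iff [OF assms] by auto
  then show "i = j" using dvd_imp_le_int [of "int i - int j" "int (ord x)"] by force
qed

lemma (in group) pow_mod_ord:
  assumes "x \<in> carrier G"
  shows "x [^] (n mod ord x) = x [^] (n::nat)"
  unfolding pow_eq_iff [OF assms] by (metis dvd_minus_mod dvd_minus_iff minus_diff_eq of_nat_mod)

lemma (in group) cyclic_group_imp_ord: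
  assumes "finite (carrier G)" "cyclic_group G"
  shows "\<exists>x\<in>carrier G. ord x = order G"
  using assms cyclic_order_is_ord unfolding cyclic_group_def by metis

lemma (in group) full_ord_carrier:
  assumes fin: "finite (carrier G)" and x: "x \<in> carrier G" and o: "ord x = order G"
  shows "carrier G = (\<lambda>i::nat. x [^] i) ` {..<order G}"
proof (rule card_subset_eq [symmetric])
  show "card ((\<lambda>i::nat. x [^] i) ` {..<order G}) = card (carrier G)"
    using pow_inj [OF x] o by (simp add: card_image order_def)
qed (use fin x in auto)

lemma (in group) cyclic_groupI:
  assumes fin: "finite (carrier G)" and x: "x \<in> carrier G" and o: "ord x = order G"
  shows "cyclic_group G"
proof -
  have "carrier G \<subseteq> range (\<lambda>n::int. x [^] n)"
    using full_ord_carrier [OF assms] by (auto simp flip: int_pow_int)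
  then have "carrier G = range (\<lambda>n::int. x [^] n)" using x by auto
  then show ?thesis using x cyclic_group by blast
qed

lemma (in group) ord_pow_div_gcd:
  assumes "finite (carrier G)" "x \<in> carrier G"
  shows "ord (x [^] (i::nat)) = ord x div gcd (ord x) i"
  using ord_pow_gen [OF assms(2)] ord_ge_1 [OF assms] by auto

text \<open>This is psi of a cyclic group of order n: the i-th power of a generator has order n /
  gcd(n, i). It is pure arithmetic, independent of any carrier.\<close>

definition cyc_psi :: "nat \<Rightarrow> nat" where
  "cyc_psi n = (\<Sum>i<n. n div gcd n i)"

lemma (in group) psi_cyclic:
  assumes fin: "finite (carrier G)" and x: "x \<in> carrier G" and o: "ord x = order G"
  shows "psi G = cyc_psi (order G)"
proof -
  have "psi G = (\<Sum>i\<in>{..<order G}. ord (x [^] (i::nat)))"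
    unfolding psi_def full_ord_carrier [OF assms]
    using pow_inj [OF x] o by (subst sum.reindex) (auto simp: o_def)
  then show ?thesis by (simp add: cyc_psi_def ord_pow_div_gcd [OF fin x] o)
qed

lemma order_Cyc: "n > 0 \<Longrightarrow> order (Cyc n) = n"
  by (simp add: order_def carrier_integer_mod_group)

lemma finite_Cyc: "n > 0 \<Longrightarrow> finite (carrier (Cyc n))"
  by (simp add: carrier_integer_mod_group)

lemma ord_Cyc_gen:
  assumes "n > 0"
  shows "\<exists>x\<in>carrier (Cyc n). group.ord (Cyc n) x = n"
\<comment> \<open>The carrier of \<open>Cyc 1\<close> is {0}, so 1 can be the generator only for
  other n.\<close>
proof (cases "n = 1")
  case True
  then show ?thesis
    by (intro bexI[of _ 0]) (auto simp: group.ord_eq_1 [of "Cyc 1", simplified])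
next
  case False
  interpret group "Cyc n" by simp
  have one: "1 \<in> carrier (Cyc n)" using False by simp
  have "1 [^]\<^bsub>Cyc n\<^esub> k = \<one>\<^bsub>Cyc n\<^esub> \<longleftrightarrow> n dvd k" for k :: nat
    by (simp add: dvd_eq_mod_eq_0 flip: of_nat_mod)
  then show ?thesis using one ord_unique by (intro bexI[of _ 1]) auto
qed

lemma psi_Cyc:
  assumes "n > 0"
  shows "psi (Cyc n) = cyc_psi n"
  using ord_Cyc_gen [OF assms] group.psi_cyclic [OF group_integer_mod_group finite_Cyc [OF assms]]
  by (metis assms order_Cyc)

lemma DirProd_nat_pow:
  "(a, b) [^]\<^bsub>G \<times>\<times> H\<^esub> (n::nat) = (a [^]\<^bsub>G\<^esub> n, b [^]\<^bsub>H\<^esub> n)"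
  by (induction n) auto

lemma ord_DirProd:
  assumes "group G" "group H" "a \<in> carrier G" "b \<in> carrier H"
  shows "group.ord (G \<times>\<times> H) (a, b) = lcm (group.ord G a) (group.ord H b)"
proof -
  interpret G: group G by fact
  interpret H: group H by fact
  interpret GH: group "G \<times>\<times> H" by (intro DirProd_group assms)
  show ?thesis
    using assms by (subst GH.ord_unique) (auto simp: DirProd_nat_pow G.pow_eq_id H.pow_eq_id)
qed

lemma order_DirProd: "order (G \<times>\<times> H) = order G * order H"
  by (simp add: order_def card_cartesian_product)

lemma psi_DirProd:
  assumes "group G" "group H" "coprime (order G) (order H)"
  shows "psi (G \<times>\<times> H) = psi G * psi H"
proof -
  have "group.ord (G \<times>\<times> H) (a, b) = group.ord G a * group.ord H b"
    if "a \<in> carrier G" "b \<in> carrier H" for a b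
  proof -
    have "coprime (group.ord G a) (group.ord H b)"
      using assms that by (meson coprime_divisors group.ord_dvd_group_order)
    then show ?thesis using assms that by (simp add: ord_DirProd lcm_coprime)
  qed
  then have "psi (G \<times>\<times> H) = (\<Sum>(a, b)\<in>carrier G \<times> carrier H. group.ord G a * group.ord H b)"
    unfolding psi_def by (auto intro: sum.cong)
  then show ?thesis
    unfolding psi_def by (simp add: sum_product sum.cartesian_product)
qed

text \<open>Read off from a group instead of from gcds: for coprime orders a pair of generators
  generates C_a x C_b, whose psi is thus computed in two ways.\<close>

lemma cyc_psi_mult:
  assumes "coprime a b" "a > 0" "b > 0"
  shows "cyc_psi (a * b) = cyc_psi a * cyc_psi b"
proof -
  let ?G = "Cyc a \<times>\<times> Cyc b"
  interpret group ?G by (simp add: DirProd_group)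
  obtain x y where "x \<in> carrier (Cyc a)" "group.ord (Cyc a) x = a"
    "y \<in> carrier (Cyc b)" "group.ord (Cyc b) y = b"
    using ord_Cyc_gen assms by metis
  then have "ord (x, y) = order ?G" "(x, y) \<in> carrier ?G"
    using assms by (simp_all add: ord_DirProd lcm_coprime order_DirProd order_Cyc)
  moreover have "finite (carrier ?G)" using assms by (simp add: finite_Cyc)
  ultimately have "psi ?G = cyc_psi (order ?G)" using psi_cyclic by blast
  then show ?thesis
    using assms by (simp add: psi_DirProd order_DirProd order_Cyc psi_Cyc)
qed

lemma cyc_psi_1 [simp]: "cyc_psi (Suc 0) = 1"
  by (simp add: cyc_psi_def)

text \<open>The exponents divisible by r run through the subgroup of index r, which is cyclic of
  order n / r.\<close>

lemma cyc_psi_dvd_sum: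
  assumes r: "r dvd n" "n > 0"
  shows "(\<Sum>i\<in>{i. i < n \<and> r dvd i}. n div gcd n i) = cyc_psi (n div r)"
proof -
  obtain m where m: "n = r * m" using r by auto
  have pos: "r > 0" "m > 0" using m r by auto
  have "{i. i < n \<and> r dvd i} = (\<lambda>j. r * j) ` {..<m}" using m pos by auto
  moreover have "inj_on (\<lambda>j. r * j) {..<m}" using pos by (auto simp: inj_on_def)
  moreover have "r * m div gcd (r * m) (r * j) = m div gcd m j" for j
    using pos by (simp add: gcd_mult_distrib_nat [symmetric])
  ultimately show ?thesis using m pos by (simp add: sum.reindex o_def cyc_psi_def)
qed

text \<open>Exponents divisible by p give the subgroup of index p; all others give generators, which
  have full order.\<close>

lemma cyc_psi_prime_power_Suc:
  assumes p: "nprime p"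
  shows "cyc_psi (p ^ Suc k) = cyc_psi (p ^ k) + (p ^ Suc k - p ^ k) * p ^ Suc k"
proof -
  let ?n = "p ^ Suc k" let ?f = "\<lambda>i. ?n div gcd ?n i"
  have p0: "p > 0" using p prime_gt_0_nat by blast
  let ?A = "{i. i < ?n \<and> p dvd i}" let ?B = "{i. i < ?n \<and> \<not> p dvd i}"
  have "cyc_psi ?n = sum ?f (?A \<union> ?B)"
    unfolding cyc_psi_def by (rule sum.cong) auto
  also have "\<dots> = sum ?f ?A + sum ?f ?B" by (rule sum.union_disjoint) auto
  also have "sum ?f ?A = cyc_psi (p ^ k)"
    using cyc_psi_dvd_sum [of p ?n] p0 by simp
  also have "sum ?f ?B = (\<Sum>i\<in>?B. ?n)"
  proof (rule sum.cong)
    fix i assume "i \<in> ?B"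
    then have "coprime ?n i" using p by (simp add: prime_imp_coprime)
    then show "?f i = ?n" by simp
  qed simp
  also have "\<dots> = card ?B * ?n" by simp
  also have "card ?B = ?n - p ^ k"
  proof -
    have "?A = (\<lambda>j. p * j) ` {..<p ^ k}" using p0 by auto
    then have "card ?A = p ^ k" using p0 by (simp add: card_image inj_on_def)
    moreover have "card ?A + card ?B = card (?A \<union> ?B)" by (subst card_Un_disjoint) auto
    moreover have "?A \<union> ?B = {..<?n}" by auto
    ultimately show ?thesis by simp
  qed
  finally show ?thesis .
qed

lemma cyc_psi_prime_power:
  assumes p: "nprime p"
  shows "(p + 1) * cyc_psi (p ^ k) = p ^ (2 * k + 1) + 1"
proof (induction k)
  case (Suc k)
  have "p ^ k \<le> p ^ Suc k" using p prime_gt_0_nat by (simp add: Suc_leI)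
  then have "int ((p + 1) * cyc_psi (p ^ Suc k)) = int ((p + 1) * cyc_psi (p ^ k))
      + (int p + 1) * ((int p ^ Suc k - int p ^ k) * int p ^ Suc k)"
    by (simp only: cyc_psi_prime_power_Suc [OF p] of_nat_add of_nat_mult of_nat_power of_nat_1 of_nat_diff ring_distribs)
  also have "\<dots> = int (p ^ (2 * Suc k + 1) + 1)"
    unfolding Suc.IH by (simp add: algebra_simps power_add mult_2 power2_eq_square mult_2_right)
  finally show ?case by linarith
qed simp

lemma cyc_psi_prime_power_real:
  assumes p: "nprime p"
  shows "real (cyc_psi (p ^ k)) = (real p ^ (2 * k + 1) + 1) / (real p + 1)"
  using arg_cong [OF cyc_psi_prime_power [OF p, of k], of real]
  by (simp add: field_simps)

lemma cyc_psi_pos: "n > 0 \<Longrightarrow> cyc_psi n > 0"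
  unfolding cyc_psi_def
  by (rule sum_pos2 [where i = 0]) auto

subsection \<open>Normal cyclic Sylow subgroups\<close>

lemma (in group) subgroup_nat_pow_closed:
  assumes "subgroup H G" "x \<in> H"
  shows "x [^] (n::nat) \<in> H"
  using assms by (induction n) (auto simp: subgroup.one_closed subgroup.m_closed)

lemma (in group) subgroup_coprime_pow:
  assumes H: "subgroup H G" and x: "x \<in> carrier G" "x [^] (d::nat) \<in> H" "coprime d (ord x)"
  shows "x \<in> H"
proof -
  obtain e where e: "[d * e = Suc 0] (mod ord x)"
    using cong_solve_coprime_nat x(3) by blast
  have "(x [^] d) [^] e = x [^] Suc 0"
    using e x(1) by (simp only: nat_pow_pow pow_eq_iff) (metis cong_iff_dvd_diff cong_int_iff)
  then show ?thesis
    using subgroup_nat_pow_closed [OF H x(2), of e] x(1) by simp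
qed

text \<open>Pigeonhole on the cosets H t^i with i < P: two of them coincide, so H contains a power
  t^(j-i) with 0 < j - i < P. Since j - i is prime to the order of t, t is itself a power of that
  element.\<close>

lemma (in group) small_index_contains:
  assumes fin: "finite (carrier G)" and H: "subgroup H G" and P: "nprime P"
    and t: "t \<in> carrier G" "ord t = P ^ k" and idx: "card (rcosets H) < P"
  shows "t \<in> H"
proof (rule ccontr)
  assume nt: "t \<notin> H"
  have aux: False if ij: "i < j" "j < P" "H #> t [^] i = H #> t [^] j" for i j :: nat
  proof -
    have "t [^] j \<in> H #> t [^] i"
      using ij(3) rcos_self [OF _ H, of "t [^] j"] t(1) by simp
    then obtain h where h: "h \<in> H" "t [^] j = h \<otimes> t [^] i"
      by (auto simp: r_coset_def)
    have "t [^] (j - i) \<otimes> t [^] i = h \<otimes> t [^] i"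
      using h ij t(1) by (simp add: nat_pow_mult)
    then have "t [^] (j - i) \<in> H"
      using h t(1) subgroup.mem_carrier [OF H] by (metis nat_pow_closed r_cancel)
    moreover have "coprime (j - i) (ord t)"
      using ij P t(2) by (metis coprime_commute coprime_power_left_iff diff_less_mono2 dvd_imp_le
        le_less_trans less_imp_diff_less not_less prime_imp_coprime zero_less_diff)
    ultimately show False using subgroup_coprime_pow [OF H t(1)] nt by blast
  qed
  have "inj_on (\<lambda>i::nat. H #> t [^] i) {..<P}"
    by (rule inj_onI) (metis aux lessThan_iff linorder_neqE_nat)
  moreover have "(\<lambda>i::nat. H #> t [^] i) ` {..<P} \<subseteq> rcosets H"
    using t(1) rcosetsI [OF subgroup.subset [OF H]] by auto
  moreover have "finite (rcosets H)"
    using fin by (simp add: RCOSETS_def)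
  ultimately show False
    using card_inj_on_le idx by (metis card_lessThan not_less)
qed

lemma (in group) sum_powers_ord:
  assumes "finite (carrier G)" "x \<in> carrier G"
  shows "(\<Sum>u\<in>(\<lambda>i::nat. x [^] i) ` {..<ord x}. ord u) = cyc_psi (ord x)"
  using pow_inj [OF assms(2)]
  by (subst sum.reindex) (auto simp: cyc_psi_def ord_pow_div_gcd [OF assms])

lemma (in group) sum_rcosets:
  fixes f :: "'a \<Rightarrow> nat"
  assumes fin: "finite (carrier G)" and H: "subgroup H G"
  shows "(\<Sum>x\<in>carrier G. f x) = sum (\<lambda>Z. sum f Z) (rcosets H)"
proof -
  have "sum f (\<Union>(rcosets H)) = sum (\<lambda>Z. sum f Z) (rcosets H)"
  proof (rule sum.Union_disjoint [simplified o_def])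
    show "\<forall>A\<in>(rcosets H). finite A"
      using fin rcosets_part_G [OF H] by (metis Sup_upper finite_subset)
    show "\<forall>A\<in>(rcosets H). \<forall>B\<in>(rcosets H). A \<noteq> B \<longrightarrow> A \<inter> B = {}"
      using rcos_disjoint [OF H] by (auto simp: pairwise_def disjnt_def)
  qed
  then show ?thesis using rcosets_part_G [OF H] by simp
qed

lemma (in group) sum_rcoset:
  fixes f :: "'a \<Rightarrow> nat"
  assumes H: "subgroup H G" and g: "g \<in> carrier G"
  shows "(\<Sum>x\<in>H #> g. f x) = (\<Sum>u\<in>H. f (u \<otimes> g))"
proof -
  have "H #> g = (\<lambda>u. u \<otimes> g) ` H" by (auto simp: r_coset_def)
  moreover have "inj_on (\<lambda>u. u \<otimes> g) H"
    using g subgroup.mem_carrier [OF H] by (auto simp: inj_on_def)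
  ultimately show ?thesis by (simp add: sum.reindex)
qed

text \<open>If \<open>g\<close> acts on a cyclic group by \<open>c\<close>-th powers and \<open>g\<^bsup>r\<^esup> = 1\<close>, then
  \<open>(u g)\<^bsup>r\<^esup>\<close> is \<open>u\<close> to the power \<open>\<Sum>i<r. c\<^bsup>i\<^esup>\<close>.\<close>

lemma geometric_sum_dvd_cases:
  fixes c :: nat
  assumes P: "nprime P" and c: "int P ^ k dvd int c ^ r - 1" and r: "coprime r P"
  shows "int P ^ k dvd int c - 1 \<or>
    (\<not> int P dvd int c - 1 \<and> int P ^ k dvd (\<Sum>i<r. int c ^ i))"
proof -
  let ?\<sigma> = "\<Sum>i<r. int c ^ i"
  \<comment> \<open>P cannot divide both factors: if c = 1 modulo P, the geometric sum is r modulo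
    P, and r is prime to P. So one factor carries all of P^k.\<close>
  have prod: "int P ^ k dvd (int c - 1) * ?\<sigma>"
    using c by (simp add: power_diff_1_eq)
  show ?thesis
  proof (cases "int P dvd int c - 1")
    case True
    then have "[int c = 1] (mod int P)" by (simp add: cong_iff_dvd_diff)
    then have "[?\<sigma> = (\<Sum>i<r. 1 ^ i)] (mod int P)"
      by (intro cong_sum cong_pow)
    then have "[?\<sigma> = int r] (mod int P)" by simp
    then have "coprime ?\<sigma> (int P)"
      using r by (metis cong_imp_coprime cong_sym coprime_int_iff)
    then have "coprime (int P ^ k) ?\<sigma>"
      by (simp add: coprime_commute)
    then show ?thesis using prod by (simp add: coprime_dvd_mult_left_iff)
  next
    case False
    then have "coprime (int P ^ k) (int c - 1)"
      using P by (simp add: prime_imp_coprime)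
    then show ?thesis using prod False by (simp add: coprime_dvd_mult_right_iff)
  qed
qed

lemma (in group) conj_pow:
  assumes g: "g \<in> carrier G" and s: "s \<in> carrier G" and c: "g \<otimes> s = s [^] (c::nat) \<otimes> g"
  shows "g \<otimes> s [^] (i::nat) = s [^] (c * i) \<otimes> g"
proof (induction i)
  case (Suc i)
  have "g \<otimes> s [^] Suc i = (g \<otimes> s [^] i) \<otimes> s" using g s by (simp add: m_assoc)
  also have "\<dots> = s [^] (c * i) \<otimes> (g \<otimes> s)" using Suc g s by (simp add: m_assoc)
  also have "\<dots> = s [^] (c * i) \<otimes> s [^] c \<otimes> g" using c g s by (simp add: m_assoc)
  also have "\<dots> = s [^] (c * Suc i) \<otimes> g" using s by (simp add: nat_pow_mult add.commute)
  finally show ?case .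
qed (use g in simp)

lemma (in group) pow_conj:
  assumes g: "g \<in> carrier G" and s: "s \<in> carrier G" and c: "g \<otimes> s = s [^] (c::nat) \<otimes> g"
  shows "g [^] (m::nat) \<otimes> s [^] (i::nat) = s [^] (c ^ m * i) \<otimes> g [^] m"
proof (induction m arbitrary: i)
  case (Suc m)
  have "g [^] Suc m \<otimes> s [^] i = g [^] m \<otimes> (g \<otimes> s [^] i)" using g s by (simp add: m_assoc)
  also have "\<dots> = (g [^] m \<otimes> s [^] (c * i)) \<otimes> g"
    using conj_pow [OF assms] g s by (simp add: m_assoc)
  also have "\<dots> = s [^] (c ^ m * (c * i)) \<otimes> g [^] m \<otimes> g"
    using Suc by simp
  also have "\<dots> = s [^] (c ^ Suc m * i) \<otimes> g [^] Suc m"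
    using g s by (simp add: m_assoc mult_ac)
  finally show ?case .
qed (use g s in simp)

lemma (in group) twisted_pow:
  assumes g: "g \<in> carrier G" and s: "s \<in> carrier G" and c: "g \<otimes> s = s [^] (c::nat) \<otimes> g"
  shows "(s [^] (i::nat) \<otimes> g) [^] (m::nat) = s [^] (i * (\<Sum>j<m. c ^ j)) \<otimes> g [^] m"
proof (induction m)
  case (Suc m)
  let ?t = "i * (\<Sum>j<m. c ^ j)"
  have "(s [^] i \<otimes> g) [^] Suc m = s [^] ?t \<otimes> (g [^] m \<otimes> s [^] i) \<otimes> g"
    using Suc g s by (simp add: m_assoc)
  also have "\<dots> = s [^] ?t \<otimes> s [^] (c ^ m * i) \<otimes> g [^] m \<otimes> g"
    using pow_conj [OF assms] g s by (simp add: m_assoc)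
  also have "\<dots> = s [^] (i * (\<Sum>j<Suc m. c ^ j)) \<otimes> g [^] Suc m"
    using g s by (simp add: nat_pow_mult m_assoc algebra_simps)
  finally show ?case .
qed (use g s in simp)

text \<open>The generator \<open>s\<close> is part of the data because conjugation by g is recorded
  as an exponent c with g s = s^c g, and the arguments below are congruences for c.\<close>

locale normal_cyclic_sylow = group G for G (structure) +
  fixes S s P k N
  assumes fin: "finite (carrier G)" and P: "nprime P"
    and s: "s \<in> carrier G" "ord s = P ^ k" and S_def: "S = (\<lambda>i::nat. s [^] i) ` {..<P ^ k}"
    and S_normal: "S \<lhd> G" and order_G: "order G = P ^ k * N" and cop: "coprime P N"
begin

lemma S_subgroup: "subgroup S G" using S_normal normal_imp_subgroup by blast

lemma P_gt_1: "P > 1" using P prime_gt_1_nat by blast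

lemma N_pos: "N > 0"
  using order_G fin by (metis gr0I mult_0_right order_gt_0_iff_finite less_irrefl)

lemma card_S: "card S = P ^ k"
  unfolding S_def using pow_inj [OF s(1)] s(2) by (simp add: card_image)

lemma S_iff: "u \<in> S \<longleftrightarrow> (\<exists>i::nat. u = s [^] i)"
proof
  assume "\<exists>i::nat. u = s [^] i"
  then obtain i :: nat where "u = s [^] (i mod P ^ k)"
    using pow_mod_ord [OF s(1)] s(2) by metis
  then show "u \<in> S" unfolding S_def using P_gt_1 by auto
qed (auto simp: S_def)

lemma sum_S: "(\<Sum>u\<in>S. ord u) = cyc_psi (P ^ k)"
  unfolding S_def using sum_powers_ord [OF fin s(1)] s(2) by simp

lemma order_quotient: "order (G Mod S) = N"
  using lagrange [OF S_subgroup] order_G card_S P_gt_1 by (simp add: order_def FactGroup_def)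

sublocale Q: group "G Mod S"
  using normal.factorgroup_is_group [OF S_normal] .

lemma fin_quotient: "finite (carrier (G Mod S))"
  using order_quotient N_pos Q.order_gt_0_iff_finite by metis

lemma rcos_pow: "g \<in> carrier G \<Longrightarrow> (S #> g) [^]\<^bsub>G Mod S\<^esub> (n::nat) = S #> g [^] n"
  using normal.FactGroup_pow [OF S_normal] .

text \<open>A power e with e = 1 modulo N and e = 0 modulo P^k keeps a representative in its coset
  and removes the P-part of its order. So no complement of S has to be constructed.\<close>

lemma coset_rep:
  assumes Z: "Z \<in> carrier (G Mod S)"
  obtains g where "g \<in> carrier G" "Z = S #> g" "ord g = Q.ord Z"
proof -
  obtain g0 where g0: "g0 \<in> carrier G" "Z = S #> g0"
    using Z by (auto simp: carrier_FactGroup)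
  have copN: "coprime N (P ^ k)" using cop by (simp add: coprime_commute)
  obtain e where e: "[e = 1] (mod N)" "[e = 0] (mod (P ^ k))"
    using binary_chinese_remainder_nat [OF copN] by blast
  have oZ: "Q.ord Z dvd N" using Q.ord_dvd_group_order [OF Z] order_quotient by simp
  define g where "g = g0 [^] e"
  have g: "g \<in> carrier G" using g0 g_def by simp
  have "Z [^]\<^bsub>G Mod S\<^esub> e = Z [^]\<^bsub>G Mod S\<^esub> (1::nat)"
    using e(1) oZ Z by (simp only: Q.pow_eq_iff) (metis cong_iff_dvd_diff cong_int_iff dvd_trans of_nat_dvd_iff)
  then have Z': "Z = S #> g"
    using Z g0 rcos_pow [OF g0(1), of e] by (simp only: Q.nat_pow_eone g_def)
  have "g0 [^] (e * N) = \<one>"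
    using e(2) g0(1) order_G by (metis cong_0_iff dvd_trans mult_dvd_mono dvd_refl ord_dvd_group_order pow_eq_id)
  then have ogN: "ord g dvd N"
    using g g0(1) by (simp add: g_def nat_pow_pow flip: pow_eq_id)
  have "Q.ord Z dvd ord g"
  proof -
    have "Z [^]\<^bsub>G Mod S\<^esub> ord g = \<one>\<^bsub>G Mod S\<^esub>"
      using g Z' coset_join2 [OF one_closed S_subgroup] subgroup.one_closed [OF S_subgroup]
      by (simp add: rcos_pow)
    then show ?thesis using Q.pow_eq_id Z by blast
  qed
  moreover have "ord g dvd Q.ord Z"
  proof -
    let ?r = "Q.ord Z"
    have "S #> g [^] ?r = S"
      using Z Z' g rcos_pow [OF g, of ?r] Q.pow_ord_eq_1 by simp
    then have "g [^] ?r \<in> S"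
      using g rcos_self [OF _ S_subgroup] by (metis nat_pow_closed)
    then obtain i where i: "g [^] ?r = s [^] (i::nat)" using S_iff by blast
    have "ord (g [^] ?r) dvd P ^ k"
      unfolding i using s by (metis nat_pow_closed pow_eq_id nat_pow_pow mult.commute nat_pow_one pow_ord_eq_1)
    moreover have "ord (g [^] ?r) dvd N"
    proof -
      have "g [^] (?r * N) = \<one>" using ogN by (simp add: pow_eq_id [OF g])
      then have "(g [^] ?r) [^] N = \<one>" using g by (simp add: nat_pow_pow)
      then show ?thesis using g pow_eq_id by simp
    qed
    ultimately have "ord (g [^] ?r) = 1"
      using coprime_common_divisor [OF copN] by simp
    then have "g [^] ?r = \<one>" using g ord_eq_1 by simp
    then show ?thesis using g pow_eq_id by blast
  qed
  ultimately have "ord g = Q.ord Z" by (simp add: dvd_antisym)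
  then show ?thesis using that g Z' by blast
qed

lemma conj_exponent:
  assumes g: "g \<in> carrier G"
  obtains c :: nat where "g \<otimes> s = s [^] c \<otimes> g"
proof -
  have "s \<in> S" unfolding S_iff by (rule exI[of _ 1]) (use s in simp)
  then have "g \<otimes> s \<otimes> inv g \<in> S" using normal.inv_op_closed2 [OF S_normal g] by blast
  then obtain c where "g \<otimes> s \<otimes> inv g = s [^] (c::nat)" using S_iff by blast
  then have "g \<otimes> s = s [^] c \<otimes> g"
    using g s by (metis inv_solve_right m_closed nat_pow_closed)
  then show ?thesis using that by blast
qed

text \<open>The power (u g)^(ord g) equals u raised to 1 + c + ... + c^(ord g - 1). If g does not
  centralize s, this geometric sum is divisible by P^k, so the power is trivial.\<close>

lemma twisted_ord:
  assumes g: "g \<in> carrier G" and gN: "ord g dvd N" and u: "u \<in> S"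
  shows "ord (u \<otimes> g) dvd ord u * ord g"
    and "g \<otimes> s \<noteq> s \<otimes> g \<Longrightarrow> ord (u \<otimes> g) dvd ord g"
proof -
  obtain i where i: "u = s [^] (i::nat)" using u S_iff by blast
  obtain c :: nat where c: "g \<otimes> s = s [^] c \<otimes> g" using conj_exponent [OF g] by blast
  define \<sigma> where "\<sigma> = (\<Sum>j\<in>{..<ord g}. c ^ j)"
  have uG: "u \<in> carrier G" and ug: "u \<otimes> g \<in> carrier G" using i s g by auto
  have pow: "(u \<otimes> g) [^] ord g = u [^] \<sigma>"
    using twisted_pow [OF g s(1) c, of i "ord g"] g s i by (simp add: \<sigma>_def nat_pow_pow)
  have "(u \<otimes> g) [^] (ord u * ord g) = ((u \<otimes> g) [^] ord g) [^] ord u"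
    using ug by (simp add: nat_pow_pow mult.commute)
  also have "\<dots> = (u [^] ord u) [^] \<sigma>"
    unfolding pow nat_pow_pow [OF uG] by (simp add: mult.commute)
  also have "\<dots> = \<one>" using uG by simp
  finally show "ord (u \<otimes> g) dvd ord u * ord g" using ug pow_eq_id by blast
  assume nc: "g \<otimes> s \<noteq> s \<otimes> g"
  \<comment> \<open>The trivial element g^(ord g) acts trivially on s, so c^(ord g) = 1 modulo
    P^k.\<close>
  have "s [^] (c ^ ord g) = s [^] (1::nat)"
    using pow_conj [OF g s(1) c, of "ord g" 1] g s by simp
  then have "int P ^ k dvd int c ^ ord g - 1"
    using s by (simp only: pow_eq_iff) simp
  moreover have "coprime (ord g) P"
    using gN cop by (metis coprime_commute coprime_divisors dvd_refl)
  moreover have "\<not> int P ^ k dvd int c - 1"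
  proof
    assume "int P ^ k dvd int c - 1"
    then have "s [^] c = s [^] (1::nat)" using s by (simp only: pow_eq_iff) simp
    then show False using nc c s by simp
  qed
  ultimately have "int P ^ k dvd (\<Sum>j\<in>{..<ord g}. int c ^ j)"
    using geometric_sum_dvd_cases [OF P] by blast
  then have "int (P ^ k) dvd int \<sigma>" by (simp add: \<sigma>_def)
  then have "P ^ k dvd \<sigma>" by (simp only: of_nat_dvd_iff)
  then have "s [^] \<sigma> = \<one>" using s pow_eq_id by simp
  then have "u [^] \<sigma> = \<one>" using i s by (metis mult.commute nat_pow_one nat_pow_pow)
  then show "ord (u \<otimes> g) dvd ord g" using pow ug pow_eq_id by simp
qed

lemma coset_sum_le:
  assumes g: "g \<in> carrier G" and gN: "ord g dvd N"
  shows "(\<Sum>u\<in>S. ord (u \<otimes> g)) \<le> ord g * cyc_psi (P ^ k)"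
    and "g \<otimes> s \<noteq> s \<otimes> g \<Longrightarrow> (\<Sum>u\<in>S. ord (u \<otimes> g)) \<le> ord g * P ^ k"
proof -
  have uG: "u \<in> carrier G" if "u \<in> S" for u
    using that subgroup.mem_carrier [OF S_subgroup] by blast
  have pos: "ord x > 0" if "x \<in> carrier G" for x
    using ord_ge_1 [OF fin that] by simp
  have "(\<Sum>u\<in>S. ord (u \<otimes> g)) \<le> (\<Sum>u\<in>S. ord u * ord g)"
    using twisted_ord(1) [OF g gN] uG pos g by (intro sum_mono dvd_imp_le) auto
  also have "\<dots> = ord g * cyc_psi (P ^ k)"
    by (simp add: sum_distrib_right [symmetric] sum_S)
  finally show "(\<Sum>u\<in>S. ord (u \<otimes> g)) \<le> ord g * cyc_psi (P ^ k)" .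
  assume nc: "g \<otimes> s \<noteq> s \<otimes> g"
  have "(\<Sum>u\<in>S. ord (u \<otimes> g)) \<le> (\<Sum>u\<in>S. ord g)"
    using twisted_ord(2) [OF g gN _ nc] pos g by (intro sum_mono dvd_imp_le) auto
  then show "(\<Sum>u\<in>S. ord (u \<otimes> g)) \<le> ord g * P ^ k"
    by (simp add: card_S mult.commute)
qed

lemma psi_sum_cosets: "psi G = sum (\<lambda>Z. sum ord Z) (carrier (G Mod S))"
  unfolding psi_def sum_rcosets [OF fin S_subgroup] by (simp add: FactGroup_def)

lemma psi_le_quotient: "psi G \<le> cyc_psi (P ^ k) * psi (G Mod S)"
proof -
  have "sum ord Z \<le> cyc_psi (P ^ k) * Q.ord Z" if Z: "Z \<in> carrier (G Mod S)" for Z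
  proof -
    obtain g where g: "g \<in> carrier G" "Z = S #> g" "ord g = Q.ord Z"
      using coset_rep [OF Z] by blast
    have "Q.ord Z dvd N" using Q.ord_dvd_group_order [OF Z] order_quotient by simp
    then show ?thesis
      using coset_sum_le(1) [OF g(1)] g sum_rcoset [OF S_subgroup g(1), of ord]
      by (simp add: mult.commute)
  qed
  then show ?thesis
    unfolding psi_sum_cosets psi_def [of "G Mod S"] sum_distrib_left by (rule sum_mono)
qed

text \<open>The exponents i for which g^i centralizes s are the multiples of their least positive
  member d, which divides N and is not 1. Any prime factor r of d divides all of them, which limits
  the number of cosets where the weaker estimate must be used.\<close>

lemma commuting_exponents:
  assumes g: "g \<in> carrier G" and nc: "g \<otimes> s \<noteq> s \<otimes> g" and gN: "g [^] N \<otimes> s = s \<otimes> g [^] N"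
  obtains r where "nprime r" "r dvd N" "\<And>i::nat. g [^] i \<otimes> s = s \<otimes> g [^] i \<Longrightarrow> r dvd i"
proof -
  define C where "C i \<longleftrightarrow> g [^] i \<otimes> s = s \<otimes> g [^] i" for i :: nat
  have add: "C i \<longleftrightarrow> C (i + j)" if "C j" for i j
  proof -
    have "g [^] (i + j) \<otimes> s = g [^] i \<otimes> s \<otimes> g [^] j"
      using that g s by (simp add: C_def m_assoc flip: nat_pow_mult)
    moreover have "s \<otimes> g [^] (i + j) = s \<otimes> g [^] i \<otimes> g [^] j"
      using g s by (simp add: m_assoc flip: nat_pow_mult)
    ultimately show ?thesis using g s by (simp add: C_def)
  qed
  define d where "d = (LEAST i. i > 0 \<and> C i)"
  have "N > 0 \<and> C N" using N_pos gN by (simp add: C_def)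
  then have d: "d > 0" "C d" using LeastI [of "\<lambda>i. i > 0 \<and> C i" N] by (auto simp: d_def)
  have mult: "C (j + d * i) \<longleftrightarrow> C j" for i j
  proof (induction i)
    case (Suc i)
    have "j + d * Suc i = j + d * i + d" by simp
    then show ?case using add [OF d(2), of "j + d * i"] Suc by metis
  qed simp
  have dvd: "d dvd i" if "C i" for i
  proof -
    have "C (i mod d)" using mult [of "i mod d" "i div d"] that by simp
    moreover have "\<not> (0 < j \<and> C j)" if "j < d" for j
      using not_less_Least [of j "\<lambda>i. i > 0 \<and> C i"] that by (simp add: d_def)
    ultimately show ?thesis using d(1) by (metis dvd_eq_mod_eq_0 gr0I mod_less_divisor)
  qed
  have "d \<noteq> 1" using d nc g by (auto simp: C_def)
  then obtain r where r: "nprime r" "r dvd d" using prime_factor_nat by blast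
  show ?thesis
  proof
    show "r dvd N" using dvd [of N] r gN by (auto simp: C_def intro: dvd_trans)
    show "r dvd i" if "g [^] i \<otimes> s = s \<otimes> g [^] i" for i :: nat
      using dvd [of i] r that by (auto simp: C_def intro: dvd_trans)
  qed (use r in blast)
qed

text \<open>Modulo P the exponent c of the action satisfies c^N = 1 and c^(P-1) = 1, but not c = 1,
  so N and P - 1 have a common prime. This is what later forces P to be large compared with
  q.\<close>

lemma prime_dvd_index_pred:
  assumes g: "g \<in> carrier G" and nc: "g \<otimes> s \<noteq> s \<otimes> g" and gN: "ord g = N"
  obtains r where "nprime r" "r dvd N" "r dvd P - 1"
proof -
  obtain c :: nat where c: "g \<otimes> s = s [^] c \<otimes> g" using conj_exponent [OF g] by blast
  have "s [^] (c ^ N) = s [^] (1::nat)"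
    using pow_conj [OF g s(1) c, of N 1] g s gN pow_ord_eq_1 [OF g] by simp
  then have cN: "int P ^ k dvd int c ^ N - 1"
    using s by (simp only: pow_eq_iff) simp
  have ncP: "\<not> int P ^ k dvd int c - 1"
  proof
    assume "int P ^ k dvd int c - 1"
    then have "s [^] c = s [^] (1::nat)" using s by (simp only: pow_eq_iff) simp
    then show False using nc c s by simp
  qed
  \<comment> \<open>An action that is trivial modulo P but not modulo P^k would have order divisible
    by P, against c^N = 1 with N prime to P.\<close>
  then have ndvd: "\<not> int P dvd int c - 1"
    using geometric_sum_dvd_cases [OF P cN] cop by (metis coprime_commute)
  have k0: "k > 0" using ncP by (rule_tac ccontr) simp
  then have "int P dvd int P ^ k" by simp
  then have "int P dvd int c ^ N - 1" using cN dvd_trans by blast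
  then have cN1: "[c ^ N = 1] (mod P)"
    by (metis cong_iff_dvd_diff cong_int_iff of_nat_1 of_nat_power)
  have "\<not> P dvd c"
  proof
    assume "P dvd c"
    then have "[c ^ N = 0] (mod P)" using N_pos by (simp add: cong_0_iff dvd_power_same dvd_power dvd_trans [of P c "c ^ N"])
    then have "[1 = 0] (mod P)" using cN1 cong_trans cong_sym by blast
    then show False using P_gt_1 by (simp add: cong_def)
  qed
  then have cP1: "[c ^ (P - 1) = 1] (mod P)" using fermat_theorem [OF P] by simp
  have "\<not> coprime N (P - 1)"
  proof
    assume "coprime N (P - 1)"
    then obtain a b where ab: "N * a = (P - 1) * b + 1"
      using bezout_nat [of N "P - 1"] N_pos by (metis coprime_iff_gcd_eq_1 less_irrefl)
    have "[c ^ (N * a) = 1] (mod P)" using cong_pow [OF cN1, of a] by (simp add: power_mult)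
    moreover have "[c ^ ((P - 1) * b + 1) = 1 * c] (mod P)"
      using cong_mult [OF cong_pow [OF cP1, of b] cong_refl [of c]]
      by (simp only: power_add power_mult power_one power_one_right)
    ultimately have "[c = 1] (mod P)" unfolding ab by (metis cong_sym cong_trans mult_1)
    then have "[int c = int 1] (mod int P)" using cong_int_iff by blast
    then show False using ndvd by (simp add: cong_iff_dvd_diff)
  qed
  then have "gcd N (P - 1) \<noteq> 1" by (simp add: coprime_iff_gcd_eq_1)
  then obtain r where "nprime r" "r dvd gcd N (P - 1)" using prime_factor_nat by blast
  then show ?thesis using that by auto
qed

text \<open>Subtraction-free form of psi(G) <= P^k (psi(C_N) - psi(C_(N/r))) + psi(C_(P^k))
  psi(C_(N/r)): only the cosets of g^i with r dividing i may centralize s, and in all others no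
  element has a larger order than g^i. The prime r counts cosets, r' bounds P from below; the two
  are obtained separately.\<close>

lemma psi_le_cyclic_quotient:
  assumes Z: "Z \<in> carrier (G Mod S)" "Q.ord Z = N" and ncyc: "\<not> cyclic_group G"
  obtains r r' where "nprime r" "r dvd N" "nprime r'" "r' dvd N" "r' dvd P - 1"
    "psi G + P ^ k * cyc_psi (N div r) \<le> P ^ k * cyc_psi N + cyc_psi (P ^ k) * cyc_psi (N div r)"
proof -
  obtain g where g: "g \<in> carrier G" "Z = S #> g" "ord g = N"
    using coset_rep [OF Z(1)] Z(2) by metis
  \<comment> \<open>Otherwise g s would have order N P^k and generate G.\<close>
  have nc: "g \<otimes> s \<noteq> s \<otimes> g"
  proof
    assume comm: "g \<otimes> s = s \<otimes> g"
    have copk: "coprime N (P ^ k)" using cop by (simp add: coprime_commute)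
    have gs: "g \<otimes> s \<in> carrier G" using g s by simp
    let ?o = "ord (g \<otimes> s)"
    have e: "g [^] ?o \<otimes> s [^] ?o = \<one>"
      using pow_mult_distrib [OF comm g(1) s(1), of ?o] gs by simp
    have "(g [^] ?o \<otimes> s [^] ?o) [^] N = g [^] (?o * N) \<otimes> s [^] (?o * N)"
      using pow_mult_distrib [OF comm g(1) s(1)] gs e by (metis nat_pow_pow)
    then have "s [^] (?o * N) = \<one>"
      using e g s by (metis dvd_triv_right l_one nat_pow_closed nat_pow_one pow_eq_id)
    then have "P ^ k dvd ?o * N" using s pow_eq_id by simp
    then have Pk: "P ^ k dvd ?o" using copk by (simp add: coprime_commute coprime_dvd_mult_left_iff)
    then have "s [^] ?o = \<one>" using s pow_eq_id by simp
    then have "g [^] ?o = \<one>" using e g(1) by simp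
    then have "N dvd ?o" using g(1,3) pow_eq_id by blast
    then have "order G dvd ?o"
      unfolding order_G using Pk copk by (metis coprime_commute divides_mult)
    then have "?o = order G" using ord_dvd_group_order [OF gs] dvd_antisym by blast
    then show False using ncyc cyclic_groupI [OF fin gs] by blast
  qed
  obtain r where r: "nprime r" "r dvd N" "\<And>i::nat. g [^] i \<otimes> s = s \<otimes> g [^] i \<Longrightarrow> r dvd i"
    using commuting_exponents [OF g(1) nc] g s by (metis l_one pow_ord_eq_1 r_one)
  obtain r' where r': "nprime r'" "r' dvd N" "r' dvd P - 1"
    using prime_dvd_index_pred [OF g(1) nc g(3)] by blast
  have car: "carrier (G Mod S) = (\<lambda>i::nat. S #> g [^] i) ` {..<N}"
    using Q.full_ord_carrier [OF fin_quotient Z(1)] Z(2) order_quotient g rcos_pow [OF g(1)] by simp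
  have inj: "inj_on (\<lambda>i::nat. S #> g [^] i) {..<N}"
    using Q.pow_inj [OF Z(1)] Z(2) g rcos_pow [OF g(1)] by simp
  define o' where "o' i = N div gcd N i" for i
  have og: "ord (g [^] i) = o' i" for i :: nat
    using ord_pow_div_gcd [OF fin g(1)] g(3) by (simp add: o'_def)
  have "o' i dvd N" for i unfolding o'_def by (metis dvd_div_mult_self dvd_triv_left gcd_dvd1)
  then have *: "sum ord (S #> g [^] i) \<le> o' i * (if r dvd i then cyc_psi (P ^ k) else P ^ k)" for i
    using coset_sum_le [of "g [^] i"] r(3) [of i] g og sum_rcoset [OF S_subgroup, of "g [^] i" ord] by auto
  have "psi G = (\<Sum>i<N. sum ord (S #> g [^] i))"
    unfolding psi_sum_cosets car using inj by (simp add: sum.reindex)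
  also have "\<dots> \<le> (\<Sum>i<N. o' i * (if r dvd i then cyc_psi (P ^ k) else P ^ k))"
    by (rule sum_mono) (rule *)
  finally have le: "psi G \<le> (\<Sum>i<N. o' i * (if r dvd i then cyc_psi (P ^ k) else P ^ k))" .
  have sub: "(\<Sum>i<N. if r dvd i then o' i else 0) = cyc_psi (N div r)"
    using cyc_psi_dvd_sum [OF r(2) N_pos] by (simp add: o'_def flip: sum.inter_filter)
  have "(\<Sum>i<N. o' i * (if r dvd i then cyc_psi (P ^ k) else P ^ k)) + P ^ k * cyc_psi (N div r)
      = (\<Sum>i<N. P ^ k * o' i + cyc_psi (P ^ k) * (if r dvd i then o' i else 0))"
    unfolding sub [symmetric] sum_distrib_left sum.distrib [symmetric]
    by (rule sum.cong) auto
  also have "\<dots> = P ^ k * cyc_psi N + cyc_psi (P ^ k) * cyc_psi (N div r)"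
    unfolding sum.distrib sum_distrib_left [symmetric] sub by (simp add: cyc_psi_def o'_def)
  finally have "psi G + P ^ k * cyc_psi (N div r) \<le> P ^ k * cyc_psi N + cyc_psi (P ^ k) * cyc_psi (N div r)"
    using le by linarith
  then show ?thesis using that [OF r(1,2) r'] by blast
qed

end

section \<open>A normal cyclic Sylow subgroup from an element of large order\<close>

lemma (in group) conj_nat_pow:
  assumes "g \<in> carrier G" "x \<in> carrier G"
  shows "(g \<otimes> x \<otimes> inv g) [^] (n::nat) = g \<otimes> x [^] n \<otimes> inv g"
proof (induction n)
  case (Suc n)
  then show ?case using assms
    by (simp add: m_assoc) (simp add: m_assoc [symmetric])
qed (use assms in simp)

lemma (in group) powers_subgroup:
  assumes "finite (carrier G)" "x \<in> carrier G"
  shows "subgroup ((\<lambda>i::nat. x [^] i) ` {..<ord x}) G"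
proof -
  have "(\<lambda>i::nat. x [^] i) ` {..<ord x} = {x [^] i | i. i \<in> {0..ord x - 1}}"
    using ord_ge_1 [OF assms] by (auto simp: image_def)
  then show ?thesis using element_generates_subgroup [OF assms] by simp
qed

lemma (in group) powers_iff:
  assumes "finite (carrier G)" "x \<in> carrier G"
  shows "u \<in> (\<lambda>i::nat. x [^] i) ` {..<ord x} \<longleftrightarrow> (\<exists>i::nat. u = x [^] i)"
proof
  assume "\<exists>i::nat. u = x [^] i"
  then obtain i :: nat where "u = x [^] (i mod ord x)"
    using pow_mod_ord [OF assms(2)] by metis
  then show "u \<in> (\<lambda>i::nat. x [^] i) ` {..<ord x}"
    using ord_ge_1 [OF assms] by auto
qed auto

lemma (in group) card_powers:
  "x \<in> carrier G \<Longrightarrow> card ((\<lambda>i::nat. x [^] i) ` {..<ord x}) = ord x"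
  using pow_inj by (simp add: card_image)

text \<open>The index of <x> is below P, hence prime to P, so P^k divides ord x and <x> contains a
  subgroup S of order P^k. Conjugates of elements of S are again P-elements, so they lie in <x>, and
  a cyclic group has only one subgroup of order P^k.\<close>

lemma (in group) normal_cyclic_sylow_of_small_index:
  assumes fin: "finite (carrier G)" and P: "nprime P" and x: "x \<in> carrier G"
    and o: "order G = P ^ k * N" and cop: "coprime P N" and idx: "order G < P * ord x"
  obtains S s where "normal_cyclic_sylow G S s P k N"
proof -
  define H where "H = (\<lambda>i::nat. x [^] i) ` {..<ord x}"
  have H: "subgroup H G" unfolding H_def by (rule powers_subgroup [OF fin x])
  let ?i = "card (rcosets H)"
  have lag: "?i * ord x = order G"
    using lagrange [OF H] card_powers [OF x] by (simp add: H_def)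
  have ox: "ord x > 0" using ord_ge_1 [OF fin x] by simp
  have iP: "?i < P" using idx unfolding lag [symmetric] by simp
  have "?i > 0" using lag fin ox by (metis gr0I mult_0 order_gt_0_iff_finite less_irrefl)
  then have "coprime (P ^ k) ?i"
    using iP P by (metis coprime_power_left_iff nat_dvd_not_less prime_imp_coprime)
  moreover have "P ^ k dvd ?i * ord x" using lag o by simp
  ultimately have Pk: "P ^ k dvd ord x" by (simp add: coprime_dvd_mult_right_iff)
  then obtain d where d: "ord x = P ^ k * d" by auto
  have d0: "d > 0" using d ox by (metis gr0I mult_0_right less_irrefl)
  define s where "s = x [^] d"
  have s: "s \<in> carrier G" "ord s = P ^ k"
    using x d d0 by (auto simp: s_def ord_pow)
  define S where "S = (\<lambda>i::nat. s [^] i) ` {..<P ^ k}"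
  have S: "subgroup S G" using powers_subgroup [OF fin s(1)] s(2) by (simp add: S_def)
  have S_iff: "u \<in> S \<longleftrightarrow> (\<exists>i::nat. u = s [^] i)" for u
    using powers_iff [OF fin s(1)] s(2) by (simp add: S_def)
  have "g \<otimes> u \<otimes> inv g \<in> S" if g: "g \<in> carrier G" and u: "u \<in> S" for g u
  proof -
    have uG: "u \<in> carrier G" using subgroup.mem_carrier [OF S u] .
    let ?t = "g \<otimes> u \<otimes> inv g"
    have tG: "?t \<in> carrier G" using g uG by simp
    obtain i where "u = s [^] (i::nat)" using u S_iff by blast
    then have "u [^] (P ^ k) = \<one>"
      using s by (metis mult.commute nat_pow_one nat_pow_pow pow_ord_eq_1)
    then have t1: "?t [^] (P ^ k) = \<one>" using conj_nat_pow [OF g uG] g by simp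
    then have "ord ?t dvd P ^ k" using tG pow_eq_id by blast
    then obtain j where "ord ?t = P ^ j" using P by (metis divides_primepow_nat)
    then have "?t \<in> H" using small_index_contains [OF fin H P tG _ iP] by blast
    then obtain m where m: "?t = x [^] (m::nat)" by (auto simp: H_def)
    \<comment> \<open>An element of <x> that is killed by P^k is a power of s = x^d.\<close>
    then have "ord x dvd m * P ^ k" using t1 x by (simp add: nat_pow_pow pow_eq_id)
    then have "d dvd m" using d P prime_gt_0_nat [OF P] by (simp add: mult.commute)
    then obtain l where "m = d * l" by auto
    then have "?t = s [^] l" using m x by (simp add: s_def nat_pow_pow)
    then show ?thesis using S_iff by blast
  qed
  then have "S \<lhd> G" using S normal_inv_iff by blast
  then have "normal_cyclic_sylow G S s P k N"
    using fin P s S_def o cop is_group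
    by (intro normal_cyclic_sylow.intro normal_cyclic_sylow_axioms.intro)
  then show ?thesis using that by blast
qed

subsection \<open>Groups of odd prime power order\<close>

text \<open>With c = 1 + q w one has c^j = 1 + j q w modulo q^2, and the sum of all j < q is q
  (q-1)/2, a multiple of q because q is odd. For q = 2 the congruence fails, as c = 3 shows.\<close>

lemma prime_geometric_sum:
  fixes c :: nat
  assumes q: "odd q" and c: "[c = 1] (mod q)"
  shows "[(\<Sum>j<q. c ^ j) = q] (mod q\<^sup>2)"
proof -
  obtain w where w: "int c = 1 + int q * w"
    using c by (metis add.commute cong_iff_lin cong_int_iff cong_sym of_nat_1)
  have "[int c ^ j = 1 + int j * (int q * w)] (mod (int q)\<^sup>2)" for j
  proof (induction j)
    case (Suc j)
    have "[int c ^ Suc j = (1 + int j * (int q * w)) * int c] (mod (int q)\<^sup>2)"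
      using cong_mult [OF Suc cong_refl [of "int c"]] by (simp add: mult.commute)
    moreover have "(1 + int j * (int q * w)) * int c - (1 + int (Suc j) * (int q * w)) = (int q)\<^sup>2 * (int j * w * w)"
      unfolding w by (simp add: algebra_simps power2_eq_square)
    ultimately show ?case by (metis cong_iff_dvd_diff cong_trans dvd_triv_left)
  qed simp
  then have "[(\<Sum>j<q. int c ^ j) = (\<Sum>j<q. 1 + int j * (int q * w))] (mod (int q)\<^sup>2)"
    by (rule cong_sum)
  moreover have "(\<Sum>j<q. 1 + int j * (int q * w)) = int q + (\<Sum>j<q. int j) * (int q * w)"
    by (simp add: sum.distrib sum_distrib_right)
  moreover have "(\<Sum>j<q. int j) = int q * ((int q - 1) div 2)"
  proof -
    obtain t where t: "q = 2 * t + 1" using q oddE by blast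
    have "(\<Sum>j<n. int j) * 2 = int n * (int n - 1)" for n
      by (induction n) (auto simp: algebra_simps)
    from this [of q] show ?thesis unfolding t by simp
  qed
  ultimately have "[(\<Sum>j<q. int c ^ j) = int q + (int q)\<^sup>2 * (((int q - 1) div 2) * w)] (mod (int q)\<^sup>2)"
    by (simp add: power2_eq_square mult_ac)
  then have "[(\<Sum>j<q. int c ^ j) = int q] (mod (int q)\<^sup>2)"
    by (metis cong_add_rcancel_0 cong_mult_self_left cong_trans cong_add_lcancel_0)
  then have "[int (\<Sum>j<q. c ^ j) = int q] (mod int (q\<^sup>2))" by simp
  then show ?thesis using cong_int_iff by blast
qed

lemma sum_periodic:
  fixes F :: "nat \<Rightarrow> nat"
  assumes "\<And>j. F (j + n) = F j"
  shows "(\<Sum>j<q * n. F j) = q * (\<Sum>j<n. F j)"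
proof (induction q)
  case (Suc q)
  have per: "F (q * n + j) = F j" for j
  proof (induction q)
    case (Suc q)
    have "Suc q * n + j = q * n + j + n" by simp
    then show ?case using assms [of "q * n + j"] Suc by metis
  qed simp
  have split: "(\<Sum>j<a + b. F j) = (\<Sum>j<a. F j) + (\<Sum>j<b. F (a + j))" for a b
    by (induction b) auto
  have "Suc q * n = q * n + n" by simp
  then show ?case using Suc per split [of "q * n" n] by (simp only: mult_Suc add.commute)
qed simp

lemma bij_betw_affine_mod:
  assumes "coprime t N" "(N::nat) > 0"
  shows "bij_betw (\<lambda>i. (i * t + f) mod N) {..<N} {..<N}"
proof -
  have "inj_on (\<lambda>i. (i * t + f) mod N) {..<N}"
  proof (rule inj_onI)
    fix i j assume ij: "i \<in> {..<N}" "j \<in> {..<N}" "(i * t + f) mod N = (j * t + f) mod N"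
    then have "[i * t + f = j * t + f] (mod N)" by (simp add: cong_def)
    then have "[i = j] (mod N)"
      using assms(1) by (simp add: cong_add_rcancel_nat cong_mult_rcancel_nat coprime_commute)
    then show "i = j" using ij by (simp add: cong_def)
  qed
  moreover have "(\<lambda>i. (i * t + f) mod N) ` {..<N} \<subseteq> {..<N}" using assms(2) by auto
  ultimately show ?thesis by (simp add: bij_betw_def endo_inj_surj)
qed

text \<open>As t is a unit, i t + f runs once through the residues modulo q^(k+1), hence q times
  through those modulo q^k.\<close>

lemma sum_gcd_affine:
  assumes t: "coprime t q" and q: "nprime q"
  shows "(\<Sum>i<q ^ Suc k. q ^ k div gcd (q ^ k) (i * t + f)) = q * cyc_psi (q ^ k)"
proof -
  let ?F = "\<lambda>m. q ^ k div gcd (q ^ k) m"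
  let ?N = "q ^ Suc k"
  have N0: "?N > 0" using q prime_gt_0_nat by simp
  have "?F (m mod ?N) = ?F m" for m
  proof -
    have "[m mod ?N = m] (mod ?N)" by (simp add: cong_def)
    then have "[m mod ?N = m] (mod q ^ k)" by (rule cong_dvd_modulus_nat) simp
    then have "gcd (m mod ?N) (q ^ k) = gcd m (q ^ k)" by (rule cong_gcd_eq)
    then show ?thesis by (simp only: gcd.commute)
  qed
  then have "(\<Sum>i<?N. ?F (i * t + f)) = (\<Sum>i<?N. ?F ((i * t + f) mod ?N))" by simp
  also have "\<dots> = (\<Sum>j<?N. ?F j)"
    using t by (intro sum.reindex_bij_betw bij_betw_affine_mod N0) simp
  also have "\<dots> = (\<Sum>j<q * q ^ k. ?F j)" by simp
  also have "\<dots> = q * (\<Sum>j<q ^ k. ?F j)"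
    by (rule sum_periodic) (metis gcd_add2 add.commute)
  finally show ?thesis by (simp add: cyc_psi_def)
qed

text \<open>If g a g^-1 were outside A, the q cosets A g a^i with i < q would be distinct, hence all
  the cosets, and one of them would be A. Then g a^i, and with it g, would lie in A. In a q-group
  this makes every subgroup of index q normal.\<close>

lemma (in group) prime_index_conj_closed:
  assumes fin: "finite (carrier G)" and q: "nprime q" and A: "subgroup A G"
    and idx: "card (rcosets A) = q" and a: "a \<in> A" "ord a = q ^ k" and g: "g \<in> carrier G"
  shows "g \<otimes> a \<otimes> inv g \<in> A"
proof (rule ccontr)
  assume nt: "g \<otimes> a \<otimes> inv g \<notin> A"
  have aG: "a \<in> carrier G" using subgroup.mem_carrier [OF A a(1)] .
  have aux: False if ij: "i < j" "j < q" "A #> (g \<otimes> a [^] i) = A #> (g \<otimes> a [^] j)" for i j :: nat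
  proof -
    let ?t = "g \<otimes> a \<otimes> inv g"
    have tG: "?t \<in> carrier G" using g aG by simp
    have "g \<otimes> a [^] j \<in> A #> (g \<otimes> a [^] i)"
      using ij(3) rcos_self [OF _ A, of "g \<otimes> a [^] j"] aG g by simp
    then obtain h where h: "h \<in> A" "g \<otimes> a [^] j = h \<otimes> (g \<otimes> a [^] i)"
      by (auto simp: r_coset_def)
    have hG: "h \<in> carrier G" using subgroup.mem_carrier [OF A h(1)] .
    have "g \<otimes> a [^] (j - i) \<otimes> a [^] i = g \<otimes> a [^] j"
      using ij aG g by (simp add: m_assoc nat_pow_mult)
    also have "\<dots> = h \<otimes> g \<otimes> a [^] i" using h hG g aG by (simp add: m_assoc)
    finally have "g \<otimes> a [^] (j - i) = h \<otimes> g"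
      using aG g hG by simp
    then have "?t [^] (j - i) = h" using conj_nat_pow [OF g aG] g hG by (simp add: m_assoc)
    then have "?t [^] (j - i) \<in> A" using h by simp
    moreover have "?t [^] (q ^ k) = \<one>"
      using conj_nat_pow [OF g aG] g aG a(2) by (metis pow_ord_eq_1 r_inv r_one)
    then have "ord ?t dvd q ^ k" using tG pow_eq_id by blast
    moreover have "coprime (j - i) q"
      using ij q by (metis coprime_commute diff_less_mono2 dvd_imp_le
        le_less_trans less_imp_diff_less not_less prime_imp_coprime zero_less_diff)
    ultimately show False
      using subgroup_coprime_pow [OF A tG, of "j - i"] nt
      by (meson coprime_divisors coprime_power_right_iff dvd_refl)
  qed
  have inj: "inj_on (\<lambda>i::nat. A #> (g \<otimes> a [^] i)) {..<q}"
    by (rule inj_onI) (metis aux lessThan_iff linorder_neqE_nat)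
  have finr: "finite (rcosets A)" using fin by (simp add: RCOSETS_def)
  have "(\<lambda>i::nat. A #> (g \<otimes> a [^] i)) ` {..<q} \<subseteq> rcosets A"
    using g aG rcosetsI [OF subgroup.subset [OF A]] by auto
  then have "(\<lambda>i::nat. A #> (g \<otimes> a [^] i)) ` {..<q} = rcosets A"
    using card_image [OF inj] idx finr by (intro card_subset_eq) auto
  moreover have "A \<in> rcosets A" using subgroup.subgroup_in_rcosets [OF A is_group] .
  ultimately obtain i where "A = A #> (g \<otimes> a [^] (i::nat))" by auto
  then have "g \<otimes> a [^] i \<in> A"
    using rcos_self [OF _ A] g aG by (metis m_closed nat_pow_closed)
  then have "g \<in> A"
  proof -
    have ai: "a [^] i \<in> A" using subgroup_nat_pow_closed [OF A a(1)] .
    have "g = g \<otimes> a [^] i \<otimes> inv (a [^] i)" using g aG by (simp add: m_assoc)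
    then show ?thesis
      using \<open>g \<otimes> a [^] i \<in> A\<close> ai A by (metis subgroup.m_closed [OF A] subgroup.m_inv_closed [OF A])
  qed
  then have "g \<otimes> a \<otimes> inv g \<in> A"
    using a(1) by (intro subgroup.m_closed [OF A] subgroup.m_inv_closed [OF A])
  then show False using nt by blast
qed

context group begin

lemma pgroup_ord_cases:
  assumes fin: "finite (carrier G)" and q: "nprime q" and o: "order G = q ^ Suc k"
    and x: "x \<in> carrier G" and ncyc: "\<not> cyclic_group G"
  obtains j where "j \<le> k" "ord x = q ^ j"
proof -
  have "ord x dvd q ^ Suc k" using ord_dvd_group_order [OF x] o by simp
  then obtain j where j: "j \<le> Suc k" "ord x = q ^ j" using divides_primepow_nat [OF q] by blast
  have "j \<noteq> Suc k" using ncyc cyclic_groupI [OF fin x] j(2) o by metis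
  then show ?thesis using that [of j] j by linarith
qed

text \<open>If \<open>x a x\<^bsup>-1\<^esup> = a\<^bsup>c\<^esup>\<close> and \<open>x\<^bsup>q\<^esup> = a\<^bsup>e\<^esup>\<close>, then \<open>(a\<^bsup>i\<^esup> x)\<^bsup>q\<^esup> = a\<^bsup>i u + e\<^esup>\<close> for \<open>u = 1 + c + \<dots> + c\<^bsup>q-1\<^esup>\<close>,
  which is \<open>q\<close> times a unit because \<open>c \<equiv> 1\<close> modulo \<open>q\<close> and \<open>q\<close> is odd.\<close>

lemma pgroup_coset_sum:
  assumes fin: "finite (carrier G)" and q: "nprime q" "odd q" and o: "order G = q ^ (k + 2)"
    and a: "a \<in> carrier G" "ord a = q ^ Suc k" and ncyc: "\<not> cyclic_group G"
    and A_def: "A = (\<lambda>i::nat. a [^] i) ` {..<ord a}" and A: "A \<lhd> G"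
    and x: "x \<in> carrier G" "x \<notin> A"
  shows "(\<Sum>y\<in>A #> x. ord y) = q\<^sup>2 * cyc_psi (q ^ k)"
proof -
  have q1: "q > 1" using q prime_gt_1_nat by blast
  have As: "subgroup A G" using A normal_imp_subgroup by blast
  have A_iff: "u \<in> A \<longleftrightarrow> (\<exists>i::nat. u = a [^] i)" for u
    unfolding A_def by (rule powers_iff [OF fin a(1)])
  have o': "order G = q ^ Suc (Suc k)" using o by simp
  have idx: "card (rcosets A) = q"
    using lagrange [OF As] card_powers [OF a(1)] o a(2) q1 by (simp add: A_def)
  interpret Q: group "G Mod A" using normal.factorgroup_is_group [OF A] .
  have xA: "A #> x \<in> carrier (G Mod A)" using x by (auto simp: carrier_FactGroup)
  have "(A #> x) [^]\<^bsub>G Mod A\<^esub> q = \<one>\<^bsub>G Mod A\<^esub>"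
    using Q.pow_order_eq_1 [OF xA] idx by (simp add: order_def FactGroup_def)
  then have "A #> x [^] q = A" using normal.FactGroup_pow [OF A x(1), of q] by simp
  then have "x [^] q \<in> A" using rcos_self [OF _ As, of "x [^] q"] x(1) by simp
  then obtain e where e: "x [^] q = a [^] (e::nat)" using A_iff by blast
  obtain j where j: "j \<le> Suc k" "ord x = q ^ j"
    using pgroup_ord_cases [OF fin q(1) o' x(1) ncyc] by blast
  \<comment> \<open>No element has the full order q^(k+2), so x^q = a^e is killed by q^k, which
    makes e a multiple of q.\<close>
  then have "ord x dvd q * q ^ k" by (metis le_imp_power_dvd power_Suc)
  then have "a [^] (e * q ^ k) = \<one>"
    using x(1) a(1) e by (metis nat_pow_pow pow_eq_id)
  then have "q * q ^ k dvd e * q ^ k" using a pow_eq_id by simp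
  then have "q dvd e" using q1 by simp
  then obtain f where f: "e = q * f" by auto
  have "x \<otimes> a \<otimes> inv x \<in> A"
    using normal.inv_op_closed2 [OF A x(1)] A_iff a(1) by (metis nat_pow_eone)
  then obtain c :: nat where "x \<otimes> a \<otimes> inv x = a [^] c" using A_iff by blast
  then have c: "x \<otimes> a = a [^] c \<otimes> x"
    using x(1) a(1) by (metis inv_solve_right m_closed nat_pow_closed)
  have "a [^] (c ^ q) \<otimes> x [^] q = x [^] q \<otimes> a"
    using pow_conj [OF x(1) a(1) c, of q 1] a by simp
  also have "\<dots> = a [^] (1::nat) \<otimes> x [^] q"
    unfolding e using a by (metis nat_pow_closed nat_pow_comm nat_pow_eone)
  finally have "a [^] (c ^ q) = a [^] (1::nat)" using a(1) x(1) by (metis nat_pow_closed r_cancel)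
  then have "int (q ^ Suc k) dvd int (c ^ q) - int 1" using a by (simp only: pow_eq_iff)
  then have "int q dvd int (c ^ q) - int 1" by (metis dvd_trans dvd_triv_left of_nat_mult power_Suc)
  then have cq: "[c ^ q = 1] (mod q)" by (metis cong_iff_dvd_diff cong_int_iff)
  have qq: "c ^ q = c ^ (q - 1) * c" using q1 by (metis Suc_diff_1 less_trans power_Suc2 zero_less_one)
  have "\<not> q dvd c"
  proof
    assume "q dvd c"
    then have "[c ^ q = 0] (mod q)" unfolding qq by (simp add: cong_0_iff)
    then have "[1 = 0] (mod q)" using cq cong_trans cong_sym by blast
    then show False using q1 by (simp add: cong_def)
  qed
  \<comment> \<open>Fermat gives c^q = c modulo q, and c^q = 1 is known, so c = 1 modulo q.\<close>
  then have "[c ^ (q - 1) * c = 1 * c] (mod q)"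
    using fermat_theorem [OF q(1)] by (intro cong_mult) auto
  then have c1: "[c = 1] (mod q)" using cq qq by (metis cong_sym cong_trans mult_1)
  define u where "u = (\<Sum>j<q. c ^ j)"
  have u: "[u = q] (mod q\<^sup>2)" unfolding u_def by (rule prime_geometric_sum [OF q(2) c1])
  then have "[u = q] (mod q)" by (rule cong_dvd_modulus_nat) (simp add: power2_eq_square)
  then have "q dvd u" by (simp add: cong_dvd_iff)
  then obtain t where t: "u = q * t" by auto
  have "[q * t = q * 1] (mod q * q)" using u t by (simp add: power2_eq_square)
  then have "q * (t mod q) = q * (1 mod q)" by (simp only: cong_def mult_mod_right)
  then have "[t = 1] (mod q)" using q1 by (simp only: cong_def mult_cancel1) simp
  then have copt: "coprime t q" by (metis cong_imp_coprime cong_sym coprime_1_left)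
  \<comment> \<open>The element y = a^i x lies outside A, so y is not 1 and q divides its order.
    Hence ord y = q ord(y^q), and y^q is the explicit power a^(q (i t + f)).\<close>
  have ord_i: "ord (a [^] i \<otimes> x) = q * (q ^ k div gcd (q ^ k) (i * t + f))" for i :: nat
  proof -
    let ?y = "a [^] i \<otimes> x"
    have y: "?y \<in> carrier G" using a x by simp
    have "?y \<notin> A"
    proof
      assume "?y \<in> A"
      then have "inv (a [^] i) \<otimes> ?y \<in> A"
        using A_iff As by (metis subgroup.m_closed subgroup.m_inv_closed)
      then show False using x a by (simp add: m_assoc [symmetric])
    qed
    then have "?y \<noteq> \<one>" using subgroup.one_closed [OF As] by metis
    then have "ord ?y \<noteq> 1" using ord_eq_1 [OF y] by blast
    moreover obtain j where "ord ?y = q ^ j" using pgroup_ord_cases [OF fin q(1) o' y ncyc] by blast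
    ultimately have "q dvd ord ?y" by (metis dvd_power gr0I power_0)
    then have "ord ?y = q * ord (?y [^] q)" using ord_pow [OF y, of q] q1 by simp
    also have "?y [^] q = a [^] (i * u) \<otimes> a [^] e"
      using twisted_pow [OF x(1) a(1) c, of i q] e by (simp add: u_def)
    also have "\<dots> = a [^] (q * (i * t + f))"
      using a by (simp add: nat_pow_mult t f algebra_simps)
    also have "ord \<dots> = q * q ^ k div gcd (q * q ^ k) (q * (i * t + f))"
      using ord_pow_div_gcd [OF fin a(1)] a(2) by simp
    also have "\<dots> = q ^ k div gcd (q ^ k) (i * t + f)"
      using q1 by (simp add: gcd_mult_distrib_nat [symmetric])
    finally show ?thesis .
  qed
  have "(\<Sum>y\<in>A #> x. ord y) = (\<Sum>v\<in>A. ord (v \<otimes> x))" by (rule sum_rcoset [OF As x(1)])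
  also have "\<dots> = (\<Sum>i\<in>{..<ord a}. ord (a [^] i \<otimes> x))"
    unfolding A_def using pow_inj [OF a(1)] by (simp add: sum.reindex)
  also have "\<dots> = q * (\<Sum>i<q ^ Suc k. q ^ k div gcd (q ^ k) (i * t + f))"
    unfolding ord_i a(2) sum_distrib_left [symmetric] by simp
  also have "\<dots> = q * (q * cyc_psi (q ^ k))" using sum_gcd_affine [OF copt q(1)] by simp
  finally show ?thesis by (simp add: power2_eq_square)
qed

text \<open>The subgroup <a> has index q and is normal, and its q - 1 nontrivial cosets all have the
  same sum of orders. So the value depends only on q and k; this is why C_q x C_(q^2) and M(q^3)
  agree.\<close>

lemma pgroup_psi_eq:
  assumes fin: "finite (carrier G)" and q: "nprime q" "odd q" and o: "order G = q ^ (k + 2)"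
    and a: "a \<in> carrier G" "ord a = q ^ Suc k" and ncyc: "\<not> cyclic_group G"
  shows "psi G = cyc_psi (q ^ Suc k) + (q - 1) * (q\<^sup>2 * cyc_psi (q ^ k))"
proof -
  have q1: "q > 1" using q prime_gt_1_nat by blast
  define A where "A = (\<lambda>i::nat. a [^] i) ` {..<ord a}"
  have As: "subgroup A G" unfolding A_def by (rule powers_subgroup [OF fin a(1)])
  have A_iff: "u \<in> A \<longleftrightarrow> (\<exists>i::nat. u = a [^] i)" for u
    unfolding A_def by (rule powers_iff [OF fin a(1)])
  have idx: "card (rcosets A) = q"
    using lagrange [OF As] card_powers [OF a(1)] o a(2) q1 by (simp add: A_def)
  have "g \<otimes> u \<otimes> inv g \<in> A" if g: "g \<in> carrier G" and u: "u \<in> A" for g u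
  proof -
    have uG: "u \<in> carrier G" using subgroup.mem_carrier [OF As u] .
    have "ord u dvd q ^ (k + 2)" using ord_dvd_group_order [OF uG] o by simp
    then obtain j where "ord u = q ^ j" using divides_primepow_nat [OF q(1)] by blast
    then show ?thesis using prime_index_conj_closed [OF fin q(1) As idx u _ g] by blast
  qed
  then have A: "A \<lhd> G" using As normal_inv_iff by blast
  have finr: "finite (rcosets A)" using fin by (simp add: RCOSETS_def)
  have Ar: "A \<in> rcosets A" using subgroup.subgroup_in_rcosets [OF As is_group] .
  have rest: "sum ord Z = q\<^sup>2 * cyc_psi (q ^ k)" if Z: "Z \<in> rcosets A - {A}" for Z
  proof -
    obtain x where x: "x \<in> carrier G" "Z = A #> x" using Z by (auto simp: RCOSETS_def)
    have "x \<notin> A" using Z x coset_join2 [OF x(1) As] by auto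
    then show ?thesis using pgroup_coset_sum [OF assms A_def A x(1)] x(2) by simp
  qed
  have "psi G = sum (\<lambda>Z. sum ord Z) (rcosets A)"
    unfolding psi_def by (rule sum_rcosets [OF fin As])
  also have "\<dots> = sum ord A + sum (\<lambda>Z. sum ord Z) (rcosets A - {A})"
    by (rule sum.remove [OF finr Ar])
  also have "sum ord A = cyc_psi (q ^ Suc k)"
    unfolding A_def using sum_powers_ord [OF fin a(1)] a(2) by simp
  also have "sum (\<lambda>Z. sum ord Z) (rcosets A - {A}) = (q - 1) * (q\<^sup>2 * cyc_psi (q ^ k))"
    using rest finr Ar idx by simp
  finally show ?thesis .
qed

lemma pgroup_psi_real:
  assumes "finite (carrier G)" and q: "nprime q" "odd q" and "order G = q ^ (k + 2)"
    and "a \<in> carrier G" "ord a = q ^ Suc k" and "\<not> cyclic_group G"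
  shows "real (psi G) = (real q ^ (2 * k + 4) + real q ^ 3 - real q ^ 2 + 1) / (real q + 1)"
proof -
  have q0: "q > 0" using q prime_gt_0_nat by blast
  have "real (psi G) * (real q + 1) = (real q + 1) * real (cyc_psi (q ^ Suc k))
      + (real q - 1) * (real q ^ 2 * ((real q + 1) * real (cyc_psi (q ^ k))))"
  proof -
    have "real (q - 1) = real q - 1" using q0 by (simp add: of_nat_diff)
    then show ?thesis
      unfolding pgroup_psi_eq [OF assms] of_nat_add of_nat_mult of_nat_power by (simp add: algebra_simps)
  qed
  also have "(real q + 1) * real (cyc_psi (q ^ Suc k)) = real q ^ (2 * k + 3) + 1"
    using arg_cong [OF cyc_psi_prime_power [OF q(1), of "Suc k"], of real]
    by (simp add: algebra_simps numeral_eq_Suc)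
  also have "(real q + 1) * real (cyc_psi (q ^ k)) = real q ^ (2 * k + 1) + 1"
    using q0 by (simp add: cyc_psi_prime_power_real [OF q(1)])
  also have "real q ^ (2 * k + 3) + 1 + (real q - 1) * (real q ^ 2 * (real q ^ (2 * k + 1) + 1))
      = real q ^ (2 * k + 4) + real q ^ 3 - real q ^ 2 + 1"
    by (simp add: algebra_simps power_add numeral_eq_Suc)
  finally show ?thesis using q0 by (simp add: field_simps)
qed

lemma psi_le_max_ord:
  assumes "\<And>x. x \<in> carrier G \<Longrightarrow> ord x \<le> M"
  shows "psi G \<le> order G * M"
  unfolding psi_def order_def using sum_mono [of "carrier G" ord "\<lambda>_. M"] assms by simp

text \<open>If an element of order q^(k+1) exists, the exact value applies. Otherwise all orders are
  at most q^k, and the trivial estimate |G| q^k is small enough.\<close>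

lemma pgroup_psi_le:
  assumes fin: "finite (carrier G)" and q: "nprime q" "odd q" and o: "order G = q ^ (k + 2)"
    and ncyc: "\<not> cyclic_group G"
  shows "real (psi G) \<le> (real q ^ (2 * k + 4) + real q ^ 3 - real q ^ 2 + 1) / (real q + 1)"
proof (cases "\<exists>a\<in>carrier G. ord a = q ^ Suc k")
  case True
  then show ?thesis using pgroup_psi_real [OF fin q o _ _ ncyc] by auto
next
  case False
  have q1: "q > 1" using q prime_gt_1_nat by blast
  have q2: "q \<ge> 2" using q1 by simp
  have o': "order G = q ^ Suc (Suc k)" using o by simp
  have "ord x \<le> q ^ k" if x: "x \<in> carrier G" for x
  proof -
    obtain j where j: "j \<le> Suc k" "ord x = q ^ j"
      using pgroup_ord_cases [OF fin q(1) o' x ncyc] by blast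
    then have "j \<noteq> Suc k" using False x by metis
    then show ?thesis using j q1 by (simp add: power_increasing)
  qed
  then have "psi G \<le> q ^ (k + 2) * q ^ k" using psi_le_max_ord o by metis
  also have "\<dots> = q ^ (2 * k + 2)" by (simp add: power_add mult_2)
  finally have "real (psi G) \<le> real q ^ (2 * k + 2)"
    using of_nat_mono [of "psi G" "q ^ (2 * k + 2)"] by simp
  then have "real (psi G) * (real q + 1) \<le> real q ^ (2 * k + 2) * (real q + 1)"
    by (intro mult_right_mono) auto
  also have "\<dots> \<le> real q ^ (2 * k + 2) * real q ^ 2"
  proof (intro mult_left_mono)
    have "real q * 2 \<le> real q * real q" using q2 by (intro mult_left_mono) auto
    then show "real q + 1 \<le> real q ^ 2" using q2 unfolding power2_eq_square by linarith
  qed simp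
  also have "\<dots> = real q ^ (2 * k + 4)" by (simp add: power_add numeral_eq_Suc)
  also have "\<dots> \<le> real q ^ (2 * k + 4) + real q ^ 3 - real q ^ 2 + 1"
  proof -
    have "real q ^ 2 \<le> real q ^ 3" using q2 by (intro power_increasing) auto
    then show ?thesis by linarith
  qed
  finally show ?thesis using q1 by (simp add: field_simps)
qed

end

subsection \<open>Sylow subgroups of prime order\<close>

context group begin

definition elt_centralizer :: "'a \<Rightarrow> 'a set" where
  "elt_centralizer y = {g \<in> carrier G. g \<otimes> y = y \<otimes> g}"

text \<open>Conjugacy of Sylow subgroups of prime order, by double cosets: if no conjugate of y lay
  in <z>, every double coset <y> g <z> would have exactly q^2 elements, and q^2 would divide
  |G|.\<close>

lemma conj_prime_order:
  assumes fin: "finite (carrier G)" and q: "nprime q" and o: "order G = q * m" and cop: "coprime q m"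
    and y: "y \<in> carrier G" "ord y = q" and z: "z \<in> carrier G" "ord z = q"
  shows "\<exists>g\<in>carrier G. \<exists>j\<in>{1..<q}. y = g \<otimes> z [^] (j::nat) \<otimes> inv g"
proof -
  have q1: "q > 1" using q prime_gt_1_nat by blast
  define Q where "Q = (\<lambda>i::nat. z [^] i) ` {..<ord z}"
  have Qs: "subgroup Q G" unfolding Q_def by (rule powers_subgroup [OF fin z(1)])
  have Q_iff: "u \<in> Q \<longleftrightarrow> (\<exists>i::nat. u = z [^] i)" for u
    unfolding Q_def by (rule powers_iff [OF fin z(1)])
  have "\<exists>g\<in>carrier G. inv g \<otimes> y \<otimes> g \<in> Q"
  proof (rule ccontr)
    assume no: "\<not> ?thesis"
    \<comment> \<open>\<open>f g\<close> maps B onto the double coset <y> g <z>.\<close>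
    define f where "f g ij = (case ij of (i, j) \<Rightarrow> y [^] i \<otimes> g \<otimes> z [^] j)" for g and ij :: "nat \<times> nat"
    define B where "B = {..<q} \<times> {..<q}"
    define r where "r = {(g, h). g \<in> carrier G \<and> h \<in> f g ` B}"
    have fG: "f g ij \<in> carrier G" if "g \<in> carrier G" for g ij
      using that y z by (auto simp: f_def split: prod.split)
    have r_iff: "(g, h) \<in> r \<longleftrightarrow> g \<in> carrier G \<and> (\<exists>i j. h = f g (i, j))" for g h
    proof
      assume "g \<in> carrier G \<and> (\<exists>i j. h = f g (i, j))"
      then obtain i j where g: "g \<in> carrier G" and h: "h = f g (i, j)" by blast
      have "h = f g (i mod q, j mod q)"
        using h pow_mod_ord [OF y(1), of i] pow_mod_ord [OF z(1), of j] y z by (simp add: f_def)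
      then show "(g, h) \<in> r" using g q1 by (auto simp: r_def B_def)
    qed (auto simp: r_def B_def)
    have ff: "f (f g (i, j)) (i', j') = f g (i' + i, j + j')" if "g \<in> carrier G" for g i j i' j'
      using that y z by (simp add: f_def m_assoc flip: nat_pow_mult)
    have f0: "f g (i, j) = g" if "g \<in> carrier G" "q dvd i" "q dvd j" for g i j
    proof -
      have "y [^] i = \<one>" "z [^] j = \<one>" using that y z pow_eq_id by auto
      then show ?thesis using that by (simp add: f_def)
    qed
    have eq: "equiv (carrier G) r"
    proof (rule equivI)
      show "r \<subseteq> carrier G \<times> carrier G" using fG by (auto simp: r_def)
      show "refl_on (carrier G) r"
        using fG f0 [of _ 0 0] by (intro refl_onI) (auto simp: r_iff, metis)
      show "sym r"
      proof (rule symI)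
        fix g h assume "(g, h) \<in> r"
        then obtain i j where g: "g \<in> carrier G" and h: "h = f g (i, j)" by (auto simp: r_iff)
        \<comment> \<open>Multiplying the exponents by q - 1 inverts the shift without negative
          powers.\<close>
        have "f h ((q - 1) * i, (q - 1) * j) = f g ((q - 1) * i + i, j + (q - 1) * j)"
          unfolding h by (rule ff [OF g])
        also have "\<dots> = g"
        proof -
          have "(q - 1) * i + i = q * i" "j + (q - 1) * j = q * j"
            using q1 by (auto simp: algebra_simps)
          then show ?thesis using f0 [OF g] by simp
        qed
        finally have "g = f h ((q - 1) * i, (q - 1) * j)" by simp
        then show "(h, g) \<in> r" using fG [OF g] h by (auto simp: r_iff)
      qed
      show "trans r"
      proof (rule transI)
        fix g h l assume "(g, h) \<in> r" "(h, l) \<in> r"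
        then obtain i j i' j' where g: "g \<in> carrier G" and "h = f g (i, j)" "l = f h (i', j')"
          by (auto simp: r_iff)
        then have "l = f g (i' + i, j + j')" using ff [OF g] by metis
        then show "(g, l) \<in> r" using g r_iff by blast
      qed
    qed
    have inj_aux: False
      if g: "g \<in> carrier G" and lt: "i < i'" "i' < q" and e: "f g (i, j) = f g (i', j')" for g i j i' j'
    proof -
      let ?t = "inv g \<otimes> y \<otimes> inv (inv g)"
      have "f g (i', j') = y [^] i \<otimes> (y [^] (i' - i) \<otimes> g \<otimes> z [^] j')"
      proof -
        have "y [^] i' = y [^] i \<otimes> y [^] (i' - i)" using lt y by (simp add: nat_pow_mult)
        then show ?thesis using g y z by (simp add: f_def m_assoc)
      qed
      moreover have "f g (i, j) = y [^] i \<otimes> (g \<otimes> z [^] j)"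
        using g y z by (simp add: f_def m_assoc)
      ultimately have "g \<otimes> z [^] j = y [^] (i' - i) \<otimes> g \<otimes> z [^] j'"
        using e g y z by simp
      then have "g \<otimes> (z [^] j \<otimes> inv (z [^] j')) = y [^] (i' - i) \<otimes> g"
        using g y z by (simp add: m_assoc [symmetric]) (simp add: m_assoc)
      then have "z [^] j \<otimes> inv (z [^] j') = inv g \<otimes> y [^] (i' - i) \<otimes> inv (inv g)"
        using g y z by (simp add: m_assoc inv_solve_left)
      then have "?t [^] (i' - i) = z [^] j \<otimes> inv (z [^] j')"
        using conj_nat_pow [of "inv g" y "i' - i"] g y by simp
      also have "\<dots> \<in> Q"
        using Q_iff by (intro subgroup.m_closed [OF Qs] subgroup.m_inv_closed [OF Qs]) auto
      finally have mem: "?t [^] (i' - i) \<in> Q" .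
      have tG: "?t \<in> carrier G" using g y by simp
      have "?t [^] q = \<one>"
        using conj_nat_pow [of "inv g" y q] g y by (metis inv_closed pow_ord_eq_1 r_inv r_one)
      then have "ord ?t dvd q" using tG pow_eq_id by blast
      moreover have "coprime (i' - i) q"
        using lt q by (metis coprime_commute less_imp_diff_less nat_dvd_not_less prime_imp_coprime zero_less_diff)
      ultimately have "coprime (i' - i) (ord ?t)" by (meson coprime_divisors dvd_refl)
      then have "?t \<in> Q" using subgroup_coprime_pow [OF Qs tG mem] by blast
      then show False using no g by simp
    qed
    have inj: "inj_on (f g) B" if g: "g \<in> carrier G" for g
    proof (rule inj_onI)
      fix a b assume ab: "a \<in> B" "b \<in> B" "f g a = f g b"
      obtain i j i' j' where a: "a = (i, j)" and b: "b = (i', j')" by (metis surj_pair)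
      have "i = i'"
        using inj_aux [OF g, of i i' j j'] inj_aux [OF g, of i' i j' j] ab a b
        by (auto simp: B_def) (metis linorder_neqE_nat)
      then have "z [^] j = z [^] j'" using ab a b g y z by (simp add: f_def)
      then have "j = j'" using pow_inj [OF z(1)] z(2) ab a b by (auto simp: B_def inj_on_def)
      then show "a = b" using \<open>i = i'\<close> a b by simp
    qed
    have "q * q dvd card (carrier G)"
    proof (rule equiv_imp_dvd_card [OF fin eq])
      fix C assume "C \<in> carrier G // r"
      then obtain g where g: "g \<in> carrier G" "C = r `` {g}" by (auto elim: quotientE)
      then have "C = f g ` B" by (auto simp: r_def)
      then show "q * q dvd card C" using inj [OF g(1)] by (simp add: card_image B_def)
    qed
    then have "q dvd m" using o q1 by (simp add: order_def)
    then show False using cop q1 by (metis coprime_def dvd_refl nat_dvd_1_iff_1 less_irrefl)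
  qed
  then obtain g where g: "g \<in> carrier G" "inv g \<otimes> y \<otimes> g \<in> Q" by blast
  then obtain j where j: "j < q" "inv g \<otimes> y \<otimes> g = z [^] j" unfolding Q_def z(2) by auto
  have y': "y = g \<otimes> z [^] j \<otimes> inv g"
    using g y by (simp add: j(2) [symmetric] m_assoc) (simp add: m_assoc [symmetric])
  have "j \<noteq> 0"
  proof
    assume "j = 0"
    then have "y = \<one>" using y' g by simp
    then show False using y q1 by simp
  qed
  then show ?thesis using g(1) j(1) y' by (intro bexI [of _ g] bexI [of _ j]) auto
qed

text \<open>For a fixed z of order q, the pairs (g, j) are sorted by the value g z^j g^-1. Every y
  of order q is such a value, and right translation by one solution g embeds the centralizer of y
  into the fibre over y. The fibres are disjoint subsets of (q-1)|G| pairs.\<close>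

lemma sum_card_elt_centralizer_le:
  assumes fin: "finite (carrier G)" and q: "nprime q" and o: "order G = q * m" and cop: "coprime q m"
  shows "(\<Sum>y\<in>{y \<in> carrier G. ord y = q}. card (elt_centralizer y)) \<le> (q - 1) * order G"
proof (cases "\<exists>z\<in>carrier G. ord z = q")
  case True
  then obtain z where z: "z \<in> carrier G" "ord z = q" by blast
  define Y where "Y = {y \<in> carrier G. ord y = q}"
  define F where "F y = {(g, j). g \<in> carrier G \<and> j \<in> {1..<q} \<and> g \<otimes> z [^] (j::nat) \<otimes> inv g = y}" for y
  have Fsub: "F y \<subseteq> carrier G \<times> {1..<q}" for y by (auto simp: F_def)
  then have finF: "finite (F y)" for y using fin by (meson finite_SigmaI finite_atLeastLessThan finite_subset)
  have "card (elt_centralizer y) \<le> card (F y)" if y: "y \<in> Y" for y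
  proof -
    have yG: "y \<in> carrier G" and oy: "ord y = q" using y by (auto simp: Y_def)
    obtain g j where g: "g \<in> carrier G" and j: "j \<in> {1..<q}" and gj: "y = g \<otimes> z [^] (j::nat) \<otimes> inv g"
      using conj_prime_order [OF fin q o cop yG oy z] by blast
    have "inj_on (\<lambda>c. (c \<otimes> g, j)) (elt_centralizer y)"
      using g by (auto simp: inj_on_def elt_centralizer_def)
    moreover have "(\<lambda>c. (c \<otimes> g, j)) ` elt_centralizer y \<subseteq> F y"
    proof safe
      fix c assume "c \<in> elt_centralizer y"
      then have c: "c \<in> carrier G" "c \<otimes> y = y \<otimes> c" by (auto simp: elt_centralizer_def)
      have "c \<otimes> g \<otimes> z [^] j \<otimes> inv (c \<otimes> g) = c \<otimes> y \<otimes> inv c"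
        unfolding gj using c(1) g z by (simp add: inv_mult_group m_assoc)
      also have "\<dots> = y" using c yG by (simp add: m_assoc)
      finally show "(c \<otimes> g, j) \<in> F y" using c(1) g j by (simp add: F_def)
    qed
    ultimately show ?thesis using card_inj_on_le finF by blast
  qed
  then have "(\<Sum>y\<in>Y. card (elt_centralizer y)) \<le> (\<Sum>y\<in>Y. card (F y))" by (rule sum_mono)
  also have "\<dots> = card (\<Union>y\<in>Y. F y)"
    using fin finF by (subst card_UN_disjoint) (auto simp: Y_def F_def)
  also have "\<dots> \<le> card (carrier G \<times> {1..<q})"
    using Fsub fin by (intro card_mono) auto
  finally show ?thesis by (simp add: Y_def card_cartesian_product order_def mult.commute)
next
  case False
  then have "{y \<in> carrier G. ord y = q} = {}" by blast
  then show ?thesis by (simp only: sum.empty)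
qed

text \<open>With e = 1 modulo q and e = 0 modulo m, the power x^e is the q-part of x.\<close>

lemma prime_part_exponent:
  assumes fin: "finite (carrier G)" and q: "nprime q" and o: "order G = q * m" and cop: "coprime q m"
  obtains e :: nat where
    "\<And>y. y \<in> carrier G \<Longrightarrow> ord y = q \<Longrightarrow> y [^] e = y"
    "\<And>x. x \<in> carrier G \<Longrightarrow> q dvd ord x \<Longrightarrow> ord (x [^] e) = q"
    "\<And>x. x \<in> carrier G \<Longrightarrow> \<not> q dvd ord x \<Longrightarrow> x [^] e = \<one>"
proof -
  have q1: "q > 1" using q prime_gt_1_nat by blast
  obtain e where e: "[e = 1] (mod q)" "[e = 0] (mod m)"
    using binary_chinese_remainder_nat [OF cop] by blast
  show ?thesis
  proof
    fix y assume y: "y \<in> carrier G" "ord y = q"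
    have "int q dvd int e - int 1" using e(1) by (metis cong_iff_dvd_diff cong_int_iff)
    then have "y [^] e = y [^] (1::nat)" using pow_eq_iff [OF y(1), of e 1] y(2) by simp
    then show "y [^] e = y" using y by simp
  next
    fix x assume x: "x \<in> carrier G" "q dvd ord x"
    have "ord x dvd e * q"
      using ord_dvd_group_order [OF x(1)] o e(2) by (metis cong_0_iff dvd_trans mult.commute mult_dvd_mono dvd_refl)
    then have "ord (x [^] e) dvd q" using x by (simp add: nat_pow_pow flip: pow_eq_id)
    moreover have "ord (x [^] e) \<noteq> 1"
    proof
      assume "ord (x [^] e) = 1"
      then have "x [^] e = \<one>" using x ord_eq_1 by simp
      then have "q dvd e" using x pow_eq_id dvd_trans by blast
      then have "[1 = 0] (mod q)" using e(1) by (metis cong_0_iff cong_sym cong_trans)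
      then show False using q1 by (simp add: cong_def)
    qed
    ultimately show "ord (x [^] e) = q" using q by (metis prime_nat_iff)
  next
    fix x assume x: "x \<in> carrier G" "\<not> q dvd ord x"
    then have "coprime (ord x) q" using q by (simp add: coprime_commute prime_imp_coprime)
    then have "ord x dvd m" using ord_dvd_group_order [OF x(1)] o by (simp add: coprime_dvd_mult_right_iff)
    then show "x [^] e = \<one>" using e(2) x by (metis cong_0_iff dvd_trans pow_eq_id)
  qed
qed

text \<open>A special case of Frobenius' theorem on the number of solutions of \<open>x\<^bsup>m\<^esup> = 1\<close>.\<close>

lemma card_dvd_ord_le:
  assumes fin: "finite (carrier G)" and q: "nprime q" and o: "order G = q * m" and cop: "coprime q m"
  shows "q * card {x \<in> carrier G. q dvd ord x} \<le> (q - 1) * order G"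
proof -
  obtain e :: nat where e: "\<And>y. y \<in> carrier G \<Longrightarrow> ord y = q \<Longrightarrow> y [^] e = y"
    "\<And>x. x \<in> carrier G \<Longrightarrow> q dvd ord x \<Longrightarrow> ord (x [^] e) = q"
    using prime_part_exponent [OF assms] by metis
  define Y where "Y = {y \<in> carrier G. ord y = q}"
  define T where "T y = {x \<in> carrier G. x [^] e = y}" for y
  have finY: "finite Y" using fin by (simp add: Y_def)
  have finT: "finite (T y)" for y using fin by (simp add: T_def)
  have comm: "x \<otimes> y = y \<otimes> x" if "x \<in> T y" for x y
    using that by (auto simp: T_def) (metis nat_pow_Suc nat_pow_Suc2)
  \<comment> \<open>\<open>T y\<close> consists of the elements with q-part y. The products y^i x
    with i < q and x in \<open>T y\<close> are distinct, because the e-th power y^(i+1) reveals i,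
    and all of them centralize y.\<close>
  have le: "q * card (T y) \<le> card (elt_centralizer y)" if y: "y \<in> Y" for y
  proof -
    have yG: "y \<in> carrier G" "ord y = q" using y by (auto simp: Y_def)
    let ?f = "\<lambda>(i::nat, x). y [^] i \<otimes> x"
    have pw: "(y [^] i \<otimes> x) [^] e = y [^] i \<otimes> y" if x: "x \<in> T y" for i :: nat and x
    proof -
      have xG: "x \<in> carrier G" "x [^] e = y" using x by (auto simp: T_def)
      have "y [^] i \<otimes> x = x \<otimes> y [^] i"
        using comm [OF x] xG(1) yG(1) by (metis conj_pow mult_1 nat_pow_eone)
      then have "(y [^] i \<otimes> x) [^] e = (y [^] i) [^] e \<otimes> x [^] e"
        using xG yG by (intro pow_mult_distrib) auto
      also have "(y [^] i) [^] e = (y [^] e) [^] i" using yG by (simp add: nat_pow_pow mult.commute)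
      finally show ?thesis using e(1) [OF yG] xG(2) by simp
    qed
    have "inj_on ?f ({..<q} \<times> T y)"
    proof (rule inj_onI, clarify)
      fix i j x x' assume h: "i < q" "j < q" "x \<in> T y" "x' \<in> T y" "y [^] i \<otimes> x = y [^] j \<otimes> x'"
      then have "y [^] i \<otimes> y = y [^] j \<otimes> y" using pw by metis
      then have "y [^] i = y [^] j" using yG by simp
      then have "i = j" using pow_inj [OF yG(1)] yG(2) h by (auto simp: inj_on_def)
      then show "i = j \<and> x = x'" using h yG by (auto simp: T_def)
    qed
    moreover have "?f ` ({..<q} \<times> T y) \<subseteq> elt_centralizer y"
    proof clarify
      fix i :: nat and x assume x: "x \<in> T y"
      then have xG: "x \<in> carrier G" by (simp add: T_def)
      have "y [^] i \<otimes> x \<otimes> y = y [^] i \<otimes> y \<otimes> x" using comm [OF x] xG yG by (simp add: m_assoc)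
      also have "\<dots> = y \<otimes> (y [^] i \<otimes> x)" using xG yG by (simp add: m_assoc [symmetric] nat_pow_comm [of y i 1, simplified])
      finally show "y [^] i \<otimes> x \<in> elt_centralizer y" using xG yG by (simp add: elt_centralizer_def)
    qed
    moreover have "finite (elt_centralizer y)" using fin by (simp add: elt_centralizer_def)
    ultimately have "card ({..<q} \<times> T y) \<le> card (elt_centralizer y)" by (rule card_inj_on_le)
    then show ?thesis unfolding card_cartesian_product card_lessThan .
  qed
  have "{x \<in> carrier G. q dvd ord x} \<subseteq> (\<Union>y\<in>Y. T y)"
    using e(2) by (auto simp: Y_def T_def)
  then have "card {x \<in> carrier G. q dvd ord x} \<le> card (\<Union>y\<in>Y. T y)"
    using finY finT by (intro card_mono) auto
  also have "\<dots> \<le> (\<Sum>y\<in>Y. card (T y))" by (rule card_UN_le [OF finY])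
  finally have "q * card {x \<in> carrier G. q dvd ord x} \<le> (\<Sum>y\<in>Y. q * card (T y))"
    by (metis mult_le_mono2 sum_distrib_left)
  also have "\<dots> \<le> (\<Sum>y\<in>Y. card (elt_centralizer y))" using le by (rule sum_mono)
  also have "\<dots> \<le> (q - 1) * order G" unfolding Y_def by (rule sum_card_elt_centralizer_le [OF assms])
  finally show ?thesis .
qed

end

section \<open>The bound for q-groups as a rational function\<close>

text \<open>For a >= 2 this is psi(C_q x C_(q^(a-1))) / psi(C_(q^a)), after cancelling the common
  denominator q + 1.\<close>

definition noncyc_bound :: "nat \<Rightarrow> nat \<Rightarrow> real" where
  "noncyc_bound q a = (real q ^ (2 * a) + real q ^ 3 - real q ^ 2 + 1) / (real q ^ (2 * a + 1) + 1)"

lemma noncyc_bound_antimono_exp: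
  assumes "q \<ge> 2"
  shows "noncyc_bound q (k + 2) \<le> noncyc_bound q 2"
proof -
  define x xk where "x = real q" and "xk = x ^ (2 * k)"
  have x: "x \<ge> 2" using assms by (simp add: x_def)
  have X1: "xk \<ge> 1" using x by (simp add: xk_def one_le_power)
  define c where "c = x ^ 3 - x ^ 2 + 1"
  have "x ^ 2 * 1 \<le> x ^ 2 * (x - 1)" using x by (intro mult_left_mono) auto
  then have c: "c \<ge> 1 + x ^ 2" by (simp add: c_def algebra_simps power2_eq_square power3_eq_cube)
  have e4: "x ^ (2 * (k + 2)) = xk * x ^ 4" by (simp add: xk_def power_add numeral_eq_Suc)
  have e5: "x ^ (2 * (k + 2) + 1) = xk * x ^ 5" by (simp add: xk_def power_add numeral_eq_Suc)
  have "c * x ^ 5 - x ^ 4 \<ge> 0"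
  proof -
    have "c \<ge> 1" using c zero_le_power2 [of x] by linarith
    then have "1 * 1 \<le> c * x" using x by (intro mult_mono) auto
    then have "1 * x ^ 4 \<le> (c * x) * x ^ 4" using x by (intro mult_right_mono) auto
    then show ?thesis by (simp add: algebra_simps numeral_eq_Suc)
  qed
  \<comment> \<open>This product is the difference of the two sides after
    cross-multiplication.\<close>
  then have "(xk - 1) * (c * x ^ 5 - x ^ 4) \<ge> 0" using X1 by simp
  then have "(xk * x ^ 4 + c) * (x ^ 5 + 1) \<le> (x ^ 4 + c) * (xk * x ^ 5 + 1)"
    by (simp add: algebra_simps)
  moreover have "xk * x ^ 5 + 1 > 0" "x ^ 5 + 1 > 0" using x X1 by (auto intro!: add_nonneg_pos)
  ultimately have "(xk * x ^ 4 + c) / (xk * x ^ 5 + 1) \<le> (x ^ 4 + c) / (x ^ 5 + 1)"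
    by (simp add: divide_le_eq le_divide_eq mult.commute)
  moreover have "A + c = A + x ^ 3 - x ^ 2 + 1" for A by (simp add: c_def)
  ultimately show ?thesis
    unfolding noncyc_bound_def x_def [symmetric] e4 e5 by simp
qed

text \<open>For \<alpha> \<ge> 2 both the index estimate and the value of the Frobenius group are
  compared with 1/q instead of with the bound itself.\<close>

lemma noncyc_bound_gt_inverse:
  assumes "q \<ge> 2"
  shows "noncyc_bound q a > 1 / real q"
proof -
  have x: "real q \<ge> 2" using assms by simp
  have "real q ^ 4 \<ge> real q ^ 3" using x by (intro power_increasing) auto
  then have "real q ^ (2 * a + 1) + 1 < (real q ^ (2 * a) + real q ^ 3 - real q ^ 2 + 1) * real q"
  proof -
    have "(real q ^ (2 * a) + real q ^ 3 - real q ^ 2 + 1) * real q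
        = real q ^ (2 * a + 1) + (real q ^ 4 - real q ^ 3) + real q"
      by (simp add: algebra_simps numeral_eq_Suc)
    then show ?thesis using \<open>real q ^ 4 \<ge> real q ^ 3\<close> x by linarith
  qed
  moreover have "real q ^ (2 * a + 1) + 1 > 0" using x by (auto intro!: add_nonneg_pos)
  ultimately show ?thesis using x unfolding noncyc_bound_def by (simp add: field_simps)
qed

lemma noncyc_bound_mult_cyc_psi:
  assumes "nprime q"
  shows "noncyc_bound q a * real (cyc_psi (q ^ a)) = (real q ^ (2 * a) + real q ^ 3 - real q ^ 2 + 1) / (real q + 1)"
proof -
  have "real q ^ (2 * a + 1) + 1 > 0" by (auto intro!: add_nonneg_pos)
  moreover have "A / B * (B / C) = A / C" if "B > 0" for A B C :: real using that by simp
  ultimately show ?thesis unfolding noncyc_bound_def cyc_psi_prime_power_real [OF assms] by blast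
qed

lemma cyc_psi_prime:
  assumes "nprime q"
  shows "real (cyc_psi q) = real q * real q - real q + 1"
proof -
  have "cyc_psi q = 1 + (q - 1) * q" using cyc_psi_prime_power_Suc [OF assms, of 0] by simp
  then show ?thesis using prime_gt_0_nat [OF assms] by (simp add: of_nat_diff algebra_simps)
qed

section \<open>Groups of order q p^k whose Sylow p-subgroup is not cyclic\<close>

lemma subgroup_ord:
  assumes "group G" and "subgroup H G" and "x \<in> H"
  shows "group.ord (G\<lparr>carrier := H\<rparr>) x = group.ord G x"
proof -
  interpret group G by fact
  interpret H: group "G\<lparr>carrier := H\<rparr>" using subgroup_imp_group assms(2) by blast
  have x: "x \<in> carrier G" "x \<in> carrier (G\<lparr>carrier := H\<rparr>)"
    using assms subgroup.mem_carrier by auto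
  show ?thesis
    using pow_eq_id [OF x(1)] by (subst H.ord_unique [OF x(2)]) (simp flip: nat_pow_consistent)
qed

context group begin

lemma ord_dvd_card_subgroup:
  assumes "subgroup H G" "x \<in> H"
  shows "ord x dvd card H"
proof -
  interpret H: group "G\<lparr>carrier := H\<rparr>" using subgroup_imp_group assms(1) by blast
  have "H.ord x dvd card H" using H.ord_dvd_group_order [of x] assms(2) by (simp add: order_def)
  then show ?thesis using subgroup_ord [OF is_group assms] by simp
qed

lemma psi_subgroup:
  assumes "subgroup H G"
  shows "psi (G\<lparr>carrier := H\<rparr>) = (\<Sum>u\<in>H. ord u)"
  unfolding psi_def by (simp add: subgroup_ord [OF is_group assms])

text \<open>The average order over any subgroup D of the non-cyclic p-group H is at most W / |H|.
  The three assumptions on W match the three possibilities: D = H, D cyclic of index p in H, and all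
  orders in D at most p^j.\<close>

lemma sum_ord_sub_pgroup_le:
  fixes W :: real
  assumes fin: "finite (carrier G)" and p: "nprime p" "odd p"
    and H: "subgroup H G" "card H = p ^ (j + 2)" and nel: "\<And>x. x \<in> H \<Longrightarrow> ord x \<noteq> p ^ (j + 2)"
    and D: "subgroup D G" "D \<subseteq> H"
    and W: "noncyc_bound p (j + 2) * real (cyc_psi (p ^ (j + 2))) \<le> W"
      "real (p * cyc_psi (p ^ Suc j)) \<le> W" "real (p ^ (j + 2) * p ^ j) \<le> W"
  shows "real (p ^ (j + 2)) * real (\<Sum>u\<in>D. ord u) \<le> real (card D) * W"
proof -
  have p1: "p > 1" using p prime_gt_1_nat by blast
  let ?H = "G\<lparr>carrier := H\<rparr>"
  interpret H: group ?H using subgroup_imp_group H(1) by blast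
  have finH: "finite (carrier ?H)" using fin finite_subset subgroup.subset [OF H(1)] by auto
  have oH: "order ?H = p ^ (j + 2)" using H(2) by (simp only: order_def) simp
  have ncyc: "\<not> cyclic_group ?H"
  proof
    assume "cyclic_group ?H"
    then obtain x where "x \<in> H" "group.ord ?H x = p ^ (j + 2)"
      using H.cyclic_group_imp_ord [OF finH] H(2) by (auto simp: order_def)
    then show False using nel subgroup_ord [OF is_group H(1)] by auto
  qed
  show ?thesis
  proof (cases "D = H")
    case True
    have e: "2 * (j + 2) = 2 * j + 4" by simp
    have "real (psi ?H) \<le> noncyc_bound p (j + 2) * real (cyc_psi (p ^ (j + 2)))"
      unfolding noncyc_bound_mult_cyc_psi [OF p(1)] e by (rule H.pgroup_psi_le [OF finH p oH ncyc])
    then have "real (\<Sum>u\<in>D. ord u) \<le> W" using W(1) True psi_subgroup [OF H(1)] by simp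
    then show ?thesis using True H(2) by (simp add: mult_left_mono)
  next
    case False
    have sH: "subgroup D ?H"
      by (rule subgroup_incl [OF D(1) H(1) D(2)])
    then have "card D dvd p ^ (j + 2)"
      using H.lagrange [OF sH] oH by (metis dvd_triv_right)
    then obtain i where i: "i \<le> j + 2" "card D = p ^ i" using divides_primepow_nat [OF p(1)] by blast
    have "card D < card H" using False D finH by (simp add: psubset_card_mono)
    then have "i \<noteq> j + 2" using i H(2) by auto
    then have i': "i \<le> Suc j" using i(1) by linarith
    have dvd: "ord u dvd p ^ i" if "u \<in> D" for u
      using ord_dvd_card_subgroup [OF D(1) that] i(2) by simp
    show ?thesis
    proof (cases "\<exists>u\<in>D. ord u = p ^ Suc j")
      case True
      then obtain u where u: "u \<in> D" "ord u = p ^ Suc j" by blast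
      have uG: "u \<in> carrier G" using subgroup.mem_carrier [OF D(1) u(1)] .
      have "p ^ Suc j \<le> p ^ i" using dvd [OF u(1)] u(2) p1 by (simp add: dvd_imp_le)
      then have "Suc j \<le> i" using p1 power_le_imp_le_exp by blast
      then have ij: "i = Suc j" using i' by simp
      have finD: "finite D" using D finH finite_subset by auto
      have "(\<lambda>i::nat. u [^] i) ` {..<ord u} \<subseteq> D" using subgroup_nat_pow_closed [OF D(1) u(1)] by auto
      then have "(\<lambda>i::nat. u [^] i) ` {..<ord u} = D"
        using card_powers [OF uG] i ij u finD by (intro card_subset_eq) auto
      then have "(\<Sum>u\<in>D. ord u) = cyc_psi (p ^ Suc j)"
        using sum_powers_ord [OF fin uG] u(2) by simp
      then have "real (p ^ (j + 2)) * real (\<Sum>u\<in>D. ord u) = real (card D) * real (p * cyc_psi (p ^ Suc j))"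
        using i ij by simp
      then show ?thesis using W(2) by (simp only: mult_left_mono of_nat_0_le_iff)
    next
      case False
      have "ord u \<le> p ^ j" if u: "u \<in> D" for u
      proof -
        obtain l where l: "l \<le> i" "ord u = p ^ l" using dvd [OF u] divides_primepow_nat [OF p(1)] by blast
        then have "l \<noteq> Suc j" using False u by metis
        then show ?thesis using l i' p1 by (simp add: power_increasing)
      qed
      then have "(\<Sum>u\<in>D. ord u) \<le> card D * p ^ j" using sum_bounded_above [of D ord "p ^ j"] by simp
      then have "p ^ (j + 2) * (\<Sum>u\<in>D. ord u) \<le> card D * (p ^ (j + 2) * p ^ j)"
        by (metis mult.left_commute mult_le_mono2)
      then have "real (p ^ (j + 2)) * real (\<Sum>u\<in>D. ord u) \<le> real (card D) * real (p ^ (j + 2) * p ^ j)"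
        by (metis of_nat_le_iff of_nat_mult)
      also have "\<dots> \<le> real (card D) * W" using W(3) by (intro mult_left_mono) auto
      finally show ?thesis .
    qed
  qed
qed

text \<open>The Sylow p-subgroup H has index q < p, so it contains every p-element. An element
  outside H has a q-part y of order q and equals y u with u in the centralizer \<open>D y\<close> of
  y in H, so its order is at most q ord u. The average of ord u over \<open>D y\<close> is at most W
  / |H| whatever the size of \<open>D y\<close>.\<close>

lemma psi_le_normal_sylow_prime_index:
  fixes W :: real
  assumes fin: "finite (carrier G)" and q: "nprime q" and p: "nprime p" "odd p" "q < p"
    and o: "order G = q * p ^ (j + 2)" and nel: "\<And>x. x \<in> carrier G \<Longrightarrow> ord x \<noteq> p ^ (j + 2)"
    and W: "noncyc_bound p (j + 2) * real (cyc_psi (p ^ (j + 2))) \<le> W"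
      "real (p * cyc_psi (p ^ Suc j)) \<le> W" "real (p ^ (j + 2) * p ^ j) \<le> W"
  shows "real (psi G) \<le> W * real (cyc_psi q)"
proof -
  let ?m = "p ^ (j + 2)"
  have p1: "p > 1" and q1: "q > 1" using p q prime_gt_1_nat by blast+
  have cop: "coprime q ?m" using p q by (simp add: primes_coprime)
  obtain H where H: "subgroup H G" "card H = ?m"
    using sylow_thm [OF p(1) is_group _ fin, of "j + 2" q] o by (metis mult.commute)
  have idx: "card (rcosets H) = q" using lagrange [OF H(1)] H(2) o p1 by simp
  have HG: "x \<in> carrier G" if "x \<in> H" for x using subgroup.mem_carrier [OF H(1) that] .
  have Hord: "ord x dvd ?m" if "x \<in> H" for x
    using ord_dvd_card_subgroup [OF H(1) that] H(2) by simp
  have H_iff: "x \<in> H \<longleftrightarrow> \<not> q dvd ord x" if x: "x \<in> carrier G" for x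
  proof
    assume "x \<in> H"
    then show "\<not> q dvd ord x"
      using Hord p q by (metis dvd_trans less_irrefl prime_dvd_power primes_dvd_imp_eq)
  next
    assume "\<not> q dvd ord x"
    then have "coprime (ord x) q" using q by (simp add: coprime_commute prime_imp_coprime)
    then have "ord x dvd ?m" using ord_dvd_group_order [OF x] o by (simp add: coprime_dvd_mult_right_iff)
    then obtain i where "ord x = p ^ i" using divides_primepow_nat [OF p(1)] by blast
    then show "x \<in> H" using small_index_contains [OF fin H(1) p(1) x] idx p(3) by blast
  qed
  obtain e :: nat where e: "\<And>y. y \<in> carrier G \<Longrightarrow> ord y = q \<Longrightarrow> y [^] e = y"
    "\<And>x. x \<in> carrier G \<Longrightarrow> q dvd ord x \<Longrightarrow> ord (x [^] e) = q"
    "\<And>x. x \<in> carrier G \<Longrightarrow> \<not> q dvd ord x \<Longrightarrow> x [^] e = \<one>"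
    using prime_part_exponent [OF fin q o cop] by metis
  define Y where "Y = {y \<in> carrier G. ord y = q}"
  define T where "T y = {x \<in> carrier G. x [^] e = y}" for y
  define D where "D y = H \<inter> elt_centralizer y" for y
  have finY: "finite Y" using fin by (simp add: Y_def)
  have finT: "finite (T y)" for y using fin by (simp add: T_def)
  have Dsub: "subgroup (D y) G" if "y \<in> carrier G" for y
  proof -
    have "subgroup (elt_centralizer y) G"
    proof (rule subgroupI)
      show "elt_centralizer y \<noteq> {}" using that by (auto simp: elt_centralizer_def)
      show "inv a \<in> elt_centralizer y" if a: "a \<in> elt_centralizer y" for a
      proof -
        have "a \<in> carrier G" "a \<otimes> y = y \<otimes> a" using a by (auto simp: elt_centralizer_def)
        then show ?thesis using \<open>y \<in> carrier G\<close>
          by (auto simp: elt_centralizer_def) (metis inv_solve_left inv_solve_right m_assoc m_closed inv_closed)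
      qed
      show "a \<otimes> b \<in> elt_centralizer y" if "a \<in> elt_centralizer y" "b \<in> elt_centralizer y" for a b
        using that \<open>y \<in> carrier G\<close> by (auto simp: elt_centralizer_def m_assoc) (metis m_assoc)
    qed (auto simp: elt_centralizer_def)
    then show ?thesis unfolding D_def by (rule subgroups_Inter_pair [OF H(1)])
  qed
  have bij: "bij_betw (\<lambda>u. y \<otimes> u) (D y) (T y)" if y: "y \<in> Y" for y
  proof -
    have yG: "y \<in> carrier G" "ord y = q" using y by (auto simp: Y_def)
    have "(\<lambda>u. y \<otimes> u) ` D y = T y"
    proof safe
      fix u assume u: "u \<in> D y"
      then have uG: "u \<in> carrier G" "u \<in> H" "y \<otimes> u = u \<otimes> y" by (auto simp: D_def elt_centralizer_def HG)
      have "(y \<otimes> u) [^] e = y [^] e \<otimes> u [^] e" using pow_mult_distrib [OF uG(3) yG(1) uG(1)] .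
      also have "\<dots> = y" using e(1) [OF yG] e(3) [OF uG(1)] H_iff [OF uG(1)] uG yG by simp
      finally show "y \<otimes> u \<in> T y" using uG yG by (simp add: T_def)
    next
      fix x assume "x \<in> T y"
      then have x: "x \<in> carrier G" "x [^] e = y" by (auto simp: T_def)
      then have comm: "x \<otimes> y = y \<otimes> x" by (metis nat_pow_Suc nat_pow_Suc2)
      define u where "u = inv y \<otimes> x"
      have uG: "u \<in> carrier G" using x yG by (simp add: u_def)
      have xu: "x = y \<otimes> u" using x yG by (simp add: u_def m_assoc [symmetric])
      have cu: "u \<otimes> y = y \<otimes> u"
        using comm x yG by (simp add: u_def m_assoc) (simp add: m_assoc [symmetric])
      have "y \<otimes> u [^] e = y \<otimes> \<one>"
        using pow_mult_distrib [OF cu [symmetric] yG(1) uG, of e] x e(1) [OF yG] xu uG yG by simp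
      then have "u [^] e = \<one>" using uG yG by (subst (asm) l_cancel) auto
      then have "\<not> q dvd ord u" using e(2) [OF uG] q1 by auto
      then have "u \<in> D y" using uG H_iff [OF uG] cu by (simp add: D_def elt_centralizer_def)
      then show "x \<in> (\<lambda>u. y \<otimes> u) ` D y" using xu by blast
    qed
    moreover have "inj_on (\<lambda>u. y \<otimes> u) (D y)"
      using yG by (auto simp: inj_on_def D_def elt_centralizer_def)
    ultimately show ?thesis by (simp add: bij_betw_def)
  qed
  have part: "carrier G - H = (\<Union>y\<in>Y. T y)"
  proof safe
    fix x assume "x \<in> carrier G" "x \<notin> H"
    then show "x \<in> (\<Union>y\<in>Y. T y)" using H_iff e(2) by (auto simp: Y_def T_def)
  next
    fix x y assume "y \<in> Y" "x \<in> T y" "x \<in> H"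
    then have x: "x \<in> carrier G" "x [^] e = y" and oy: "ord y = q" by (auto simp: Y_def T_def)
    then have "y = \<one>" using e(3) [OF x(1)] H_iff [OF x(1)] \<open>x \<in> H\<close> by simp
    then show False using oy q1 by simp
  qed (auto simp: T_def)
  have disj: "\<forall>y\<in>Y. \<forall>z\<in>Y. y \<noteq> z \<longrightarrow> T y \<inter> T z = {}" by (auto simp: T_def)
  have bound: "real ?m * real (\<Sum>u\<in>D y. ord u) \<le> real (card (D y)) * W" if "y \<in> carrier G" for y
    using sum_ord_sub_pgroup_le [OF fin p(1,2) H _ Dsub [OF that] _ W] nel HG by (auto simp: D_def)
  have coset: "real ?m * real (\<Sum>x\<in>T y. ord x) \<le> real q * (real (card (T y)) * W)" if y: "y \<in> Y" for y
  proof -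
    have yG: "y \<in> carrier G" "ord y = q" using y by (auto simp: Y_def)
    have "(\<Sum>x\<in>T y. ord x) = (\<Sum>u\<in>D y. ord (y \<otimes> u))"
      using sum.reindex_bij_betw [OF bij [OF y]] by metis
    also have "\<dots> \<le> (\<Sum>u\<in>D y. q * ord u)"
    proof (rule sum_mono)
      fix u assume "u \<in> D y"
      then have u: "u \<in> carrier G" "y \<otimes> u = u \<otimes> y" by (auto simp: D_def elt_centralizer_def)
      then show "ord (y \<otimes> u) \<le> q * ord u"
        using ord_mul_divides [OF u(2) yG(1) u(1)] yG(2) q1 ord_ge_1 [OF fin u(1)]
        by (intro dvd_imp_le) auto
    qed
    finally have "real (\<Sum>x\<in>T y. ord x) \<le> real q * real (\<Sum>u\<in>D y. ord u)"
      unfolding sum_distrib_left [symmetric] of_nat_mult [symmetric] of_nat_le_iff .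
    then have "real ?m * real (\<Sum>x\<in>T y. ord x) \<le> real q * (real ?m * real (\<Sum>u\<in>D y. ord u))"
      by (metis mult.left_commute mult_left_mono of_nat_0_le_iff)
    also have "\<dots> \<le> real q * (real (card (D y)) * W)"
      using bound [OF yG(1)] by (intro mult_left_mono) auto
    finally show ?thesis using bij_betw_same_card [OF bij [OF y]] by simp
  qed
  \<comment> \<open>The sum over H itself is the case y = 1 of the estimate for
    \<open>D y\<close>.\<close>
  have "elt_centralizer \<one> = carrier G" by (auto simp: elt_centralizer_def)
  then have "D \<one> = H" using HG by (auto simp: D_def)
  then have SW: "real (\<Sum>u\<in>H. ord u) \<le> W" using bound [of \<one>] H(2) p1 by simp
  have "real ?m * real (\<Sum>x\<in>carrier G - H. ord x) = (\<Sum>y\<in>Y. real ?m * real (\<Sum>x\<in>T y. ord x))"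
    unfolding part using sum.UNION_disjoint [OF finY _ disj, of ord] finT by (simp add: sum_distrib_left)
  also have "\<dots> \<le> (\<Sum>y\<in>Y. real q * (real (card (T y)) * W))" using coset by (rule sum_mono)
  also have "\<dots> = real q * W * real (\<Sum>y\<in>Y. card (T y))"
    by (simp add: sum_distrib_left sum_distrib_right mult_ac)
  also have "(\<Sum>y\<in>Y. card (T y)) = card (carrier G - H)"
    unfolding part using finY finT disj by (subst card_UN_disjoint) auto
  also have "\<dots> = q * ?m - ?m"
    using card_Diff_subset [of H "carrier G"] subgroup.subset [OF H(1)] H(2) o fin finite_subset
    by (metis order_def)
  also have "real (q * ?m - ?m) = real ?m * (real q - 1)" using q1 by (simp add: of_nat_diff algebra_simps)
  finally have "real ?m * real (\<Sum>x\<in>carrier G - H. ord x) \<le> real ?m * (real q * W * (real q - 1))"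
    by (simp only: mult_ac)
  then have CW: "real (\<Sum>x\<in>carrier G - H. ord x) \<le> real q * W * (real q - 1)"
    using p1 by (simp only: mult_le_cancel_left_pos of_nat_0_less_iff zero_less_power)
  \<comment> \<open>H contributes at most W and its complement at most q (q-1) W; the total factor 1
    + q (q-1) is psi(C_q).\<close>
  have "psi G = (\<Sum>u\<in>H. ord u) + (\<Sum>x\<in>carrier G - H. ord x)"
    unfolding psi_def using fin subgroup.subset [OF H(1)] by (simp add: sum.subset_diff add.commute)
  then have "real (psi G) \<le> W * ((real q) * real q - real q + 1)" using SW CW by (simp add: algebra_simps)
  also have "real q * real q - real q + 1 = real (cyc_psi q)"
    using cyc_psi_prime [OF q] by simp
  finally show ?thesis .
qed

end

text \<open>With W = \<open>noncyc_bound p 2\<close> times psi(C_(p^(j+2))), the three assumptions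
  on W become polynomial inequalities in p and p^(2j), valid from p = 3 on.\<close>

lemma (in group) two_prime_psi_le:
  assumes fin: "finite (carrier G)" and q: "nprime q" and p: "nprime p" "odd p" "q < p"
    and o: "order G = q * p ^ (j + 2)" and nel: "\<And>x. x \<in> carrier G \<Longrightarrow> ord x \<noteq> p ^ (j + 2)"
  shows "real (psi G) \<le> noncyc_bound p 2 * real (cyc_psi (p ^ (j + 2))) * real (cyc_psi q)"
proof (rule psi_le_normal_sylow_prime_index [OF assms])
  have p3: "p \<ge> 3" using p prime_ge_2_nat [OF p(1)] by (cases "p = 2") auto
  define x xk where "x = real p" and "xk = x ^ (2 * j)"
  have x: "x \<ge> 3" using p3 by (simp add: x_def)
  have X1: "xk \<ge> 1" using x by (simp add: xk_def one_le_power)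
  define c where "c = x ^ 3 - x ^ 2 + 1"
  have nb: "noncyc_bound p 2 = (x ^ 4 + c) / (x ^ 5 + 1)"
    by (simp add: noncyc_bound_def x_def c_def)
  have pos: "x ^ 5 + 1 > 0" "x + 1 > 0" using x by (auto intro!: add_nonneg_pos)
  have cp2: "real (cyc_psi (p ^ (j + 2))) = (xk * x ^ 5 + 1) / (x + 1)"
    unfolding cyc_psi_prime_power_real [OF p(1)] by (simp add: x_def xk_def power_add numeral_eq_Suc)
  have cp1: "real (cyc_psi (p ^ Suc j)) = (xk * x ^ 3 + 1) / (x + 1)"
    unfolding cyc_psi_prime_power_real [OF p(1)] by (simp add: x_def xk_def power_add numeral_eq_Suc)
  show "noncyc_bound p (j + 2) * real (cyc_psi (p ^ (j + 2))) \<le> noncyc_bound p 2 * real (cyc_psi (p ^ (j + 2)))"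
    using noncyc_bound_antimono_exp p3 by (intro mult_right_mono) auto
  have eq: "noncyc_bound p 2 * real (cyc_psi (p ^ (j + 2))) = (x ^ 4 + c) * (xk * x ^ 5 + 1) / ((x ^ 5 + 1) * (x + 1))"
    unfolding nb cp2 by simp
  have frac_le: "A / (x + 1) \<le> B / ((x ^ 5 + 1) * (x + 1))" if "A * (x ^ 5 + 1) \<le> B" for A B
  proof -
    have "A / (x + 1) = (A * (x ^ 5 + 1)) / ((x ^ 5 + 1) * (x + 1))" using pos by simp
    also have "\<dots> \<le> B / ((x ^ 5 + 1) * (x + 1))" using that pos by (intro divide_right_mono) auto
    finally show ?thesis .
  qed
  \<comment> \<open>After shifting a variable to its least value, the polynomials in question have
    nonnegative coefficients, so their sign is visible term by term. The later polynomial
    inequalities use the same device.\<close>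
  obtain z where z: "x = 3 + z" "z \<ge> 0" using x by (metis add_diff_cancel_left' diff_ge_0_iff_ge add.commute diff_add_cancel)
  obtain Z where Z: "xk = 1 + Z" "Z \<ge> 0" using X1 by (metis diff_ge_0_iff_ge add.commute diff_add_cancel)
  have "x * (xk * x ^ 3 + 1) * (x ^ 5 + 1) \<le> (x ^ 4 + c) * (xk * x ^ 5 + 1)"
  proof -
    have "(x ^ 4 + c) * (xk * x ^ 5 + 1) - x * (xk * x ^ 3 + 1) * (x ^ 5 + 1)
        = Z * (x ^ 7 * (x - 1) + x ^ 4 * (x - 1)) + (x ^ 6 * (x * (x - 1) - 1) + (x ^ 5 + x ^ 3 - x ^ 2 - x + 1))"
      unfolding Z c_def by (simp add: algebra_simps numeral_eq_Suc)
    moreover have "x ^ 5 + x ^ 3 - x ^ 2 - x + 1 \<ge> 0"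
      unfolding z using z(2) by (simp add: algebra_simps numeral_eq_Suc)
    moreover have "x * (x - 1) - 1 \<ge> 0" unfolding z using z(2) by (simp add: algebra_simps)
    ultimately show ?thesis using x Z(2) by (smt (verit) mult_nonneg_nonneg zero_le_power)
  qed
  then show "real (p * cyc_psi (p ^ Suc j)) \<le> noncyc_bound p 2 * real (cyc_psi (p ^ (j + 2)))"
    unfolding eq of_nat_mult cp1 x_def [symmetric] times_divide_eq_right by (rule frac_le)
  have "xk * x ^ 2 * (x + 1) * (x ^ 5 + 1) \<le> (x ^ 4 + c) * (xk * x ^ 5 + 1)"
  proof -
    have "(x ^ 4 + c) * (xk * x ^ 5 + 1) - xk * x ^ 2 * (x + 1) * (x ^ 5 + 1)
        = xk * x ^ 2 * (x ^ 7 - 2 * x ^ 5 + x ^ 3 - x - 1) + (x ^ 4 + x ^ 2 * (x - 1) + 1)"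
      unfolding c_def by (simp add: algebra_simps numeral_eq_Suc)
    moreover have "x ^ 7 - 2 * x ^ 5 + x ^ 3 - x - 1 \<ge> 0"
      unfolding z using z(2) by (simp add: algebra_simps numeral_eq_Suc)
    ultimately show ?thesis using x X1 by (smt (verit) mult_nonneg_nonneg zero_le_power)
  qed
  then have "xk * x ^ 2 * (x + 1) / (x + 1) \<le> (x ^ 4 + c) * (xk * x ^ 5 + 1) / ((x ^ 5 + 1) * (x + 1))"
    by (rule frac_le)
  moreover have "real (p ^ (j + 2) * p ^ j) = xk * x ^ 2 * (x + 1) / (x + 1)"
    using pos by (simp add: xk_def x_def power_add mult_2 power2_eq_square)
  ultimately show "real (p ^ (j + 2) * p ^ j) \<le> noncyc_bound p 2 * real (cyc_psi (p ^ (j + 2)))"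
    unfolding eq by simp
qed

subsection \<open>Bertrand's postulate\<close>

text \<open>Legendre's formula, cut off where the floors vanish. From n to n + 1 the floor of n /
  p^i jumps exactly when p^i divides n + 1, and the number of such i is the multiplicity of p in n +
  1.\<close>

lemma multiplicity_fact_prime:
  assumes p: "nprime p" and n: "n < p ^ Suc L"
  shows "multiplicity p (fact n :: nat) = (\<Sum>i\<in>{1..L}. n div p ^ i)"
  using n
proof (induction n)
  case (Suc n)
  have p0: "p > 1" using p prime_gt_1_nat by blast
  have "multiplicity p (fact (Suc n) :: nat) = multiplicity p (Suc n) + multiplicity p (fact n :: nat)"
  proof -
    have "(fact (Suc n) :: nat) = Suc n * fact n" by simp
    then show ?thesis
      using prime_elem_multiplicity_mult_distrib [of p "Suc n" "fact n"] p by simp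
  qed
  also have "multiplicity p (Suc n) = card {i\<in>{1..L}. p ^ i dvd Suc n}"
  proof -
    have iff: "p ^ i dvd Suc n \<longleftrightarrow> i \<le> multiplicity p (Suc n)" for i
      using p0 by (intro power_dvd_iff_le_multiplicity) auto
    have "p ^ multiplicity p (Suc n) \<le> Suc n" using iff by (intro dvd_imp_le) auto
    then have "p ^ multiplicity p (Suc n) < p ^ Suc L" using Suc.prems by simp
    then have "multiplicity p (Suc n) \<le> L" using p0 by (simp only: power_strict_increasing_iff less_Suc_eq_le)
    then have "{i\<in>{1..L}. p ^ i dvd Suc n} = {1..multiplicity p (Suc n)}" unfolding iff by auto
    then show ?thesis by simp
  qed
  also have "\<dots> = (\<Sum>i\<in>{1..L}. if p ^ i dvd Suc n then 1 else 0)"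
    by (simp add: sum.inter_filter [symmetric])
  also have "multiplicity p (fact n :: nat) = (\<Sum>i\<in>{1..L}. n div p ^ i)" using Suc by simp
  finally show ?case
    by (simp add: sum.distrib [symmetric] div_Suc dvd_eq_mod_eq_0 cong: if_cong) (rule sum.cong, auto)
qed simp

text \<open>By Legendre's formula the multiplicity is a sum of terms floor(2n/p^i) - 2 floor(n/p^i),
  each 0 or 1, over the i with p^i <= 2n. At most one such i exists if p^2 > 2n; and for 2n/3 < p <=
  n its term is 0, because n mod p = n - p is below p/2.\<close>

lemma central_binomial_prime_power_le:
  assumes p: "nprime p" and n: "n \<ge> 1"
  shows "p ^ multiplicity p ((2 * n) choose n) \<le> 2 * n"
    and "2 * n < p\<^sup>2 \<Longrightarrow> multiplicity p ((2 * n) choose n) \<le> 1"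
    and "2 * n < 3 * p \<Longrightarrow> p \<le> n \<Longrightarrow> 2 < p \<Longrightarrow> multiplicity p ((2 * n) choose n) = 0"
proof -
  have p1: "p > 1" using p prime_gt_1_nat by blast
  define v where "v = multiplicity p ((2 * n) choose n)"
  obtain L where L: "p ^ L \<le> 2 * n" "2 * n < p ^ Suc L"
  proof -
    have "\<exists>k. p ^ k \<le> 2 * n \<and> 2 * n < p ^ (k + 1)"
      using ex_power_ivl1 [of p "2 * n"] p1 n by simp
    then show ?thesis using that by auto
  qed
  have "(fact (2 * n) :: nat) = fact n * fact n * ((2 * n) choose n)"
    using binomial_fact_lemma [of n "2 * n"] by (simp add: mult_2)
  then have "multiplicity p (fact (2 * n) :: nat) = multiplicity p (fact n :: nat) + multiplicity p (fact n :: nat) + v"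
    using p by (simp add: prime_elem_multiplicity_mult_distrib v_def)
  then have "(\<Sum>i\<in>{1..L}. (2 * n) div p ^ i) = (\<Sum>i\<in>{1..L}. 2 * (n div p ^ i)) + v"
    using L multiplicity_fact_prime [OF p, of "2 * n" L] multiplicity_fact_prime [OF p, of n L]
    by (simp add: sum_distrib_left [symmetric])
  moreover have step: "(2 * n) div p ^ i = 2 * (n div p ^ i) + (2 * (n mod p ^ i)) div p ^ i" for i
  proof -
    have "2 * n = 2 * (n mod p ^ i) + p ^ i * (2 * (n div p ^ i))"
      by (metis distrib_left mod_mult_div_eq mult.left_commute)
    then show ?thesis using p1 by (metis add.commute div_mult_self2 power_not_zero less_numeral_extra(3) not_one_less_zero)
  qed
  ultimately have v: "v = (\<Sum>i\<in>{1..L}. (2 * (n mod p ^ i)) div p ^ i)"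
    by (simp add: sum.distrib)
  have le1: "(2 * (n mod p ^ i)) div p ^ i \<le> 1" for i
  proof -
    have "2 * (n mod p ^ i) < 2 * p ^ i" using p1 by simp
    then show ?thesis by (metis One_nat_def less_mult_imp_div_less less_Suc_eq_le numeral_2_eq_2)
  qed
  have "v \<le> (\<Sum>i\<in>{1..L}. 1)" unfolding v by (rule sum_mono) (rule le1)
  then have vL: "v \<le> L" by simp
  show "p ^ multiplicity p ((2 * n) choose n) \<le> 2 * n"
    using vL L p1 unfolding v_def [symmetric] by (meson le_trans less_imp_le power_increasing)
  show "multiplicity p ((2 * n) choose n) \<le> 1" if "2 * n < p\<^sup>2"
  proof -
    have "p ^ L < p ^ 2" using L(1) that by linarith
    then have "L < 2" using p1 by (simp only: power_strict_increasing_iff)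
    then show ?thesis using vL unfolding v_def by linarith
  qed
  show "multiplicity p ((2 * n) choose n) = 0" if "2 * n < 3 * p" "p \<le> n" "2 < p"
  proof -
    have "3 * p \<le> p * p" using that by simp
    then have "p ^ L < p ^ 2" using L(1) that unfolding power2_eq_square by linarith
    then have "L < 2" using p1 by (simp only: power_strict_increasing_iff)
    moreover have "n mod p = n - p"
    proof -
      have "n mod p = (n - p) mod p" using that by (simp add: le_mod_geq)
      then show ?thesis using that by simp
    qed
    then have "(2 * (n mod p)) div p = 0" using that by simp
    ultimately have "v = 0" unfolding v by (cases "L = 0") (auto simp: less_2_cases_iff)
    then show ?thesis by (simp add: v_def)
  qed
qed

lemma prod_primes_dvd:
  assumes "finite A" "\<And>p. p \<in> A \<Longrightarrow> nprime p \<and> p dvd c"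
  shows "(\<Prod>p\<in>A. p) dvd (c :: nat)"
  using assms
proof (induction A rule: finite_induct)
  case (insert p A)
  have "coprime p q" if "q \<in> A" for q
    using insert.prems that insert.hyps by (intro primes_coprime) auto
  then have "coprime p (\<Prod>p\<in>A. p)" by (rule prod_coprime_right)
  then show ?case using insert by (simp add: divides_mult)
qed simp

text \<open>Erdos's argument. An even n > 2 adds no prime. For n = 2m + 1 the primes in (m+1, n]
  divide the binomial coefficient n over m, which occurs twice in a row of sum 2^n and so is at most
  4^m.\<close>

lemma primorial_le: "(\<Prod>p\<in>{p. nprime p \<and> p \<le> n}. p) \<le> 4 ^ n"
proof (induction n rule: less_induct)
  case (less n)
  have fin: "finite {p. nprime p \<and> p \<le> n}" for n by simp
  consider "n \<le> 1" | "n = 2" | "n > 2" "even n" | "n > 2" "odd n" by linarith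
  then show ?case
  proof cases
    case 1
    then have "\<not> p \<le> n" if "nprime p" for p using prime_ge_2_nat [OF that] by simp
    then have "{p. nprime p \<and> p \<le> n} = {}" by blast
    then show ?thesis by (simp only: prod.empty) simp
  next
    case 2
    have "p = 2" if "nprime p" "p \<le> 2" for p using that prime_ge_2_nat [of p] by simp
    then have "{p. nprime p \<and> p \<le> n} = {2}" using 2 by auto
    then show ?thesis using 2 by simp
  next
    case 3
    have "\<not> nprime n" using 3 primes_dvd_imp_eq [OF two_is_prime_nat, of n] by auto
    then have "p \<le> n \<longleftrightarrow> p \<le> n - 1" if "nprime p" for p using that by (cases "p = n") auto
    then have "{p. nprime p \<and> p \<le> n} = {p. nprime p \<and> p \<le> n - 1}" by blast
    then have "(\<Prod>p\<in>{p. nprime p \<and> p \<le> n}. p) \<le> 4 ^ (n - 1)" using less [of "n - 1"] 3 by simp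
    also have "\<dots> \<le> 4 ^ n" by (intro power_increasing) auto
    finally show ?thesis .
  next
    case 4
    then obtain m where m: "n = 2 * m + 1" by (auto elim: oddE)
    then have m1: "m \<ge> 1" using 4 by simp
    let ?A = "{p. nprime p \<and> p \<le> m + 1}" and ?B = "{p. nprime p \<and> m + 1 < p \<and> p \<le> n}"
    let ?C = "(2 * m + 1) choose m"
    have finB: "finite ?B" by simp
    have "{p. nprime p \<and> p \<le> n} = ?A \<union> ?B" using m by auto
    then have "(\<Prod>p\<in>{p. nprime p \<and> p \<le> n}. p) = (\<Prod>p\<in>?A. p) * (\<Prod>p\<in>?B. p)"
      by (simp only:) (rule prod.union_disjoint, auto)
    also have "(\<Prod>p\<in>?A. p) \<le> 4 ^ (m + 1)" using less [of "m + 1"] m m1 by simp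
    also have "(\<Prod>p\<in>?B. p) \<le> ?C"
    proof (rule dvd_imp_le)
      show "(\<Prod>p\<in>?B. p) dvd ?C"
      proof (rule prod_primes_dvd [OF finB])
        fix p assume p: "p \<in> ?B"
        have "fact n = fact m * fact (m + 1) * ?C"
          using binomial_fact_lemma [of m n] m by (simp add: mult_ac)
        moreover have "p dvd (fact n :: nat)" using p by (simp add: prime_dvd_fact_iff)
        moreover have "\<not> p dvd (fact m :: nat)" "\<not> p dvd (fact (m + 1) :: nat)"
          using p by (auto simp: prime_dvd_fact_iff simp del: fact_Suc)
        ultimately show "nprime p \<and> p dvd ?C" using p by (simp add: prime_dvd_mult_iff del: fact_Suc)
      qed
    qed (simp add: zero_less_binomial)
    also have "?C \<le> 4 ^ m"
    proof -
      have "?C + ((2 * m + 1) choose (m + 1)) = (\<Sum>k\<in>{m, m + 1}. (2 * m + 1) choose k)" by simp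
      also have "\<dots> \<le> (\<Sum>k\<le>2 * m + 1. (2 * m + 1) choose k)"
        using m1 by (intro sum_mono2) auto
      also have "\<dots> = 2 ^ (2 * m + 1)" by (rule choose_row_sum)
      finally have "?C + ((2 * m + 1) choose (m + 1)) \<le> 2 ^ (2 * m + 1)" .
      moreover have "((2 * m + 1) choose (m + 1)) = ?C"
        using binomial_symmetric [of m "2 * m + 1"] by simp
      moreover have "2 ^ (2 * m + 1) = 2 * (4::nat) ^ m" by (simp add: power_mult)
      ultimately show ?thesis by linarith
    qed
    finally have "(\<Prod>p\<in>{p. nprime p \<and> p \<le> n}. p) \<le> 4 ^ (m + 1) * 4 ^ m" by (simp add: mult_le_mono)
    also have "\<dots> = 4 ^ n" using m by (simp add: power_add mult_2)
    finally show ?thesis .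
  qed
qed

lemma ex_floor_sqrt: "\<exists>s. s\<^sup>2 \<le> m \<and> m < (Suc s)\<^sup>2" for m :: nat
proof (induction m)
  case 0
  show ?case by (rule exI [of _ 0]) simp
next
  case (Suc m)
  then obtain s where s: "s\<^sup>2 \<le> m" "m < (Suc s)\<^sup>2" by blast
  show ?case
  proof (cases "Suc m < (Suc s)\<^sup>2")
    case True
    then show ?thesis using s by (intro exI [of _ s]) auto
  next
    case False
    then have "Suc m = (Suc s)\<^sup>2" using s by linarith
    then show ?thesis by (intro exI [of _ "Suc s"]) (auto simp: power2_eq_square)
  qed
qed

text \<open>Without primes strictly between n and 2n, every prime factor is at most 2n/3. Those with
  p^2 <= 2n number at most s and contribute at most 2n each; the others occur to the first power, so
  the primorial bounds their product.\<close>

lemma central_binomial_le: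
  assumes n: "n \<ge> 3" and no: "\<And>p. nprime p \<Longrightarrow> n < p \<Longrightarrow> \<not> p < 2 * n"
    and s: "2 * n < (Suc s)\<^sup>2"
  shows "(2 * n) choose n \<le> (2 * n) ^ s * 4 ^ (2 * n div 3)"
proof -
  let ?C = "(2 * n) choose n" let ?v = "\<lambda>p. multiplicity p ?C"
  have C0: "?C > 0" by simp
  define A where "A = {p \<in> prime_factors ?C. p\<^sup>2 \<le> 2 * n}"
  define B where "B = {p \<in> prime_factors ?C. \<not> p\<^sup>2 \<le> 2 * n}"
  have fin: "finite A" "finite B" by (auto simp: A_def B_def)
  have pr: "nprime p" "?v p \<ge> 1" if "p \<in> prime_factors ?C" for p
    using that by (auto simp: prime_factors_multiplicity)
  have le: "p ^ ?v p \<le> 2 * n" if "p \<in> prime_factors ?C" for p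
    using central_binomial_prime_power_le(1) [OF pr(1) [OF that]] n by simp
  have small: "p \<le> 2 * n div 3" if p: "p \<in> prime_factors ?C" for p
  proof -
    have p2: "p \<ge> 2" using pr [OF p] prime_ge_2_nat by blast
    have "p ^ 1 \<le> p ^ ?v p" using pr [OF p] p2 by (intro power_increasing) auto
    then have p2n: "p \<le> 2 * n" using le [OF p] by simp
    have "p \<noteq> 2 * n"
    proof
      assume "p = 2 * n"
      then have "2 dvd p" by simp
      then have "2 = p" using primes_dvd_imp_eq two_is_prime_nat pr(1) [OF p] by blast
      then show False using \<open>p = 2 * n\<close> n by simp
    qed
    then have pn: "p \<le> n" using no [OF pr(1) [OF p]] p2n by linarith
    show ?thesis
    proof (cases "p = 2")
      case False
      then have "2 < p" using p2 by simp
      then have "\<not> 2 * n < 3 * p"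
        using central_binomial_prime_power_le(3) [OF pr(1) [OF p], of n] n pn pr(2) [OF p] by auto
      then show ?thesis by simp
    qed (use n in simp)
  qed
  have "?C = (\<Prod>p\<in>prime_factors ?C. p ^ ?v p)" using prime_factorization_nat [OF C0] .
  also have "prime_factors ?C = A \<union> B" by (auto simp: A_def B_def)
  also have "(\<Prod>p\<in>A \<union> B. p ^ ?v p) = (\<Prod>p\<in>A. p ^ ?v p) * (\<Prod>p\<in>B. p ^ ?v p)"
    using fin by (intro prod.union_disjoint) (auto simp: A_def B_def)
  also have "\<dots> \<le> (2 * n) ^ s * 4 ^ (2 * n div 3)"
  proof (rule mult_le_mono)
    have "A \<subseteq> {1..s}"
    proof
      fix p assume p: "p \<in> A"
      then have "p\<^sup>2 < (Suc s)\<^sup>2" using s by (auto simp: A_def)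
      then have "p < Suc s" by (rule power_less_imp_less_base) simp
      moreover have "p \<ge> 2" using p pr prime_ge_2_nat by (auto simp: A_def)
      ultimately show "p \<in> {1..s}" by simp
    qed
    then have cA: "card A \<le> s" using card_mono [of "{1..s}" A] by simp
    have "(\<Prod>p\<in>A. p ^ ?v p) \<le> (\<Prod>p\<in>A. 2 * n)" using le by (intro prod_mono) (auto simp: A_def)
    also have "\<dots> = (2 * n) ^ card A" by simp
    also have "\<dots> \<le> (2 * n) ^ s" using cA n by (intro power_increasing) auto
    finally show "(\<Prod>p\<in>A. p ^ ?v p) \<le> (2 * n) ^ s" .
    have "(\<Prod>p\<in>B. p ^ ?v p) \<le> (\<Prod>p\<in>B. p)"
    proof (rule prod_mono)
      fix p assume "p \<in> B"
      then have p: "p \<in> prime_factors ?C" "2 * n < p\<^sup>2" by (auto simp: B_def)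
      then have "?v p = 1"
        using central_binomial_prime_power_le(2) [OF pr(1) [OF p(1)], of n] n pr(2) [OF p(1)] by simp
      then show "0 \<le> p ^ ?v p \<and> p ^ ?v p \<le> p" by simp
    qed
    also have "\<dots> \<le> (\<Prod>p\<in>{p. nprime p \<and> p \<le> 2 * n div 3}. p)"
    proof (rule dvd_imp_le)
      have "B \<subseteq> {p. nprime p \<and> p \<le> 2 * n div 3}" using small pr by (auto simp: B_def)
      then show "(\<Prod>p\<in>B. p) dvd (\<Prod>p\<in>{p. nprime p \<and> p \<le> 2 * n div 3}. p)"
        by (intro prod_dvd_prod_subset) auto
      show "(\<Prod>p\<in>{p. nprime p \<and> p \<le> 2 * n div 3}. p) > 0"
        by (intro prod_pos) (auto dest: prime_gt_0_nat)
    qed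
    also have "\<dots> \<le> 4 ^ (2 * n div 3)" by (rule primorial_le)
    finally show "(\<Prod>p\<in>B. p ^ ?v p) \<le> 4 ^ (2 * n div 3)" .
  qed
  finally show ?thesis .
qed

text \<open>Integers s and t with s^2 <= 2n < (s+1)^2 and 4^t <= 2n < 4^(t+1) replace square root
  and logarithm. Comparing exponents of 4 yields s^2 <= 6 (t+1)(s+1), against s >= 7 (t+1). The
  threshold 2048 is half of 4^6, since 7t + 7 <= 2^t begins to hold at t = 6.\<close>

lemma bertrand_large:
  assumes n: "n \<ge> 2048"
  shows "\<exists>p. nprime p \<and> n < p \<and> p < 2 * n"
proof (rule ccontr)
  assume no: "\<not> ?thesis"
  define m where "m = 2 * n"
  obtain s where s: "s\<^sup>2 \<le> m" "m < (Suc s)\<^sup>2" using ex_floor_sqrt by blast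
  obtain t where t: "4 ^ t \<le> m" "m < 4 ^ (t + 1)"
    using ex_power_ivl1 [of 4 m] n by (auto simp: m_def)
  have "(4::nat) ^ 6 < 4 ^ (t + 1)" using t(2) n by (simp add: m_def)
  then have t6: "t \<ge> 6" using power_less_imp_less_exp [of "4::nat" 6 "t + 1"] by simp
  have "(2 ^ t)\<^sup>2 \<le> m" using t(1) by (simp add: power2_eq_square power_mult_distrib [symmetric])
  then have "(2 ^ t)\<^sup>2 < (Suc s)\<^sup>2" using s(2) by linarith
  then have "2 ^ t < Suc s" by (rule power_less_imp_less_base) simp
  moreover have "7 * t + 7 \<le> 2 ^ t" using t6 by (induction t rule: dec_induct) auto
  ultimately have st: "7 * t + 7 \<le> s" by linarith
  have "real (4 ^ n) \<le> real (m * (m choose n))"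
    using central_binomial_lower_bound [of n] n by (simp add: m_def field_simps)
  then have "4 ^ n \<le> m * (m choose n)" by (simp only: of_nat_le_iff)
  also have "\<dots> \<le> m * (m ^ s * 4 ^ (m div 3))"
    unfolding m_def using central_binomial_le [of n s] n no s(2) by (intro mult_le_mono) (auto simp: m_def)
  also have "\<dots> = m ^ (s + 1) * 4 ^ (m div 3)" by simp
  also have "\<dots> \<le> (4 ^ (t + 1)) ^ (s + 1) * 4 ^ (m div 3)"
    using t(2) by (intro mult_le_mono power_mono) auto
  also have "\<dots> = 4 ^ ((t + 1) * (s + 1) + m div 3)" by (simp only: power_add power_mult)
  finally have "n \<le> (t + 1) * (s + 1) + m div 3" by (rule power_le_imp_le_exp [rotated]) simp
  then have "m \<le> 6 * ((t + 1) * (s + 1))" unfolding m_def by linarith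
  then have "s * s \<le> 6 * ((t + 1) * (s + 1))" using s(1) unfolding power2_eq_square by linarith
  moreover have "(7 * t + 7) * s \<le> s * s" using st by (rule mult_le_mono1)
  moreover have "(7 * t + 7) * s = 6 * ((t + 1) * s) + (t + 1) * s" by (simp add: algebra_simps)
  moreover have "6 * ((t + 1) * (s + 1)) = 6 * ((t + 1) * s) + (t + 1) * 6" by (simp add: algebra_simps)
  moreover have "(t + 1) * 6 < (t + 1) * s" using st by (intro mult_strict_left_mono) auto
  ultimately show False by linarith
qed

lemma primeI_trial_division:
  assumes n: "1 < n" "n < (Suc r)\<^sup>2" and ndvd: "\<forall>d\<in>set [2..<Suc r]. \<not> d dvd n"
  shows "nprime n"
proof (rule ccontr)
  assume np: "\<not> nprime n"
  obtain p where p: "nprime p" "p dvd n" using prime_factor_nat [of n] n by auto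
  then obtain m where m: "n = p * m" by auto
  have "p \<ge> 2" using p prime_ge_2_nat by blast
  have "m \<ge> 2" using m n p np by (cases "m = 0 \<or> m = 1") auto
  have "p \<ge> Suc r" using ndvd p(2) \<open>p \<ge> 2\<close> by (metis atLeastLessThan_iff not_le set_upt)
  moreover have "m \<ge> Suc r" using ndvd m \<open>m \<ge> 2\<close> by (metis atLeastLessThan_iff dvd_triv_right not_le set_upt)
  ultimately have "Suc r * Suc r \<le> n" unfolding m by (rule mult_le_mono)
  then show False using n by (simp add: power2_eq_square)
qed

theorem bertrand:
  assumes n: "n \<ge> 2"
  shows "\<exists>p. nprime p \<and> n < p \<and> p < 2 * n"
proof (cases "n \<ge> 2048")
  case False
  \<comment> \<open>Each prime of the chain 3, 5, 7, 13, ..., 2503 is less than twice its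
    predecessor, so together they serve every n from 2 to 2047.\<close>
  have primes: "nprime 3" "nprime 5" "nprime 7" "nprime 13" "nprime 23" "nprime 43" "nprime 83" "nprime 163"
    by simp_all
  have "nprime 317" by (rule primeI_trial_division [of _ 17]) simp_all
  moreover have "nprime 631" by (rule primeI_trial_division [of _ 25]) simp_all
  moreover have "nprime 1259" by (rule primeI_trial_division [of _ 35]) simp_all
  moreover have "nprime 2503" by (rule primeI_trial_division [of _ 50]) simp_all
  ultimately have primes': "nprime 317" "nprime 631" "nprime 1259" "nprime 2503" by blast+
  consider "n < 3" | "3 \<le> n" "n < 5" | "5 \<le> n" "n < 7" | "7 \<le> n" "n < 13" | "13 \<le> n" "n < 23"
    | "23 \<le> n" "n < 43" | "43 \<le> n" "n < 83" | "83 \<le> n" "n < 163" | "163 \<le> n" "n < 317"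
    | "317 \<le> n" "n < 631" | "631 \<le> n" "n < 1259" | "1259 \<le> n" "n < 2503"
    using False by linarith
  then show ?thesis
  proof cases
    case 1 then show ?thesis using primes primes' n by (intro exI [of _ 3] conjI) (assumption | linarith)+
  next case 2 then show ?thesis using primes primes' by (intro exI [of _ 5] conjI) (assumption | linarith)+
  next case 3 then show ?thesis using primes primes' by (intro exI [of _ 7] conjI) (assumption | linarith)+
  next case 4 then show ?thesis using primes primes' by (intro exI [of _ 13] conjI) (assumption | linarith)+
  next case 5 then show ?thesis using primes primes' by (intro exI [of _ 23] conjI) (assumption | linarith)+
  next case 6 then show ?thesis using primes primes' by (intro exI [of _ 43] conjI) (assumption | linarith)+
  next case 7 then show ?thesis using primes primes' by (intro exI [of _ 83] conjI) (assumption | linarith)+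
  next case 8 then show ?thesis using primes primes' by (intro exI [of _ 163] conjI) (assumption | linarith)+
  next case 9 then show ?thesis using primes primes' by (intro exI [of _ 317] conjI) (assumption | linarith)+
  next case 10 then show ?thesis using primes primes' by (intro exI [of _ 631] conjI) (assumption | linarith)+
  next case 11 then show ?thesis using primes primes' by (intro exI [of _ 1259] conjI) (assumption | linarith)+
  next case 12 then show ?thesis using primes primes' by (intro exI [of _ 2503] conjI) (assumption | linarith)+
  qed
qed (rule bertrand_large)

subsection \<open>The upper bound\<close>

text \<open>For a prime power, psi(C_(p^k)) (p+1)/p = (p^(2k+1) + 1)/p is slightly above p^(2k), and
  both sides are multiplicative.\<close>

lemma cyc_psi_lower:
  assumes "n > 0"
  shows "real n ^ 2 \<le> real (cyc_psi n) * (\<Prod>p\<in>prime_factors n. (real p + 1) / real p)"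
  using assms
proof (induction n rule: less_induct)
  case (less n)
  show ?case
  proof (cases "n = 1")
    case False
    then obtain p where p: "nprime p" "p dvd n" using prime_factor_nat by blast
    define k where "k = multiplicity p n"
    obtain m where m: "n = p ^ k * m" "\<not> p dvd m"
      using multiplicity_decompose' [of n p] less.prems p unfolding k_def
      by (metis not_prime_unit gr_implies_not0)
    have p1: "p > 1" using p prime_gt_1_nat by blast
    have m0: "m > 0" using m less.prems by (metis gr0I mult_0_right)
    have k0: "k > 0" using p less.prems by (simp add: k_def prime_multiplicity_gt_zero_iff)
    have cop: "coprime (p ^ k) m" using p m by (simp add: prime_imp_coprime)
    have "m < n" using m one_less_power [OF p1 k0] m0 by simp
    then have IH: "real m ^ 2 \<le> real (cyc_psi m) * (\<Prod>p\<in>prime_factors m. (real p + 1) / real p)"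
      using less.IH m0 by blast
    have pf: "prime_factors n = insert p (prime_factors m)"
      using p m k0 m0 p1 by (auto simp: prime_factors_product prime_factors_power prime_prime_factors)
    have pm: "p \<notin> prime_factors m" using m by auto
    have "real (p ^ k) ^ 2 \<le> real (cyc_psi (p ^ k)) * ((real p + 1) / real p)"
    proof -
      have "real p ^ (2 * k + 1) = real (p ^ k) ^ 2 * real p"
        by (simp add: power_mult power_even_eq mult.commute)
      moreover have "u / v * (v / w) = u / w" if "v > 0" for u v w :: real using that by simp
      ultimately have "real (cyc_psi (p ^ k)) * ((real p + 1) / real p) = (real (p ^ k) ^ 2 * real p + 1) / real p"
        by (simp only: cyc_psi_prime_power_real [OF p(1)])
      then show ?thesis using p1 by (simp add: add_divide_distrib)
    qed
    then have "real (p ^ k) ^ 2 * real m ^ 2 \<le> (real (cyc_psi (p ^ k)) * ((real p + 1) / real p))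
        * (real (cyc_psi m) * (\<Prod>p\<in>prime_factors m. (real p + 1) / real p))"
      using IH by (intro mult_mono) auto
    also have "\<dots> = real (cyc_psi n) * (\<Prod>p\<in>prime_factors n. (real p + 1) / real p)"
      unfolding pf using pm cyc_psi_mult [OF cop] p1 m0 m(1) by simp
    finally show ?thesis using m(1) by (simp add: power_mult_distrib)
  qed simp
qed

text \<open>The largest element b contributes ((b+1)/b)^2 <= (b+1)/(b-1), and the remaining odd
  numbers are at most b - 2, where the bound is (b-1)/(q-1). So the factors telescope; squaring is
  what makes this fit steps of 2.\<close>

lemma prod_odd_squared_le:
  assumes "finite A" and q: "q \<ge> 2"
    and "\<And>a. a \<in> A \<Longrightarrow> odd a \<and> q \<le> a \<and> a \<le> P" and "q \<le> P + 2"
  shows "(\<Prod>a\<in>A. (real a + 1) / real a) ^ 2 \<le> (real P + 1) / (real q - 1)"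
  using assms(1,3,4)
proof (induction A arbitrary: P rule: finite_linorder_max_induct)
  case empty
  \<comment> \<open>For the empty product the claim amounts to q <= P + 2.\<close>
  then show ?case using q by (simp add: field_simps)
next
  case (insert b A)
  have b: "odd b" "q \<le> b" "b \<le> P" using insert.prems(1) [of b] by auto
  have "(\<Prod>a\<in>A. (real a + 1) / real a) ^ 2 \<le> (real (b - 2) + 1) / (real q - 1)"
  proof (rule insert.IH)
    show "odd a \<and> q \<le> a \<and> a \<le> b - 2" if a: "a \<in> A" for a
    proof -
      have "odd a" "q \<le> a" "a < b" using insert.prems(1) [of a] insert.hyps a by auto
      moreover have "a \<noteq> b - 1" using \<open>odd a\<close> b q by auto
      ultimately show ?thesis by simp
    qed
  qed (use b in simp)
  also have "\<dots> = (real b - 1) / (real q - 1)" using b q by (simp add: of_nat_diff)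
  finally have IH: "(\<Prod>a\<in>A. (real a + 1) / real a) ^ 2 \<le> (real b - 1) / (real q - 1)" .
  have b0: "real b \<ge> 2" using b q by simp
  have "(\<Prod>a\<in>insert b A. (real a + 1) / real a) ^ 2
      = ((real b + 1) / real b) ^ 2 * (\<Prod>a\<in>A. (real a + 1) / real a) ^ 2"
  proof -
    have "(\<Prod>a\<in>insert b A. (real a + 1) / real a) = (real b + 1) / real b * (\<Prod>a\<in>A. (real a + 1) / real a)"
      using insert.hyps by (subst prod.insert) auto
    then show ?thesis by (simp only: power_mult_distrib)
  qed
  also have "\<dots> \<le> ((real b + 1) / real b) ^ 2 * ((real b - 1) / (real q - 1))"
    using IH by (intro mult_left_mono) auto
  also have "\<dots> = ((real b + 1) * ((real b + 1) * (real b - 1)) / (real b * real b)) / (real q - 1)"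
    by (simp add: power2_eq_square)
  also have "\<dots> \<le> (real b + 1) / (real q - 1)"
  proof (intro divide_right_mono)
    have "(real b + 1) * (real b - 1) \<le> real b * real b" by (simp add: algebra_simps)
    then have "(real b + 1) * ((real b + 1) * (real b - 1)) \<le> (real b + 1) * (real b * real b)"
      by (intro mult_left_mono) auto
    then show "(real b + 1) * ((real b + 1) * (real b - 1)) / (real b * real b) \<le> real b + 1"
      using b0 by (simp add: divide_le_eq mult.assoc)
  qed (use q in simp)
  also have "\<dots> \<le> (real P + 1) / (real q - 1)" using b q by (intro divide_right_mono) auto
  finally show ?case .
qed

section \<open>Rational inequalities for the index estimate\<close>

text \<open>A stand-in of lower degree that agrees with the bound up to 1/p + 1/p^2; the comparisons
  for \<alpha> = 1 and q > 3 go through it.\<close>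

lemma noncyc_bound_2_ge:
  assumes "p \<ge> 2"
  shows "real p / (real p ^ 2 - real p + 2) \<le> noncyc_bound p 2"
proof -
  define x where "x = real p"
  obtain z where z: "x = 2 + z" "z \<ge> 0"
    using assms by (metis add_diff_cancel_left' diff_ge_0_iff_ge le_add_diff_inverse of_nat_le_iff of_nat_numeral x_def)
  have "(x ^ 4 + x ^ 3 - x ^ 2 + 1) * (x ^ 2 - x + 2) - x * (x ^ 5 + 1) \<ge> 0"
    unfolding z using z(2) by (simp add: algebra_simps numeral_eq_Suc)
  moreover have "x ^ 2 - x + 2 > 0" unfolding z using z(2) by (simp add: algebra_simps power2_eq_square add_nonneg_pos)
  moreover have "x ^ 5 + 1 > 0" using z by (intro add_nonneg_pos) auto
  ultimately show ?thesis
    unfolding noncyc_bound_def x_def [symmetric] by (simp add: divide_le_eq le_divide_eq mult.commute)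
qed

lemma prime_inverse_bound_antimono:
  fixes x y :: real
  assumes "2 \<le> x" "x \<le> y"
  shows "y / (y ^ 2 - y + 2) \<le> x / (x ^ 2 - x + 2)"
proof -
  have pos: "t ^ 2 - t + 2 > 0" if "t \<ge> 2" for t :: real
  proof -
    have "t ^ 2 \<ge> 2 * t" using that by (simp add: power2_eq_square)
    then show ?thesis using that by linarith
  qed
  have "0 \<le> (y - x) * (x * y - 2)"
    using assms mult_mono [of 2 x 1 y] by (intro mult_nonneg_nonneg) auto
  then have "y * (x ^ 2 - x + 2) \<le> x * (y ^ 2 - y + 2)"
    by (simp add: algebra_simps power2_eq_square)
  then show ?thesis using pos assms by (simp add: divide_le_eq le_divide_eq mult.commute)
qed

text \<open>Below, \<open>R\<close> stands for the product of \<open>(r + 1)/r\<close> over primes \<open>r\<close> dividing the order, and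
  \<open>P\<close> for the largest of them.\<close>

lemma le_add_obtain:
  fixes x y :: real
  assumes "y \<ge> x"
  obtains z where "y = x + z" "z \<ge> 0"
  using assms by (metis add_diff_cancel_left' diff_ge_0_iff_ge le_add_diff_inverse)


text \<open>At P = q + 2 the polynomial \<open>P ^ 2 * (q - 1) - (P + 1) * q ^ 2\<close> is -4, so
  that gap is left to a direct computation with two factors.\<close>

lemma prime_product_estimate_square:
  fixes R q P :: real
  assumes q: "q \<ge> 3" and P: "P \<ge> q + 4" and R: "R ^ 2 \<le> (P + 1) / (q - 1)"
  shows "R \<le> P / q"
proof (rule power2_le_imp_le)
  obtain z where z: "q = 3 + z" "z \<ge> 0" using q by (rule le_add_obtain)
  obtain w where w: "P = q + 4 + w" "w \<ge> 0" using P by (rule le_add_obtain)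
  have "P ^ 2 * (q - 1) - (P + 1) * q ^ 2 \<ge> 0"
    unfolding w z using z(2) w(2) by (simp add: algebra_simps numeral_eq_Suc)
  then have "(P + 1) / (q - 1) \<le> P ^ 2 / q ^ 2"
    using q by (simp add: divide_le_eq le_divide_eq mult.commute)
  then show "R ^ 2 \<le> (P / q) ^ 2" using R by (simp add: power_divide)
qed (use assms in simp)

text \<open>The constants belong to q = 3 and p = 5: 4/3 is (q+1)/q, and 4 is p - 1.\<close>

lemma prime_product_estimate_3:
  fixes R P :: real
  assumes P: "P \<ge> 7" and R: "R ^ 2 \<le> (P + 1) / 4"
  shows "4 / 3 * R \<le> 85 / 301 * P"
proof (rule power2_le_imp_le)
  obtain w where w: "P = 7 + w" "w \<ge> 0" using P by (rule le_add_obtain)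
  have "(4 / 3) ^ 2 * ((P + 1) / 4) \<le> (85 / 301 * P) ^ 2"
    unfolding w using w(2) by (simp add: algebra_simps power2_eq_square)
  moreover have "(4 / 3) ^ 2 * R ^ 2 \<le> (4 / 3) ^ 2 * ((P + 1) / 4)" using R by (intro mult_left_mono) auto
  ultimately show "(4 / 3 * R) ^ 2 \<le> (85 / 301 * P) ^ 2"
    unfolding power_mult_distrib [of "4 / 3" R] by linarith
qed (use P in simp)

text \<open>Bertrand's postulate enters as p + 1 <= 2q: it replaces (q+1)/q by (p+3)/(p+1) and
  leaves an inequality in p and P alone.\<close>

lemma prime_product_estimate_far:
  fixes R q p P :: real
  assumes p: "p \<ge> 7" and q: "q > 0" "p + 1 \<le> 2 * q" and P: "P \<ge> p + 6" and R: "R ^ 2 \<le> (P + 1) / (p - 1)" "R \<ge> 0"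
  shows "(q + 1) / q * R \<le> p / (p ^ 2 - p + 2) * P"
proof -
  obtain z where z: "p = 7 + z" "z \<ge> 0" using p by (rule le_add_obtain)
  obtain w where w: "P = p + 6 + w" "w \<ge> 0" using P by (rule le_add_obtain)
  have d: "p ^ 2 - p + 2 > 0" unfolding z using z(2) by (simp add: algebra_simps power2_eq_square add_nonneg_pos)
  have "p ^ 2 * P ^ 2 * ((p + 1) ^ 2 * (p - 1)) - (p + 3) ^ 2 * (P + 1) * (p ^ 2 - p + 2) ^ 2 \<ge> 0"
    unfolding w z using z(2) w(2) by (simp add: algebra_simps numeral_eq_Suc)
  then have "((p + 3) ^ 2 * (P + 1)) / ((p + 1) ^ 2 * (p - 1)) \<le> (p ^ 2 * P ^ 2) / (p ^ 2 - p + 2) ^ 2"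
    using d p by (simp add: divide_le_eq le_divide_eq mult.commute mult.left_commute)
  then have "((p + 3) / (p + 1)) ^ 2 * ((P + 1) / (p - 1)) \<le> (p / (p ^ 2 - p + 2) * P) ^ 2"
    by (simp add: power_mult_distrib power_divide)
  moreover have "((p + 3) / (p + 1)) ^ 2 * R ^ 2 \<le> ((p + 3) / (p + 1)) ^ 2 * ((P + 1) / (p - 1))"
    using R by (intro mult_left_mono) auto
  ultimately have "((p + 3) / (p + 1) * R) ^ 2 \<le> (p / (p ^ 2 - p + 2) * P) ^ 2"
    unfolding power_mult_distrib [of "(p + 3) / (p + 1)" R] by linarith
  then have "(p + 3) / (p + 1) * R \<le> p / (p ^ 2 - p + 2) * P"
    by (rule power2_le_imp_le) (use d p P in simp)
  moreover have "(q + 1) / q \<le> (p + 3) / (p + 1)" using q p by (simp add: field_simps)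
  then have "(q + 1) / q * R \<le> (p + 3) / (p + 1) * R" using R by (intro mult_right_mono)
  ultimately show ?thesis by linarith
qed

text \<open>Meant for P = p + 4, where p + 2 is not prime and only the factors of p and p + 4 can
  occur in the product.\<close>

lemma prime_product_estimate_gap_4:
  fixes q p :: real
  assumes p: "p \<ge> 7" and q: "q > 0" "p + 1 \<le> 2 * q"
  shows "(q + 1) / q * ((p + 1) / p * ((p + 5) / (p + 4))) \<le> p / (p ^ 2 - p + 2) * (p + 4)"
proof -
  obtain z where z: "p = 7 + z" "z \<ge> 0" using p by (rule le_add_obtain)
  have d: "p ^ 2 - p + 2 > 0" unfolding z using z(2) by (simp add: algebra_simps power2_eq_square add_nonneg_pos)
  have "(q + 1) / q \<le> (p + 3) / (p + 1)" using q p by (simp add: field_simps)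
  then have "(q + 1) / q * ((p + 1) / p * ((p + 5) / (p + 4))) \<le> (p + 3) / (p + 1) * ((p + 1) / p * ((p + 5) / (p + 4)))"
    using p by (intro mult_right_mono) auto
  also have "\<dots> = ((p + 3) * (p + 5)) / (p * (p + 4))" using p by simp
  also have "\<dots> \<le> (p * (p + 4)) / (p ^ 2 - p + 2)"
  proof -
    have "(p * (p + 4)) * (p * (p + 4)) - ((p + 3) * (p + 5)) * (p ^ 2 - p + 2) \<ge> 0"
      unfolding z using z(2) by (simp add: algebra_simps numeral_eq_Suc)
    then show ?thesis using d p by (simp add: divide_le_eq le_divide_eq mult.commute mult.left_commute)
  qed
  finally show ?thesis by simp
qed

text \<open>Meant for P = p + 2. The first factor on the left replaces (q+1)/q and comes from
  splitting the elements by whether q divides their order; q^2 - q + 1 on the right is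
  psi(C_q).\<close>

lemma prime_product_estimate_gap_2:
  fixes q p :: real
  assumes p: "p \<ge> 7" and q: "q \<ge> 5"
  shows "((q ^ 2 - q) / (p + 2) + 1 / p) * ((p + 1) / p * ((p + 3) / (p + 2))) \<le> p / (p ^ 2 - p + 2) * (q ^ 2 - q + 1)"
proof -
  obtain z where z: "p = 7 + z" "z \<ge> 0" using p by (rule le_add_obtain)
  obtain y where y: "q = 5 + y" "y \<ge> 0" using q by (rule le_add_obtain)
  have d: "p ^ 2 - p + 2 > 0" unfolding z using z(2) by (simp add: algebra_simps power2_eq_square add_nonneg_pos)
  have "((q ^ 2 - q) / (p + 2) + 1 / p) * ((p + 1) / p * ((p + 3) / (p + 2)))
      = (((q ^ 2 - q) * p + (p + 2)) * ((p + 1) * (p + 3))) / ((p * (p + 2)) * (p * (p + 2)))"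
  proof -
    have "(q ^ 2 - q) / (p + 2) + 1 / p = ((q ^ 2 - q) * p + (p + 2)) / (p * (p + 2))"
      using p by (simp add: add_frac_eq mult.commute)
    then show ?thesis by simp
  qed
  also have "\<dots> \<le> (p * (q ^ 2 - q + 1)) / (p ^ 2 - p + 2)"
  proof -
    have "(p * (q ^ 2 - q + 1)) * ((p * (p + 2)) * (p * (p + 2)))
        - (((q ^ 2 - q) * p + (p + 2)) * ((p + 1) * (p + 3))) * (p ^ 2 - p + 2) \<ge> 0"
      unfolding z y using z(2) y(2) by (simp add: algebra_simps numeral_eq_Suc)
    then show ?thesis using d p by (simp add: divide_le_eq le_divide_eq mult.commute mult.left_commute)
  qed
  finally show ?thesis by simp
qed

section \<open>Cyclic quotient: comparison with a Frobenius group of order P q\<close>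

lemma quadratic_pos: "x ^ 2 - x + 1 > 0" for x :: real
proof -
  have "0 \<le> (x - 1 / 2) ^ 2" by simp
  then show ?thesis by (simp add: power2_eq_square algebra_simps)
qed

lemma inverse_quadratic_le_1:
  "1 / (real q ^ 2 - real q + 1) \<le> 1"
proof -
  have "q \<le> q * q" by simp
  then have "real q \<le> real q * real q" by (simp only: of_nat_le_iff flip: of_nat_mult)
  then show ?thesis using quadratic_pos [of "real q"] by (simp add: divide_le_eq_1 power2_eq_square)
qed

text \<open>As psi(C_P) = P^2 - P + 1, this is an equality for k = 1: the ratio P^k / psi(C_(P^k))
  is largest for the prime itself.\<close>

lemma cyc_psi_prime_power_ge:
  assumes P: "nprime P" and k: "k > 0"
  shows "real (P ^ k) \<le> real P / (real P ^ 2 - real P + 1) * real (cyc_psi (P ^ k))"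
proof -
  define x y where "x = real P" and "y = x ^ (k - 1)"
  have x: "x \<ge> 2" using prime_ge_2_nat [OF P] by (simp add: x_def)
  have y: "y \<ge> 1" using x by (simp add: y_def one_le_power)
  have Pk: "real (P ^ k) = y * x" using k by (cases k) (auto simp: y_def x_def)
  have "2 * k + 1 = (k - 1) + (k - 1) + 3" using k by simp
  then have e: "x ^ (2 * k + 1) = y * y * x ^ 3" by (simp only: power_add y_def)
  have d: "x ^ 2 - x + 1 > 0" by (rule quadratic_pos)
  have "x ^ 3 \<ge> 1" using x by (simp add: one_le_power)
  then have "1 * 1 \<le> y * x ^ 3" using y by (intro mult_mono) auto
  then have "0 \<le> (y - 1) * (y * x ^ 3 - 1)" using y by (intro mult_nonneg_nonneg) auto
  then have "x * (y * (x ^ 3 + 1)) \<le> x * (y * y * x ^ 3 + 1)"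
    using x by (intro mult_left_mono) (auto simp: algebra_simps)
  moreover have "x ^ 3 + 1 = (x + 1) * (x ^ 2 - x + 1)" by (simp add: algebra_simps numeral_eq_Suc)
  ultimately have "y * x * ((x ^ 2 - x + 1) * (x + 1)) \<le> x * (y * y * x ^ 3 + 1)" by (simp add: mult_ac)
  then show ?thesis
    unfolding Pk cyc_psi_prime_power_real [OF P] x_def [symmetric] e using d x
    by (simp add: le_divide_eq)
qed

text \<open>The reason is psi(C_(r^(a+1))) >= psi(C_r) psi(C_(r^a)), where multiplication by r + 1
  turns the difference into (r^(2a) - 1) r (r - 1). Moreover psi(C_r) = r^2 - r + 1 grows with
  r.\<close>

lemma cyc_psi_div_prime_le:
  assumes r: "nprime r" "r dvd n" and n: "n > 0" and q: "2 \<le> q" "q \<le> r"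
  shows "real (cyc_psi (n div r)) \<le> 1 / (real q ^ 2 - real q + 1) * real (cyc_psi n)"
proof -
  define a where "a = multiplicity r n - 1"
  obtain w where w: "n = r ^ multiplicity r n * w" "\<not> r dvd w"
    using multiplicity_decompose' [of n r] n r by (metis not_prime_unit gr_implies_not0)
  have "multiplicity r n > 0" using r n by (simp add: prime_multiplicity_gt_zero_iff)
  then have nw: "n = r ^ Suc a * w" using w by (simp add: a_def)
  have r0: "r > 0" using r prime_gt_0_nat by blast
  have w0: "w > 0" using nw n by (metis gr0I mult_0_right)
  have cop: "coprime (r ^ i) w" for i using w(2) r by (simp add: prime_imp_coprime)
  define x where "x = real r"
  have x: "x \<ge> 2" using prime_ge_2_nat [OF r(1)] by (simp add: x_def)
  have div: "n div r = r ^ a * w" using nw r0 by simp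
  have "(x ^ 2 - x + 1) * real (cyc_psi (r ^ a)) \<le> real (cyc_psi (r ^ Suc a))"
  proof -
    have "1 \<le> x ^ (2 * a)" using x by (simp add: one_le_power)
    then have "0 \<le> (x ^ (2 * a) - 1) * (x * (x - 1))" using x by simp
    moreover have "x ^ (2 * Suc a + 1) = x ^ (2 * a) * x ^ 3" by (simp add: power_add numeral_eq_Suc)
    moreover have "x ^ (2 * a + 1) = x ^ (2 * a) * x" by simp
    ultimately have "(x ^ 2 - x + 1) * (x ^ (2 * a + 1) + 1) \<le> x ^ (2 * Suc a + 1) + 1"
      by (simp add: algebra_simps numeral_eq_Suc)
    then have "(x ^ 2 - x + 1) * (x ^ (2 * a + 1) + 1) / (x + 1) \<le> (x ^ (2 * Suc a + 1) + 1) / (x + 1)"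
      using x by (intro divide_right_mono) auto
    then show ?thesis unfolding cyc_psi_prime_power_real [OF r(1)] x_def [symmetric] by simp
  qed
  then have "(x ^ 2 - x + 1) * real (cyc_psi (r ^ a)) * real (cyc_psi w) \<le> real (cyc_psi (r ^ Suc a)) * real (cyc_psi w)"
    by (intro mult_right_mono) auto
  moreover have "cyc_psi (r ^ i * w) = cyc_psi (r ^ i) * cyc_psi w" for i
    by (rule cyc_psi_mult [OF cop]) (use r0 w0 in auto)
  then have "cyc_psi (n div r) = cyc_psi (r ^ a) * cyc_psi w" "cyc_psi n = cyc_psi (r ^ Suc a) * cyc_psi w"
    using div nw by metis+
  ultimately have "(x ^ 2 - x + 1) * real (cyc_psi (n div r)) \<le> real (cyc_psi n)"
    by (simp only: of_nat_mult mult.assoc)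
  moreover have "(real q ^ 2 - real q + 1) * real (cyc_psi (n div r)) \<le> (x ^ 2 - x + 1) * real (cyc_psi (n div r))"
  proof (intro mult_right_mono)
    have "0 \<le> (x - real q) * (x + real q - 1)" using q x by (intro mult_nonneg_nonneg) (auto simp: x_def)
    then show "real q ^ 2 - real q + 1 \<le> x ^ 2 - x + 1" by (simp add: algebra_simps power2_eq_square)
  qed simp
  ultimately have "(real q ^ 2 - real q + 1) * real (cyc_psi (n div r)) \<le> real (cyc_psi n)" by linarith
  then show ?thesis using quadratic_pos [of "real q"] by (simp add: le_divide_eq mult.commute)
qed

text \<open>The value \<open>\<psi>(C\<^sub>P \<rtimes> C\<^sub>q) / \<psi>(C\<^sub>P\<^sub>q)\<close> for a faithful action.\<close>

definition frobenius_bound :: "nat \<Rightarrow> nat \<Rightarrow> real" where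
  "frobenius_bound q P = 1 - (1 - real P / (real P ^ 2 - real P + 1)) * (1 - 1 / (real q ^ 2 - real q + 1))"

text \<open>In the notation of the proof the coset count reads psi(G) <= a c + (b - a) d. This grows
  with d, and after d <= v c is inserted it grows with a, so a <= u b yields the factor u + v - u v
  = 1 - (1 - u)(1 - v).\<close>

lemma (in normal_cyclic_sylow) psi_le_frobenius_bound:
  assumes cyc: "cyclic_group (G Mod S)" and ncyc: "\<not> cyclic_group G" and k: "k > 0" and q: "q \<ge> 2"
    and min: "\<And>r. nprime r \<Longrightarrow> r dvd N \<Longrightarrow> q \<le> r"
  obtains r where "nprime r" "r dvd N" "r dvd P - 1"
    "real (psi G) \<le> frobenius_bound q P * real (cyc_psi (order G))"
proof -
  obtain Z where Z: "Z \<in> carrier (G Mod S)" "Q.ord Z = N"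
    using Q.cyclic_group_imp_ord [OF fin_quotient cyc] order_quotient by metis
  obtain r r' where r: "nprime r" "r dvd N" and r': "nprime r'" "r' dvd N" "r' dvd P - 1"
    and le: "psi G + P ^ k * cyc_psi (N div r) \<le> P ^ k * cyc_psi N + cyc_psi (P ^ k) * cyc_psi (N div r)"
    using psi_le_cyclic_quotient [OF Z ncyc] by blast
  define u v where "u = real P / (real P ^ 2 - real P + 1)" and "v = 1 / (real q ^ 2 - real q + 1)"
  define a b c d where "a = real (P ^ k)" and "b = real (cyc_psi (P ^ k))"
    and "c = real (cyc_psi N)" and "d = real (cyc_psi (N div r))"
  have au: "a \<le> u * b" unfolding a_def b_def u_def by (rule cyc_psi_prime_power_ge [OF P k])
  have dv: "d \<le> v * c" unfolding c_def d_def v_def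
    by (rule cyc_psi_div_prime_le [OF r N_pos q min [OF r]])
  have sq: "x ^ 2 \<ge> 2 * x" if "x \<ge> 2" for x :: real using that by (simp add: power2_eq_square)
  have u1: "u \<le> 1" using sq [of "real P"] P_gt_1 quadratic_pos [of "real P"] unfolding u_def by (subst divide_le_eq_1_pos) auto
  have v1: "v \<le> 1" unfolding v_def by (rule inverse_quadratic_le_1)
  have pos: "b \<ge> 0" "c \<ge> 0" by (auto simp: b_def c_def)
  have "u * b \<le> 1 * b" using u1 pos by (intro mult_right_mono)
  then have ab: "a \<le> b" using au by linarith
  have "real (psi G + P ^ k * cyc_psi (N div r)) \<le> real (P ^ k * cyc_psi N + cyc_psi (P ^ k) * cyc_psi (N div r))"
    using le by (simp only: of_nat_le_iff)
  then have "real (psi G) \<le> a * c + (b - a) * d" unfolding a_def b_def c_def d_def of_nat_add of_nat_mult by (simp add: algebra_simps)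
  also have "\<dots> \<le> a * c + (b - a) * (v * c)" using dv ab by (intro add_left_mono mult_left_mono) auto
  also have "\<dots> = (a * (1 - v) + v * b) * c" by (simp add: algebra_simps)
  also have "\<dots> \<le> ((u * b) * (1 - v) + v * b) * c"
    using au v1 pos by (intro mult_right_mono add_right_mono) auto
  also have "\<dots> = frobenius_bound q P * (b * c)"
    unfolding frobenius_bound_def u_def [symmetric] v_def [symmetric] by (simp add: algebra_simps)
  also have "b * c = real (cyc_psi (order G))"
    unfolding b_def c_def order_G using cyc_psi_mult [of "P ^ k" N] cop N_pos P_gt_1 by simp
  finally show ?thesis using that [OF r'] by blast
qed

lemma frobenius_bound_antimono:
  assumes "2 \<le> q" "2 \<le> P" "P \<le> P'"
  shows "frobenius_bound q P' \<le> frobenius_bound q P"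
proof -
  define x y where "x = real P" and "y = real P'"
  have xy: "2 \<le> x" "x \<le> y" using assms by (auto simp: x_def y_def)
  have "0 \<le> (y - x) * (x * y - 1)"
    using xy mult_mono [of 1 x 1 y] by (intro mult_nonneg_nonneg) auto
  then have "y * (x ^ 2 - x + 1) \<le> x * (y ^ 2 - y + 1)"
    by (simp add: algebra_simps power2_eq_square)
  moreover have "x ^ 2 - x + 1 > 0" "y ^ 2 - y + 1 > 0" by (rule quadratic_pos)+
  ultimately have "y / (y ^ 2 - y + 1) \<le> x / (x ^ 2 - x + 1)"
    by (simp add: divide_le_eq le_divide_eq mult.commute)
  moreover have "1 / (real q ^ 2 - real q + 1) \<le> 1" by (rule inverse_quadratic_le_1)
  ultimately show ?thesis
    unfolding frobenius_bound_def x_def [symmetric] y_def [symmetric]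
    by (intro diff_left_mono mult_right_mono) auto
qed

lemma frobenius_bound_frac:
  assumes "2 \<le> q" "2 \<le> P"
  shows "frobenius_bound q P = (real P * (real q ^ 2 - real q) + (real P ^ 2 - real P + 1)) /
    ((real P ^ 2 - real P + 1) * (real q ^ 2 - real q + 1))"
proof -
  define a b where "a = real P ^ 2 - real P + 1" and "b = real q ^ 2 - real q + 1"
  have "a > 0" "b > 0" unfolding a_def b_def by (rule quadratic_pos)+
  then show ?thesis
    unfolding frobenius_bound_def a_def [symmetric] b_def [symmetric]
    by (simp add: field_simps) (simp add: b_def algebra_simps)
qed

lemma frobenius_bound_le_inverse:
  assumes "3 \<le> q" "2 * q + 1 \<le> P"
  shows "frobenius_bound q P \<le> 1 / real q"
proof -
  define x where "x = real q"
  obtain z where z: "x = 3 + z" "z \<ge> 0" using assms unfolding x_def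
    by (metis add_diff_cancel_left' diff_ge_0_iff_ge le_add_diff_inverse of_nat_le_iff of_nat_numeral)
  have "frobenius_bound q P \<le> frobenius_bound q (2 * q + 1)"
    using assms by (intro frobenius_bound_antimono) auto
  also have "\<dots> = ((2 * x + 1) * (x ^ 2 - x) + ((2 * x + 1) ^ 2 - (2 * x + 1) + 1)) /
      (((2 * x + 1) ^ 2 - (2 * x + 1) + 1) * (x ^ 2 - x + 1))"
    using assms by (subst frobenius_bound_frac) (auto simp: x_def algebra_simps)
  also have "\<dots> \<le> 1 / x"
  proof -
    have "(((2 * x + 1) ^ 2 - (2 * x + 1) + 1) * (x ^ 2 - x + 1))
        - ((2 * x + 1) * (x ^ 2 - x) + ((2 * x + 1) ^ 2 - (2 * x + 1) + 1)) * x \<ge> 0"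
      unfolding z using z(2) by (simp add: algebra_simps numeral_eq_Suc)
    moreover have "((2 * x + 1) ^ 2 - (2 * x + 1) + 1) * (x ^ 2 - x + 1) > 0"
        by (intro mult_pos_pos quadratic_pos)
    ultimately show ?thesis using z by (simp add: divide_le_eq le_divide_eq mult.commute)
  qed
  finally show ?thesis by (simp add: x_def)
qed

text \<open>85/301 is the value at P = 7, that of the Frobenius group of order 21.\<close>

lemma frobenius_bound_3_le:
  assumes "7 \<le> P"
  shows "frobenius_bound 3 P \<le> 85 / 301"
proof -
  have "frobenius_bound 3 P \<le> frobenius_bound 3 7" using assms by (intro frobenius_bound_antimono) auto
  also have "\<dots> = 85 / 301" by (simp add: frobenius_bound_def power2_eq_square)
  finally show ?thesis .
qed

text \<open>To second order in 1/q, P = 2q + 1 gives 1/(2q) + 1/q^2 on the left, while p = 2q - 1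
  would give only 1/(2q) + 1/(2q^2) on the right. So this pair must be ruled out beforehand, and the
  two alternatives are what divisibility and parity can guarantee.\<close>

lemma frobenius_bound_le_noncyc_bound:
  assumes q: "5 \<le> q" and p: "2 \<le> p"
    and "P = 2 * q + 1 \<and> p + 3 \<le> 2 * q \<or> 2 * q + 5 \<le> P \<and> p + 1 \<le> 2 * q"
  shows "frobenius_bound q P \<le> noncyc_bound p 2"
proof -
  define x where "x = real q"
  obtain z where z: "x = 5 + z" "z \<ge> 0" using q unfolding x_def
    by (metis add_diff_cancel_left' diff_ge_0_iff_ge le_add_diff_inverse of_nat_le_iff of_nat_numeral)
  have P2: "P \<ge> 2" using assms by auto
  \<comment> \<open>Here c, with real value d, is the least admissible P, and y the largest
    admissible p, both expressed by x = q; monotonicity reduces the claim to these extreme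
    values.\<close>
  have main: "frobenius_bound q P \<le> y / (y ^ 2 - y + 2)"
    if P: "c \<le> P" "2 \<le> c" and c: "real c = d" and y: "y ^ 2 - y + 2 > 0"
      and pos: "(d ^ 2 - d + 1) * (x ^ 2 - x + 1) > 0"
      and le: "(d * (x ^ 2 - x) + (d ^ 2 - d + 1)) * (y ^ 2 - y + 2) \<le> y * ((d ^ 2 - d + 1) * (x ^ 2 - x + 1))"
    for y d c
  proof -
    have "frobenius_bound q P \<le> frobenius_bound q c"
      using P q by (intro frobenius_bound_antimono) auto
    also have "\<dots> = (d * (x ^ 2 - x) + (d ^ 2 - d + 1)) / ((d ^ 2 - d + 1) * (x ^ 2 - x + 1))"
      using P q c by (subst frobenius_bound_frac) (auto simp: x_def)
    also have "\<dots> \<le> y / (y ^ 2 - y + 2)"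
      using le y pos by (simp add: divide_le_eq le_divide_eq mult.commute mult.left_commute)
    finally show ?thesis .
  qed
  have fin: "frobenius_bound q P \<le> noncyc_bound p 2"
    if "frobenius_bound q P \<le> y / (y ^ 2 - y + 2)" "real p \<le> y" for y
    using that prime_inverse_bound_antimono [of "real p" y] noncyc_bound_2_ge [OF p] p by simp
  from assms(3) show ?thesis
  proof
    assume h: "P = 2 * q + 1 \<and> p + 3 \<le> 2 * q"
    have "frobenius_bound q P \<le> (2 * x - 3) / ((2 * x - 3) ^ 2 - (2 * x - 3) + 2)"
    proof (rule main)
      show "2 * q + 1 \<le> P" "2 \<le> 2 * q + 1" "real (2 * q + 1) = 2 * x + 1" using h q by (auto simp: x_def)
      show "(2 * x - 3) ^ 2 - (2 * x - 3) + 2 > 0"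
        using quadratic_pos [of "2 * x - 3"] by linarith
      show "((2 * x + 1) ^ 2 - (2 * x + 1) + 1) * (x ^ 2 - x + 1) > 0"
        by (intro mult_pos_pos quadratic_pos)
      have "(2 * x - 3) * (((2 * x + 1) ^ 2 - (2 * x + 1) + 1) * (x ^ 2 - x + 1))
          - ((2 * x + 1) * (x ^ 2 - x) + ((2 * x + 1) ^ 2 - (2 * x + 1) + 1)) * ((2 * x - 3) ^ 2 - (2 * x - 3) + 2) \<ge> 0"
        unfolding z using z(2) by (simp add: algebra_simps numeral_eq_Suc)
      then show "((2 * x + 1) * (x ^ 2 - x) + ((2 * x + 1) ^ 2 - (2 * x + 1) + 1)) * ((2 * x - 3) ^ 2 - (2 * x - 3) + 2)
          \<le> (2 * x - 3) * (((2 * x + 1) ^ 2 - (2 * x + 1) + 1) * (x ^ 2 - x + 1))" by simp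
    qed
    then show ?thesis by (rule fin) (use h in \<open>simp add: x_def\<close>)
  next
    assume h: "2 * q + 5 \<le> P \<and> p + 1 \<le> 2 * q"
    have "frobenius_bound q P \<le> (2 * x - 1) / ((2 * x - 1) ^ 2 - (2 * x - 1) + 2)"
    proof (rule main)
      show "2 * q + 5 \<le> P" "2 \<le> 2 * q + 5" "real (2 * q + 5) = 2 * x + 5" using h q by (auto simp: x_def)
      show "(2 * x - 1) ^ 2 - (2 * x - 1) + 2 > 0"
        using quadratic_pos [of "2 * x - 1"] by linarith
      show "((2 * x + 5) ^ 2 - (2 * x + 5) + 1) * (x ^ 2 - x + 1) > 0"
        by (intro mult_pos_pos quadratic_pos)
      have "(2 * x - 1) * (((2 * x + 5) ^ 2 - (2 * x + 5) + 1) * (x ^ 2 - x + 1))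
          - ((2 * x + 5) * (x ^ 2 - x) + ((2 * x + 5) ^ 2 - (2 * x + 5) + 1)) * ((2 * x - 1) ^ 2 - (2 * x - 1) + 2) \<ge> 0"
        unfolding z using z(2) by (simp add: algebra_simps numeral_eq_Suc)
      then show "((2 * x + 5) * (x ^ 2 - x) + ((2 * x + 5) ^ 2 - (2 * x + 5) + 1)) * ((2 * x - 1) ^ 2 - (2 * x - 1) + 2)
          \<le> (2 * x - 1) * (((2 * x + 5) ^ 2 - (2 * x + 5) + 1) * (x ^ 2 - x + 1))" by simp
    qed
    then show ?thesis by (rule fin) (use h in \<open>simp add: x_def\<close>)
  qed
qed

section \<open>From the average order to an element of large order\<close>

context group begin

text \<open>If P ord(x) <= n for all x, then P psi(G) <= n^2, and n^2 is at most psi(C_n) times the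
  product over the primes dividing n.\<close>

lemma psi_le_or_large_ord:
  fixes B R :: real
  assumes fin: "finite (carrier G)" and P: "P > 0"
    and R: "(\<Prod>r\<in>prime_factors (order G). (real r + 1) / real r) \<le> B * real P"
  shows "real (psi G) \<le> B * real (cyc_psi (order G)) \<or> (\<exists>x\<in>carrier G. order G < P * ord x)"
proof (rule disjCI)
  assume no: "\<not> (\<exists>x\<in>carrier G. order G < P * ord x)"
  let ?n = "order G"
  have n0: "?n > 0" using fin order_gt_0_iff_finite by blast
  have "P * psi G \<le> ?n * ?n"
    unfolding psi_def sum_distrib_left
    using no sum_bounded_above [of "carrier G" "\<lambda>x. P * ord x" ?n] by (force simp: order_def)
  then have "real (P * psi G) \<le> real (?n * ?n)" by (simp only: of_nat_le_iff)
  then have "real P * real (psi G) \<le> real ?n ^ 2" by (simp add: power2_eq_square)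
  also have "\<dots> \<le> real (cyc_psi ?n) * (\<Prod>r\<in>prime_factors ?n. (real r + 1) / real r)"
    by (rule cyc_psi_lower [OF n0])
  also have "\<dots> \<le> real (cyc_psi ?n) * (B * real P)" using R by (intro mult_left_mono) auto
  finally have "real P * real (psi G) \<le> real P * (B * real (cyc_psi ?n))" by (simp add: mult_ac)
  then show "real (psi G) \<le> B * real (cyc_psi ?n)" using P by simp
qed

text \<open>A refined average: by the special case of Frobenius' theorem at most n (1 - 1/q)
  elements have order divisible by q. Their orders are at most n/P, while all other orders are at
  most n/(q p), which is no larger.\<close>

lemma psi_le_or_large_ord_prime_factor:
  fixes B :: real
  assumes fin: "finite (carrier G)" and q: "nprime q" and o: "order G = q * m" and cop: "coprime q m"
    and p: "p > 0" "\<And>r. nprime r \<Longrightarrow> r dvd m \<Longrightarrow> p \<le> r" and P: "q < P" "P \<le> q * p"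
    and R: "((real q ^ 2 - real q) / real P + 1 / real p) * (\<Prod>r\<in>prime_factors m. (real r + 1) / real r)
      \<le> B * (real q ^ 2 - real q + 1)"
  shows "real (psi G) \<le> B * real (cyc_psi (order G)) \<or> (\<exists>x\<in>carrier G. order G < P * ord x)"
proof (rule disjCI)
  assume no: "\<not> (\<exists>x\<in>carrier G. order G < P * ord x)"
  let ?n = "order G"
  define n t where "n = real ?n" and "t = real (card {x \<in> carrier G. q dvd ord x})"
  have q0: "q > 0" using q prime_gt_0_nat by blast
  have P0: "P > 0" using P by simp
  have n0: "?n > 0" using fin order_gt_0_iff_finite by blast
  have m0: "m > 0" using n0 o by (metis gr0I mult_0_right)
  define A where "A = {x \<in> carrier G. q dvd ord x}"
  have A: "ord x \<le> n / real P" if "x \<in> A" for x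
  proof -
    have "P * ord x \<le> ?n" using no that by (auto simp: A_def not_less)
    then have "real P * real (ord x) \<le> n" unfolding n_def by (simp only: of_nat_le_iff flip: of_nat_mult)
    then show ?thesis using P0 by (simp add: le_divide_eq mult.commute)
  qed
  have notA: "ord x \<le> n / (real q * real p)" if "x \<in> carrier G - A" for x
  proof -
    have x: "x \<in> carrier G" "\<not> q dvd ord x" using that by (auto simp: A_def)
    then have "coprime (ord x) q" using q by (simp add: coprime_commute prime_imp_coprime)
    then have "ord x dvd m" using ord_dvd_group_order [OF x(1)] o by (simp add: coprime_dvd_mult_right_iff)
    then obtain i where i: "m = ord x * i" by auto
    have "P * ord x \<le> ?n" using no x by (auto simp: not_less)
    \<comment> \<open>An element of order m would generate a subgroup of index q < P, which is
      excluded. So the order is a proper divisor of m and at most m / p.\<close>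
    have "i \<noteq> 1"
    proof
      assume "i = 1"
      then have "P * ord x \<le> q * ord x" using \<open>P * ord x \<le> ?n\<close> o i by simp
      then show False using P(1) ord_ge_1 [OF fin x(1)] by simp
    qed
    then obtain r where r: "nprime r" "r dvd i" using prime_factor_nat by blast
    then have "p \<le> r" using p(2) i by simp
    moreover have "r \<le> i" using r i m0 by (intro dvd_imp_le) (auto intro!: gr0I)
    ultimately have "p * ord x \<le> m" using i by simp
    then have "q * p * ord x \<le> ?n" using o by simp
    then have "real (q * p) * real (ord x) \<le> n" unfolding n_def by (simp only: of_nat_le_iff flip: of_nat_mult)
    then show ?thesis using q0 p(1) by (simp add: le_divide_eq mult_ac)
  qed
  have AG: "A \<subseteq> carrier G" by (auto simp: A_def)
  have finA: "finite A" using fin AG finite_subset by blast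
  have "real q * t \<le> (real q - 1) * n"
  proof -
    have "real (q * card {x \<in> carrier G. q dvd ord x}) \<le> real ((q - 1) * ?n)"
      using card_dvd_ord_le [OF fin q o cop] by (simp only: of_nat_le_iff)
    then show ?thesis using q0 by (simp add: n_def t_def of_nat_diff)
  qed
  then have t: "t \<le> n * (1 - 1 / real q)" using q0 by (simp add: field_simps)
  have "real (psi G) = (\<Sum>x\<in>carrier G - A. real (ord x)) + (\<Sum>x\<in>A. real (ord x))"
    unfolding psi_def of_nat_sum by (rule sum.subset_diff [OF AG fin])
  also have "\<dots> \<le> (\<Sum>x\<in>carrier G - A. n / (real q * real p)) + (\<Sum>x\<in>A. n / real P)"
    using A notA by (intro add_mono sum_mono) auto
  also have "\<dots> = (n - t) * (n / (real q * real p)) + t * (n / real P)"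
    using card_Diff_subset [OF finA AG] card_mono [OF fin AG]
    by (simp add: n_def t_def A_def order_def of_nat_diff)
  also have "\<dots> = n * (n / (real q * real p)) + t * (n / real P - n / (real q * real p))"
  proof -
    have "(n - t) * a + t * b = n * a + t * (b - a)" for a b by (simp add: algebra_simps)
    then show ?thesis .
  qed
  also have "\<dots> \<le> n * (n / (real q * real p)) + n * (1 - 1 / real q) * (n / real P - n / (real q * real p))"
  proof (intro add_left_mono mult_right_mono t)
    \<comment> \<open>Since n/P is the larger of the two order bounds, overestimating the number t
      of elements that receive it is safe.\<close>
    have "real P \<le> real q * real p" using P(2) by (metis of_nat_le_iff of_nat_mult)
    then have "n / (real q * real p) \<le> n / real P" using P0 by (intro divide_left_mono) (auto simp: n_def)
    then show "0 \<le> n / real P - n / (real q * real p)" by simp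
  qed
  also have "\<dots> = real m ^ 2 * ((real q ^ 2 - real q) / real P + 1 / real p)"
    using q0 p(1) P0 unfolding n_def o by (simp add: field_simps power2_eq_square)
  also have "\<dots> \<le> (real (cyc_psi m) * (\<Prod>r\<in>prime_factors m. (real r + 1) / real r))
      * ((real q ^ 2 - real q) / real P + 1 / real p)"
  proof (intro mult_right_mono cyc_psi_lower [OF m0])
    have "real q ^ 2 \<ge> real q" using q0 by (simp add: power2_eq_square)
    then show "0 \<le> (real q ^ 2 - real q) / real P + 1 / real p" by simp
  qed
  also have "\<dots> = real (cyc_psi m) * (((real q ^ 2 - real q) / real P + 1 / real p) * (\<Prod>r\<in>prime_factors m. (real r + 1) / real r))"
    by (simp only: mult_ac)
  also have "\<dots> \<le> real (cyc_psi m) * (B * (real q ^ 2 - real q + 1))" using R by (intro mult_left_mono) auto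
  also have "\<dots> = B * real (cyc_psi ?n)"
    using cyc_psi_mult [OF cop q0 m0] cyc_psi_prime [OF q] o by (simp add: power2_eq_square)
  finally show "real (psi G) \<le> B * real (cyc_psi ?n)" .
qed

end

section \<open>The common bound and the arithmetic of n\<close>

text \<open>A single expression for the five bounds, so that the induction need not distinguish the
  cases.\<close>

definition main_bound :: "nat \<Rightarrow> nat \<Rightarrow> nat \<Rightarrow> real" where
  "main_bound q p a = (if a = 1 then if q = 3 then 85 / 301 else noncyc_bound p 2 else noncyc_bound q a)"

lemma next_prime_3: "next_prime 3 p \<Longrightarrow> p = 5"
proof -
  assume np: "next_prime 3 p"
  have "nprime 5" by simp
  then have "p \<le> 5" using np by (auto simp: next_prime_def)
  moreover have "3 < p" "nprime p" using np by (auto simp: next_prime_def)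
  moreover have "\<not> nprime 4" by simp
  ultimately have *: "p \<le> 5" "3 < p" "nprime p" "\<not> nprime 4" by blast+
  then have "p \<noteq> 4" by metis
  then show "p = 5" using * by linarith
qed

lemma next_prime_less:
  assumes "next_prime q p" "2 \<le> q"
  shows "p < 2 * q"
proof -
  obtain r where "nprime r" "q < r" "r < 2 * q" using bertrand [OF assms(2)] by blast
  then show ?thesis using assms(1) by (auto simp: next_prime_def intro: le_less_trans)
qed

lemma prime_not_dvd_3:
  assumes "nprime x" "3 < x"
  shows "\<not> 3 dvd x"
proof
  assume "3 dvd x"
  then have "3 = x" using primes_dvd_imp_eq [of 3 x] assms(1) by simp
  then show False using assms(2) by simp
qed

lemma odd_prime_ge_3:
  assumes "nprime q" "odd q"
  shows "3 \<le> q"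
proof -
  have "q \<noteq> 2" using assms(2) by auto
  then show ?thesis using prime_ge_2_nat [OF assms(1)] by linarith
qed

text \<open>For q = 3 one has p = 5 and \<open>noncyc_bound 5 2\<close> = 726/3126 < 85/301, so the
  case P = p can be treated alike for all q.\<close>

lemma noncyc_bound_le_main_bound:
  assumes "next_prime q p"
  shows "noncyc_bound p 2 \<le> main_bound q p 1"
proof (cases "q = 3")
  case True
  then have "p = 5" using assms next_prime_3 by blast
  then show ?thesis using True by (simp add: main_bound_def noncyc_bound_def)
qed (simp add: main_bound_def)

text \<open>As r and P are odd, P = 2 r t + 1 with t >= 1, so P >= 2q + 1. For \<alpha> \<noteq> 1
  this suffices; for \<alpha> = 1 and q > 3 it has to be set against p < 2q.\<close>

lemma frobenius_bound_le_main_bound: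
  assumes q: "nprime q" "3 \<le> q" and p: "next_prime q p" and P: "nprime P" "odd P"
    and r: "nprime r" "q \<le> r" "r dvd P - 1"
  shows "frobenius_bound q P \<le> main_bound q p a"
proof -
  have r2: "2 < r" using r q by simp
  then have "odd r" using r(1) primes_dvd_imp_eq two_is_prime_nat by blast
  then have "coprime 2 r" by simp
  then have "2 * r dvd P - 1" using P(2) r(3) by (intro divides_mult) auto
  then obtain t where t: "P - 1 = 2 * r * t" by auto
  have P1: "P > 1" using P prime_gt_1_nat by blast
  then have t0: "t > 0" using t by (cases t) auto
  have Pt: "P = 2 * r * t + 1" using t P1 by simp
  have "2 * r * 1 \<le> 2 * r * t" using t0 by (intro mult_le_mono2) simp
  then have Pr: "2 * r + 1 \<le> P" using Pt by linarith
  then have Pq: "2 * q + 1 \<le> P" using r(2) by linarith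
  have pp: "nprime p" "q < p" using p by (auto simp: next_prime_def)
  consider "a \<noteq> 1" | "a = 1" "q = 3" | "a = 1" "3 < q" using q(2) by linarith
  then show ?thesis
  proof cases
    case 1
    have "frobenius_bound q P \<le> 1 / real q" by (rule frobenius_bound_le_inverse [OF q(2) Pq])
    also have "\<dots> < noncyc_bound q a" using q by (intro noncyc_bound_gt_inverse) simp
    finally show ?thesis using 1 by (simp add: main_bound_def)
  next
    case 2
    then show ?thesis using frobenius_bound_3_le [of P] Pq by (simp add: main_bound_def)
  next
    case 3
    have "odd q" using q primes_dvd_imp_eq [OF two_is_prime_nat q(1)] by auto
    then have q5: "5 \<le> q" using 3 by (cases "q = 4") auto
    have p2q: "p < 2 * q" using next_prime_less [OF p] q by simp
    have "P = 2 * q + 1 \<and> p + 3 \<le> 2 * q \<or> 2 * q + 5 \<le> P \<and> p + 1 \<le> 2 * q"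
    proof (cases "P = 2 * q + 1")
      case True
      \<comment> \<open>One of q, 2q - 1, 2q + 1 is divisible by 3, so p = 2q - 1 is impossible when
        P = 2q + 1.\<close>
      have "\<not> 3 dvd q" "\<not> 3 dvd 2 * q + 1" "\<not> 3 dvd p"
        using prime_not_dvd_3 [OF q(1)] prime_not_dvd_3 [OF P(1)] prime_not_dvd_3 [OF pp(1)] 3 True pp(2) by auto
      then have "p \<noteq> 2 * q - 1" using q5 by presburger
      moreover have "odd p" using pp q primes_dvd_imp_eq [OF two_is_prime_nat pp(1)] by auto
      then have "p \<noteq> 2 * q - 2" by auto
      ultimately show ?thesis using True p2q q5 by linarith
    next
      case False
      \<comment> \<open>Either r = q and t >= 2, or r >= q + 2 by parity.\<close>
      have "2 * q + 5 \<le> P"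
      proof (cases "r = q")
        case True
        then have "t \<noteq> 1" using Pt False by auto
        then have "2 * r * 2 \<le> 2 * r * t" using t0 by (intro mult_le_mono2) simp
        then show ?thesis using Pt True q5 by linarith
      next
        case False
        then have "r \<noteq> q + 1" "q < r" using \<open>odd r\<close> \<open>odd q\<close> r(2) by auto
        then show ?thesis using Pr by linarith
      qed
      then show ?thesis using p2q by simp
    qed
    then have "frobenius_bound q P \<le> noncyc_bound p 2"
      using frobenius_bound_le_noncyc_bound [OF q5] pp prime_ge_2_nat by blast
    then show ?thesis using 3 by (simp add: main_bound_def)
  qed
qed

lemma prime_power_of_unique_prime:
  assumes "m > 0" "nprime p" "\<And>r. nprime r \<Longrightarrow> r dvd m \<Longrightarrow> r = p"
  obtains k where "m = p ^ k"
proof -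
  obtain w where w: "m = p ^ multiplicity p m * w" "\<not> p dvd w"
    using multiplicity_decompose' [of m p] assms by (metis not_prime_unit gr_implies_not0)
  have "w = 1"
  proof (rule ccontr)
    assume "w \<noteq> 1"
    then obtain r where r: "nprime r" "r dvd w" using prime_factor_nat by blast
    then have "r dvd m" using w(1) by (metis dvd_mult)
    then show False using assms(3) r w(2) by blast
  qed
  then show ?thesis using that w(1) by simp
qed

locale odd_setting = group G for G (structure) +
  fixes n m q p a P
  assumes fin: "finite (carrier G)" and n: "order G = n" and nm: "n = m * q ^ a" and a: "a > 0" and cop: "coprime m q"
    and q: "nprime q" "3 \<le> q" and odd_n: "odd n" and np: "next_prime q p"
    and min: "\<And>r. nprime r \<Longrightarrow> r dvd n \<Longrightarrow> q \<le> r"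
    and P: "nprime P" "P dvd n" and max: "\<And>r. nprime r \<Longrightarrow> r dvd n \<Longrightarrow> r \<le> P"
begin

lemma n0: "n > 0" using odd_n by (rule odd_pos)

lemma m0: "m > 0" using n0 nm by (metis gr0I mult_0)

lemma odd_dvd: "r dvd n \<Longrightarrow> odd r" using odd_n dvd_trans by blast

lemma prime_p: "nprime p" "q < p" using np by (auto simp: next_prime_def)

lemma q_dvd: "q dvd n" using nm a by simp

lemma prime_m: "p \<le> r" if "nprime r" "r dvd m"
proof -
  have "r dvd n" using that nm by simp
  then have "q \<le> r" using min that by blast
  moreover have "r \<noteq> q" using that cop q by (metis coprime_common_divisor coprime_commute dvd_refl not_prime_unit)
  ultimately show ?thesis using np that by (auto simp: next_prime_def)
qed

lemma prime_factors_n: "prime_factors n = insert q (prime_factors m)"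
  using nm a q m0 by (auto simp: prime_factors_product prime_factors_power prime_prime_factors)

lemma q_notin: "q \<notin> prime_factors m"
  using prime_m [of q] prime_p by (auto simp: in_prime_factors_iff)

lemma prod_n: "(\<Prod>r\<in>prime_factors n. (real r + 1) / real r)
    = (real q + 1) / real q * (\<Prod>r\<in>prime_factors m. (real r + 1) / real r)"
  unfolding prime_factors_n using q_notin by simp

lemma prod_m_sq: "p \<le> P + 2 \<Longrightarrow> (\<Prod>r\<in>prime_factors m. (real r + 1) / real r) ^ 2 \<le> (real P + 1) / (real p - 1)"
proof (rule prod_odd_squared_le)
  show "odd r \<and> p \<le> r \<and> r \<le> P" if "r \<in> prime_factors m" for r
  proof -
    have r: "nprime r" "r dvd m" using that by (auto simp: in_prime_factors_iff)
    then have "r dvd n" using nm by simp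
    then show ?thesis using r prime_m max odd_dvd by blast
  qed
qed (use prime_p prime_ge_2_nat in auto)

lemma prod_n_sq: "q \<le> P + 2 \<Longrightarrow> (\<Prod>r\<in>prime_factors n. (real r + 1) / real r) ^ 2 \<le> (real P + 1) / (real q - 1)"
proof (rule prod_odd_squared_le)
  show "odd r \<and> q \<le> r \<and> r \<le> P" if "r \<in> prime_factors n" for r
    using that min max odd_dvd by (auto simp: in_prime_factors_iff)
qed (use q in auto)

lemma prod_subset_le:
  assumes "finite B" "prime_factors k \<subseteq> B" "0 \<notin> B"
  shows "(\<Prod>r\<in>prime_factors k. (real r + 1) / real r) \<le> (\<Prod>r\<in>B. (real r + 1) / real r)"
proof (rule prod_mono2 [OF assms(1,2)])
  fix b assume "b \<in> B - prime_factors k"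
  then have "b \<in> B" by blast
  then have "b \<noteq> 0" using assms(3) by metis
  then show "1 \<le> (real b + 1) / real b" by simp
qed auto

text \<open>It suffices that the product over the primes is at most P/q. The gap P = q + 2 leaves
  only two possible primes and follows from (q+1)(q+3) <= (q+2)^2.\<close>

lemma large_ord_exponent_ge_2:
  assumes "q < P" "a \<noteq> 1"
  shows "real (psi G) \<le> main_bound q p a * real (cyc_psi n) \<or> (\<exists>x\<in>carrier G. n < P * ord x)"
proof -
  have oP: "odd P" "odd q" using odd_dvd P q_dvd by auto
  let ?R = "\<Prod>r\<in>prime_factors n. (real r + 1) / real r"
  have "?R \<le> real P / real q"
  proof (cases "P = q + 2")
    case True
    have "prime_factors n \<subseteq> {q, q + 2}"
    proof
      fix r assume "r \<in> prime_factors n"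
      then have "q \<le> r" "r \<le> P" "odd r" using min max odd_dvd by (auto simp: in_prime_factors_iff)
      moreover then have "r \<noteq> q + 1" using oP by auto
      ultimately show "r \<in> {q, q + 2}" using True by auto
    qed
    then have "?R \<le> (\<Prod>r\<in>{q, q + 2}. (real r + 1) / real r)"
      using q by (intro prod_subset_le) auto
    also have "\<dots> = ((real q + 1) * (real q + 3) / (real q + 2)) / real q" by (simp add: add_ac mult_ac)
    also have "\<dots> \<le> (real q + 2) / real q"
    proof (intro divide_right_mono)
      have "(real q + 1) * (real q + 3) \<le> (real q + 2) * (real q + 2)" by (simp add: algebra_simps)
      then show "(real q + 1) * (real q + 3) / (real q + 2) \<le> real q + 2" by (simp add: divide_le_eq)
    qed simp
    finally show ?thesis using True by (simp add: add_ac)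
  next
    case False
    then have "q + 4 \<le> P" using assms(1) oP by (cases "P = q + 1 \<or> P = q + 3") auto
    then have "real q + 4 \<le> real P" by (metis of_nat_add of_nat_le_iff of_nat_numeral)
    then show ?thesis using prime_product_estimate_square [of "real q" "real P" ?R] prod_n_sq q assms by simp
  qed
  also have "\<dots> \<le> main_bound q p a * real P"
  proof -
    have "1 / real q \<le> main_bound q p a"
      using noncyc_bound_gt_inverse [of q a] q assms(2) by (simp add: main_bound_def)
    then have "1 / real q * real P \<le> main_bound q p a * real P" by (intro mult_right_mono) auto
    then show ?thesis by simp
  qed
  finally show ?thesis
    using psi_le_or_large_ord [OF fin, of P "main_bound q p a"] n P prime_gt_0_nat by simp
qed

text \<open>If the second alternative fails, no element has order p^k, since it would generate a
  subgroup of index q < P. So the Sylow p-subgroup is not cyclic, which forces k >= 2.\<close>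

lemma large_ord_two_primes:
  assumes a1: "a = 1" and Pp: "P = p"
  shows "real (psi G) \<le> main_bound q p a * real (cyc_psi n) \<or> (\<exists>x\<in>carrier G. n < P * ord x)"
proof (cases "\<exists>x\<in>carrier G. n < P * ord x")
  case no: False
  have "r = p" if r: "nprime r" "r dvd m" for r
  proof -
    have "r dvd n" using r nm by simp
    then show ?thesis using prime_m [OF r] max [OF r(1)] Pp by simp
  qed
  then obtain k where k: "m = p ^ k" using prime_power_of_unique_prime [OF m0 prime_p(1)] by blast
  have nk: "order G = q * p ^ k" using n nm a1 k by simp
  have p1: "p > 1" using prime_p prime_gt_1_nat by blast
  have nel: "ord x \<noteq> p ^ k" if "x \<in> carrier G" for x
  proof
    assume "ord x = p ^ k"
    then have "\<not> q * p ^ k < p * p ^ k" using no that nk n Pp by auto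
    then show False using prime_p(2) p1 by simp
  qed
  have "k \<noteq> 0" using nel [of \<one>] by (intro notI) simp
  moreover have "k \<noteq> 1"
  proof
    assume k1: "k = 1"
    obtain H where H: "subgroup H G" "card H = p ^ 1"
      using sylow_thm [OF prime_p(1) is_group _ fin, of 1 q] nk k1 by (auto simp: mult.commute)
    then have "\<not> H \<subseteq> {\<one>}" using p1 card_mono [of "{\<one>}" H] by auto
    then obtain x where x: "x \<in> H" "x \<noteq> \<one>" by blast
    have xG: "x \<in> carrier G" using subgroup.mem_carrier [OF H(1) x(1)] .
    have "ord x dvd p" using ord_dvd_card_subgroup [OF H(1) x(1)] H(2) by simp
    moreover have "ord x \<noteq> 1" using ord_eq_1 [OF xG] x(2) by simp
    ultimately have "ord x = p" using prime_p(1) by (metis prime_nat_iff)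
    then show False using nel [OF xG] k1 by simp
  qed
  ultimately obtain j where j: "k = j + 2" by (metis add_2_eq_Suc' not0_implies_Suc One_nat_def)
  have odd_p: "odd p" using Pp P(2) odd_dvd by blast
  have "real (psi G) \<le> noncyc_bound p 2 * real (cyc_psi (p ^ (j + 2))) * real (cyc_psi q)"
    using two_prime_psi_le [OF fin q(1) prime_p(1) odd_p prime_p(2), of j] nk nel j by blast
  also have "\<dots> = noncyc_bound p 2 * real (cyc_psi n)"
    using cyc_psi_mult [of q "p ^ k"] cop q p1 n nk j k by (simp add: coprime_commute mult_ac)
  also have "\<dots> \<le> main_bound q p a * real (cyc_psi n)"
    using noncyc_bound_le_main_bound [OF np] a1 by (intro mult_right_mono) auto
  finally show ?thesis by blast
qed blast

text \<open>For q > 3 the gap P - p decides: 0 and 2 need the two refined arguments, 4 and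
  everything from 6 on the plain average. For q = 3 the plain average suffices from gap 2
  on.\<close>

lemma large_ord_exponent_1:
  assumes a1: "a = 1" and qP: "q < P"
  shows "real (psi G) \<le> main_bound q p a * real (cyc_psi n) \<or> (\<exists>x\<in>carrier G. n < P * ord x)"
proof -
  have oP: "odd P" "odd q" using odd_dvd P q_dvd by auto
  have odd_p: "odd p" using prime_p q primes_dvd_imp_eq [OF two_is_prime_nat prime_p(1)] by auto
  have P0: "P > 0" using qP by simp
  have pP: "p \<le> P" using np P qP by (auto simp: next_prime_def)
  let ?Rm = "\<Prod>r\<in>prime_factors m. (real r + 1) / real r"
  have Rm0: "?Rm \<ge> 0" by (intro prod_nonneg) auto
  have Rsq: "?Rm ^ 2 \<le> (real P + 1) / (real p - 1)" using prod_m_sq pP by simp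
  have crude: ?thesis if "(real q + 1) / real q * ?Rm \<le> main_bound q p a * real P"
    using psi_le_or_large_ord [OF fin P0, of "main_bound q p a"] that n prod_n by simp
  have sub: "prime_factors m \<subseteq> {r. nprime r \<and> odd r \<and> p \<le> r \<and> r \<le> P}"
  proof
    fix r assume "r \<in> prime_factors m"
    then have r: "nprime r" "r dvd m" by (auto simp: in_prime_factors_iff)
    then have "r dvd n" using nm by simp
    then show "r \<in> {r. nprime r \<and> odd r \<and> p \<le> r \<and> r \<le> P}" using r prime_m max odd_dvd by blast
  qed
  show ?thesis
  proof (cases "P = p")
    case True
    then show ?thesis using large_ord_two_primes a1 by blast
  next
    case Pp: False
    then have Pp2: "p + 2 \<le> P" using pP oP odd_p by (cases "P = p + 1") auto
    show ?thesis
    proof (cases "q = 3")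
      case True
      then have p5: "p = 5" using np next_prime_3 by blast
      then have "7 \<le> P" using Pp2 by simp
      then have "4 / 3 * ?Rm \<le> 85 / 301 * real P"
        using prime_product_estimate_3 [of "real P" ?Rm] Rsq p5 by simp
      then show ?thesis using crude True a1 by (simp add: main_bound_def)
    next
      case False
      have mb: "main_bound q p a = noncyc_bound p 2" using False a1 by (simp add: main_bound_def)
      have q5: "5 \<le> q" using False q(2) oP by (cases "q = 4") auto
      then have p7: "7 \<le> p" using prime_p(2) odd_p by (cases "p = 6") auto
      have p2q: "p + 1 \<le> 2 * q" using next_prime_less [OF np] q5 by simp
      then have "real (p + 1) \<le> real (2 * q)" by (simp only: of_nat_le_iff)
      then have p2q': "real p + 1 \<le> 2 * real q" by simp
      define g where "g = real p / (real p ^ 2 - real p + 2)"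
      have g: "g \<le> noncyc_bound p 2" unfolding g_def using noncyc_bound_2_ge p7 by simp
      then have gP: "g * real P \<le> main_bound q p a * real P" unfolding mb by (intro mult_right_mono) auto
      consider "P = p + 2" | "P = p + 4" | "p + 6 \<le> P"
        using Pp2 oP odd_p by (cases "P = p + 3 \<or> P = p + 5") (auto, linarith)
      then show ?thesis
      proof cases
        case 1
        have "r = p \<or> r = p + 2" if "odd r" "p \<le> r" "r \<le> P" for r
          using that 1 odd_p by (cases "r = p + 1") auto
        then have "prime_factors m \<subseteq> {p, p + 2}" using sub by blast
        then have R: "?Rm \<le> (real p + 1) / real p * ((real p + 3) / (real p + 2))"
          using prod_subset_le [of "{p, p + 2}" m] p7 by (simp add: add_ac)
        let ?c = "(real q ^ 2 - real q) / real P + 1 / real p"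
        have P': "real P = real p + 2" using 1 by simp
        have "real q ^ 2 \<ge> real q" using q5 by (simp add: power2_eq_square)
        then have "?c \<ge> 0" by simp
        then have "?c * ?Rm \<le> ?c * ((real p + 1) / real p * ((real p + 3) / (real p + 2)))"
          using R by (intro mult_left_mono)
        also have "\<dots> \<le> g * (real q ^ 2 - real q + 1)"
          unfolding P' g_def using p7 q5 by (intro prime_product_estimate_gap_2) auto
        also have "\<dots> \<le> main_bound q p a * (real q ^ 2 - real q + 1)"
          unfolding mb using g quadratic_pos [of "real q"] by (intro mult_right_mono) auto
        finally have c: "?c * ?Rm \<le> main_bound q p a * (real q ^ 2 - real q + 1)" .
        have o: "order G = q * m" using n nm a1 by simp
        have "3 * p \<le> q * p" using q(2) by (rule mult_le_mono1)
        then have Pqp: "P \<le> q * p" using 1 p7 by linarith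
        have cop': "coprime q m" using cop by (simp add: coprime_commute)
        show ?thesis
          using psi_le_or_large_ord_prime_factor [OF fin q(1) o cop' _ prime_m qP Pqp c] p7 n by simp
      next
        case 2
        \<comment> \<open>One of p, p + 2, p + 4 is divisible by 3, and p and p + 4 = P are primes
          above 3.\<close>
        have "\<not> nprime (p + 2)"
        proof
          assume "nprime (p + 2)"
          then have "\<not> 3 dvd p" "\<not> 3 dvd p + 2" "\<not> 3 dvd p + 4"
            using prime_not_dvd_3 [of p] prime_not_dvd_3 [of "p + 2"] prime_not_dvd_3 [of "p + 4"] prime_p(1) P(1) 2 p7 by auto
          then show False by presburger
        qed
        moreover have "r = p \<or> r = p + 2 \<or> r = p + 4" if "odd r" "p \<le> r" "r \<le> P" for r
          using that 2 odd_p by (cases "r = p + 1 \<or> r = p + 3") auto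
        ultimately have "prime_factors m \<subseteq> {p, p + 4}" using sub by blast
        then have R: "?Rm \<le> (real p + 1) / real p * ((real p + 5) / (real p + 4))"
          using prod_subset_le [of "{p, p + 4}" m] p7 by (simp add: add_ac)
        then have "(real q + 1) / real q * ?Rm \<le> (real q + 1) / real q * ((real p + 1) / real p * ((real p + 5) / (real p + 4)))"
          by (intro mult_left_mono) auto
        also have "\<dots> \<le> g * (real p + 4)"
          unfolding g_def using p7 q5 p2q' by (intro prime_product_estimate_gap_4) auto
        also have "\<dots> = g * real P" using 2 by simp
        finally show ?thesis using crude gP by linarith
      next
        case 3
        then have "real (p + 6) \<le> real P" by (simp only: of_nat_le_iff)
        then have "real p + 6 \<le> real P" by simp
        then have "(real q + 1) / real q * ?Rm \<le> g * real P"
          unfolding g_def using p7 q5 p2q' Rsq Rm0 by (intro prime_product_estimate_far) auto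
        then show ?thesis using crude gP by linarith
      qed
    qed
  qed
qed

end

section \<open>The induction on n\<close>

text \<open>Only the P-part is divided out and P differs from q, so the quotient has the same q and
  \<alpha>, hence the same bound, while psi(C_(P^k)) splits off on both sides. Carriers are in
  \<open>nat\<close> because the quotient must be replaced by a copy of the same type.\<close>

lemma psi_le_main_bound_nat:
  fixes G :: "nat monoid"
  assumes "odd_noncyclic G n m q a" "next_prime q p"
  shows "real (psi G) \<le> main_bound q p a * real (cyc_psi n)"
  using assms(1)
proof (induction n arbitrary: G m rule: less_induct)
  case (less n)
  have G: "group G" "finite (carrier G)" "\<not> cyclic_group G" "order G = n" "odd n" "n = m * q ^ a"
    "0 < a" "coprime m q" and q: "nprime q" "q dvd n" and min: "\<And>r. nprime r \<Longrightarrow> r dvd n \<Longrightarrow> q \<le> r"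
    using less.prems by (auto simp: odd_noncyclic_def smallest_prime_divisor_def)
  interpret group G by fact
  have n0: "n > 0" using G(5) by (rule odd_pos)
  have odd_q: "odd q" using q(2) G(5) dvd_trans by blast
  have q3: "3 \<le> q" using odd_prime_ge_3 [OF q(1) odd_q] .
  define P where "P = Max (prime_factors n)"
  have qpf: "q \<in> prime_factors n" using q n0 by (simp add: in_prime_factors_iff)
  have "P \<in> prime_factors n" unfolding P_def using qpf by (intro Max_in) auto
  then have P: "nprime P" "P dvd n" by (auto simp: in_prime_factors_iff)
  have max: "r \<le> P" if "nprime r" "r dvd n" for r
    unfolding P_def using that n0 by (intro Max_ge) (auto simp: in_prime_factors_iff)
  interpret O: odd_setting G n m q p a P
    using G q q3 min P max assms(2) by unfold_locales auto
  have P1: "P > 1" using P prime_gt_1_nat by blast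
  have odd_P: "odd P" using O.odd_dvd P(2) .
  show ?case
  \<comment> \<open>If the largest and the smallest prime divisor coincide, G is a q-group, and
    \<alpha> \<ge> 2 because groups of prime order are cyclic.\<close>
  proof (cases "P = q")
    case True
    have "m = 1"
    proof (rule ccontr)
      assume "m \<noteq> 1"
      then obtain r where r: "nprime r" "r dvd m" using prime_factor_nat by blast
      then have "p \<le> r" using O.prime_m by blast
      moreover have "r \<le> q" using max [of r] r G(6) True by simp
      ultimately show False using O.prime_p by simp
    qed
    then have nq: "n = q ^ a" using G(6) by simp
    have "a \<noteq> 1"
    proof
      assume "a = 1"
      then have oq: "order G = q" using nq G(4) by simp
      then have "carrier G \<noteq> {\<one>\<^bsub>G\<^esub>}" using q3 by (auto simp: order_def)
      then obtain x where x: "x \<in> carrier G" "x \<noteq> \<one>\<^bsub>G\<^esub>" by auto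
      have "ord x dvd q" using ord_dvd_group_order [OF x(1)] oq by simp
      moreover have "ord x \<noteq> 1" using ord_eq_1 [OF x(1)] x(2) by simp
      ultimately have "ord x = order G" using q(1) oq by (metis prime_nat_iff)
      then show False using cyclic_groupI [OF G(2) x(1)] G(3) by blast
    qed
    then obtain k where k: "a = k + 2" using G(7) by (metis add_2_eq_Suc' not0_implies_Suc One_nat_def less_not_refl)
    have "real (psi G) \<le> (real q ^ (2 * k + 4) + real q ^ 3 - real q ^ 2 + 1) / (real q + 1)"
      by (rule pgroup_psi_le [OF G(2) q(1) odd_q _ G(3)]) (use G(4) nq k in simp)
    also have "\<dots> = noncyc_bound q a * real (cyc_psi (q ^ a))"
    proof -
      have "2 * a = 2 * k + 4" using k by simp
      then show ?thesis unfolding noncyc_bound_mult_cyc_psi [OF q(1)] by simp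
    qed
    finally show ?thesis using nq \<open>a \<noteq> 1\<close> by (simp add: main_bound_def)
  next
    case False
    then have qP: "q < P" using min [OF P] by simp
    have "real (psi G) \<le> main_bound q p a * real (cyc_psi n) \<or> (\<exists>x\<in>carrier G. n < P * ord x)"
      using O.large_ord_exponent_1 [OF _ qP] O.large_ord_exponent_ge_2 [OF qP] by blast
    then show ?thesis
    proof
      assume "\<exists>x\<in>carrier G. n < P * ord x"
      then obtain x where x: "x \<in> carrier G" "order G < P * ord x" using G(4) by blast
      define k where "k = multiplicity P n"
      obtain N where N: "n = P ^ k * N" "\<not> P dvd N"
        using multiplicity_decompose' [of n P] n0 P unfolding k_def by (metis not_prime_unit gr_implies_not0)
      have k0: "k > 0" using P n0 by (simp add: k_def prime_multiplicity_gt_zero_iff)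
      have copP: "coprime P N" using N(2) P(1) by (simp add: prime_imp_coprime)
      have oPN: "order G = P ^ k * N" using G(4) N(1) by simp
      obtain S s where "normal_cyclic_sylow G S s P k N"
        using normal_cyclic_sylow_of_small_index [OF G(2) P(1) x(1) oPN copP x(2)] by blast
      then interpret S: normal_cyclic_sylow G S s P k N .
      have Nn: "r dvd n" if "r dvd N" for r using that N(1) by simp
      show ?thesis
      proof (cases "cyclic_group (G Mod S)")
        case True
        obtain r where r: "nprime r" "r dvd N" "r dvd P - 1"
          and le: "real (psi G) \<le> frobenius_bound q P * real (cyc_psi (order G))"
          using S.psi_le_frobenius_bound [OF True G(3) k0, of q] q3 min Nn by force
        have "frobenius_bound q P \<le> main_bound q p a"
          using frobenius_bound_le_main_bound [OF q(1) q3 assms(2) P(1) odd_P r(1) _ r(3)] min r Nn by blast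
        then have "frobenius_bound q P * real (cyc_psi n) \<le> main_bound q p a * real (cyc_psi n)"
          by (intro mult_right_mono) auto
        then show ?thesis using le G(4) by simp
      next
        case ncyc: False
        obtain H :: "nat monoid" and h where H: "group H" "h \<in> iso (G Mod S) H"
          using S.Q.finite_group_iso_nat [OF S.fin_quotient] by blast
        have iso: "G Mod S \<cong> H" using H(2) by (auto simp: is_iso_def)
        have oH: "order H = N" using iso_same_order [OF H(2)] S.order_quotient by simp
        \<comment> \<open>The full q-part of n survives in N, so the hypotheses pass to the
          quotient.\<close>
        have "coprime (q ^ a) (P ^ k)" using q P False by (simp add: primes_coprime)
        moreover have "q ^ a dvd P ^ k * N" using N(1) G(6) by (metis dvd_triv_right)
        ultimately have "q ^ a dvd N" by (simp add: coprime_dvd_mult_right_iff)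
        then obtain m' where m': "N = m' * q ^ a" by (metis dvd_def mult.commute)
        have "m * q ^ a = P ^ k * m' * q ^ a" using N(1) G(6) m' by (simp add: mult_ac)
        then have "m = P ^ k * m'" using q(1) prime_gt_0_nat by simp
        then have copm: "coprime m' q" using G(8) by simp
        have "N < n" using N(1) n0 one_less_power [OF P1 k0] by (cases "N = 0") auto
        moreover have "odd_noncyclic H N m' q a"
          unfolding odd_noncyclic_def smallest_prime_divisor_def
        proof (intro conjI allI impI)
          show "\<not> cyclic_group H" using isomorphic_group_cyclicity [OF iso S.Q.is_group H(1)] ncyc by simp
          show "finite (carrier H)" using oH S.N_pos H(1) by (metis order_gt_0_iff_finite group.is_monoid monoid.order_gt_0_iff_finite)
          show "odd N" using G(5) N(1) by simp
          show "q dvd N" using m' G(7) by simp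
          show "q \<le> r" if "nprime r \<and> r dvd N" for r using min Nn that by blast
        qed (use H oH m' copm q G in auto)
        ultimately have IH: "real (psi H) \<le> main_bound q p a * real (cyc_psi N)" using less.IH by blast
        have "psi H = psi (G Mod S)" using psi_iso [OF H(2) S.Q.is_group H(1)] .
        then have "real (psi G) \<le> real (cyc_psi (P ^ k)) * real (psi H)"
          using S.psi_le_quotient by (metis of_nat_le_iff of_nat_mult)
        also have "\<dots> \<le> real (cyc_psi (P ^ k)) * (main_bound q p a * real (cyc_psi N))"
          using IH by (intro mult_left_mono) auto
        also have "\<dots> = main_bound q p a * real (cyc_psi n)"
          using cyc_psi_mult [of "P ^ k" N] copP P1 S.N_pos N(1) by (simp add: mult_ac)
        finally show ?thesis .
      qed
    qed
  qed
qed

text \<open>Serves twice: the upper bound is proved on \<open>nat\<close> for groups of any type,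
  and the attaining groups, built on other types, are claimed on \<open>nat\<close>.\<close>

lemma odd_noncyclic_transfer_nat:
  assumes G: "odd_noncyclic G n m q a"
  shows "\<exists>H :: nat monoid. odd_noncyclic H n m q a \<and> psi_ratio H n = psi_ratio G n"
proof -
  have g: "group G" "finite (carrier G)" and n0: "n > 0"
    using G by (auto simp: odd_noncyclic_def intro: odd_pos)
  obtain H :: "nat monoid" and h where H: "group H" "h \<in> iso G H"
    using group.finite_group_iso_nat [OF g] by blast
  have iso: "G \<cong> H" using H(2) by (auto simp: is_iso_def)
  have oH: "order H = n" using iso_same_order [OF H(2)] G by (simp add: odd_noncyclic_def)
  have finH: "finite (carrier H)" using oH n0 card_ge_0_finite [of "carrier H"] by (simp add: order_def)
  have "odd_noncyclic H n m q a"
    using G H(1) oH finH isomorphic_group_cyclicity [OF iso g(1) H(1)] unfolding odd_noncyclic_def by blast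
  moreover have "psi_ratio H n = psi_ratio G n"
    using psi_iso [OF H(2) g(1) H(1)] by (simp add: psi_ratio_def)
  ultimately show ?thesis by blast
qed

lemma psi_ratio_le_main_bound:
  assumes G: "odd_noncyclic G n m q a" and np: "next_prime q p"
  shows "psi_ratio G n \<le> main_bound q p a"
proof -
  have n0: "n > 0" using G by (auto simp: odd_noncyclic_def intro: odd_pos)
  obtain H :: "nat monoid" where H: "odd_noncyclic H n m q a" "psi_ratio H n = psi_ratio G n"
    using odd_noncyclic_transfer_nat [OF G] by blast
  have "psi_ratio H n \<le> main_bound q p a"
    using psi_le_main_bound_nat [OF H(1) np] cyc_psi_pos [OF n0]
    by (simp add: psi_ratio_def psi_Cyc [OF n0] divide_le_eq)
  then show ?thesis using H(2) by simp
qed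

section \<open>Values of the ratio on the extremal abelian groups\<close>

lemma psi_ratio_pgroup:
  assumes "group G" "finite (carrier G)" and q: "nprime q" "odd q" and o: "order G = q ^ (k + 2)"
    and a: "a \<in> carrier G" "group.ord G a = q ^ Suc k" and ncyc: "\<not> cyclic_group G"
  shows "psi_ratio G (q ^ (k + 2)) = noncyc_bound q (k + 2)"
proof -
  interpret group G by fact
  have q0: "q ^ (k + 2) > 0" using q prime_gt_0_nat by simp
  have e: "2 * (k + 2) = 2 * k + 4" by simp
  have "real (psi G) = noncyc_bound q (k + 2) * real (cyc_psi (q ^ (k + 2)))"
    unfolding noncyc_bound_mult_cyc_psi [OF q(1)] e
    by (rule pgroup_psi_real [OF assms(2) q o a ncyc])
  then show ?thesis
    unfolding psi_ratio_def psi_Cyc [OF q0] using cyc_psi_pos [OF q0] by simp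
qed

lemma ord_DirProd_Cyc_dvd:
  assumes q: "q > 0" and x: "x \<in> carrier (Cyc q \<times>\<times> Cyc (q ^ Suc k))"
  shows "group.ord (Cyc q \<times>\<times> Cyc (q ^ Suc k)) x dvd q ^ Suc k"
proof -
  obtain a b where x': "x = (a, b)" "a \<in> carrier (Cyc q)" "b \<in> carrier (Cyc (q ^ Suc k))"
    using x by (cases x) auto
  have "group.ord (Cyc q) a dvd q" "group.ord (Cyc (q ^ Suc k)) b dvd q ^ Suc k"
    using group.ord_dvd_group_order [OF _ x'(2)] group.ord_dvd_group_order [OF _ x'(3)] q
    by (simp_all add: order_Cyc)
  then show ?thesis
    using x' by (simp add: ord_DirProd)
qed

lemma DirProd_Cyc_facts:
  fixes k :: nat
  assumes q: "nprime q"
  defines "G \<equiv> Cyc q \<times>\<times> Cyc (q ^ Suc k)"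
  shows "group G" "finite (carrier G)" "order G = q ^ (k + 2)" "\<not> cyclic_group G"
    "\<exists>a\<in>carrier G. group.ord G a = q ^ Suc k"
proof -
  have q1: "q > 1" using q prime_gt_1_nat by blast
  show g: "group G" unfolding G_def by (simp add: DirProd_group)
  show f: "finite (carrier G)" using q1 by (simp add: G_def finite_Cyc)
  show o: "order G = q ^ (k + 2)" using q1 by (simp add: G_def order_DirProd order_Cyc)
  show "\<not> cyclic_group G"
  proof
    assume "cyclic_group G"
    then obtain x where x: "x \<in> carrier G" "group.ord G x = q ^ (k + 2)"
      using group.cyclic_group_imp_ord [OF g f] o by metis
    have "group.ord G x dvd q ^ Suc k" using ord_DirProd_Cyc_dvd [of q x k] x(1) q1 by (simp add: G_def)
    then have "q ^ (k + 2) \<le> q ^ Suc k" using x(2) q1 by (simp add: dvd_imp_le)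
    then show False using q1 by simp
  qed
  have "q ^ Suc k > 0" using q1 by simp
  then obtain b where b: "b \<in> carrier (Cyc (q ^ Suc k))" "group.ord (Cyc (q ^ Suc k)) b = q ^ Suc k"
    using ord_Cyc_gen by blast
  have "group.ord (Cyc q) \<one>\<^bsub>Cyc q\<^esub> = 1" using group.ord_id [OF group_integer_mod_group] .
  then have "group.ord G (0, b) = q ^ Suc k"
    using b by (simp add: G_def ord_DirProd del: power_Suc)
  then show "\<exists>a\<in>carrier G. group.ord G a = q ^ Suc k"
    using b by (intro bexI [of _ "(0, b)"]) (auto simp: G_def)
qed

lemma psi_ratio_DirProd_Cyc:
  assumes "nprime q" "odd q"
  shows "psi_ratio (Cyc q \<times>\<times> Cyc (q ^ Suc k)) (q ^ (k + 2)) = noncyc_bound q (k + 2)"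
proof -
  note facts = DirProd_Cyc_facts [OF assms(1), of k]
  obtain a where a: "a \<in> carrier (Cyc q \<times>\<times> Cyc (q ^ Suc k))"
    "group.ord (Cyc q \<times>\<times> Cyc (q ^ Suc k)) a = q ^ Suc k"
    using facts(5) by blast
  show ?thesis by (rule psi_ratio_pgroup [OF facts(1,2) assms facts(3) a facts(4)])
qed

subsection \<open>The group \<open>M(q\<^sup>3)\<close>\<close>

text \<open>Right multiplication by a letter on the normal forms \<open>b\<^sup>j a\<^sup>i\<close>, written as pairs \<open>(i, j)\<close>:
  the resulting action of words on \<open>\<int>/q\<^sup>2 \<times> \<int>/q\<close> respects the relations, so
  these normal forms are pairwise distinct.\<close>

fun letter_act :: "nat \<Rightarrow> gen \<times> bool \<Rightarrow> nat \<times> nat \<Rightarrow> nat \<times> nat" where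
  "letter_act q (Gen_a, True) (i, j) = ((i + 1) mod q\<^sup>2, j)"
| "letter_act q (Gen_a, False) (i, j) = ((i + (q\<^sup>2 - 1)) mod q\<^sup>2, j)"
| "letter_act q (Gen_b, True) (i, j) = ((i * (q + 1)) mod q\<^sup>2, (j + 1) mod q)"
| "letter_act q (Gen_b, False) (i, j) = ((i * (q\<^sup>2 - q + 1)) mod q\<^sup>2, (j + (q - 1)) mod q)"

definition word_act :: "nat \<Rightarrow> gen word \<Rightarrow> nat \<times> nat \<Rightarrow> nat \<times> nat" where
  "word_act q w = fold (letter_act q) w"

definition M_cubed_rels :: "nat \<Rightarrow> (gen word \<times> gen word) set" where
  "M_cubed_rels q =
     {(replicate (q ^ 2) (Gen_a, True), []),
      (replicate q (Gen_b, True), []),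
      ([(Gen_b, False), (Gen_a, True), (Gen_b, True)], replicate (q + 1) (Gen_a, True))}"

lemma M_cubed_eq: "M_cubed q = presented_group (M_cubed_rels q)"
  by (simp add: M_cubed_def M_cubed_rels_def)

lemma word_act_append: "word_act q (u @ v) x = word_act q v (word_act q u x)"
  by (simp add: word_act_def)

lemma word_act_mem:
  assumes "q > 0" "x \<in> {..<q\<^sup>2} \<times> {..<q}"
  shows "word_act q w x \<in> {..<q\<^sup>2} \<times> {..<q}"
  using assms(2)
proof (induction w arbitrary: x)
  case (Cons l w)
  have "letter_act q l x \<in> {..<q\<^sup>2} \<times> {..<q}"
    using Cons.prems assms(1) by (cases "(q, l, x)" rule: letter_act.cases) auto
  then show ?case using Cons.IH by (simp add: word_act_def)
qed (simp add: word_act_def)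

lemma word_act_replicate_a:
  assumes "i < q\<^sup>2"
  shows "word_act q (replicate n (Gen_a, True)) (i, j) = ((i + n) mod q\<^sup>2, j)"
  using assms
proof (induction n arbitrary: i)
  case (Suc n)
  have "q\<^sup>2 > 0" using Suc.prems by (metis gr0I not_less0)
  then have "word_act q (replicate n (Gen_a, True)) ((i + 1) mod q\<^sup>2, j) = (((i + 1) mod q\<^sup>2 + n) mod q\<^sup>2, j)"
    by (intro Suc.IH) simp
  then show ?case by (simp add: word_act_def mod_add_left_eq)
qed (simp add: word_act_def)

lemma word_act_replicate_b:
  assumes "i < q\<^sup>2" "j < q"
  shows "word_act q (replicate n (Gen_b, True)) (i, j) = ((i * (q + 1) ^ n) mod q\<^sup>2, (j + n) mod q)"
  using assms
proof (induction n arbitrary: i j)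
  case (Suc n)
  have "q\<^sup>2 > 0" "q > 0" using Suc.prems by (auto intro: gr0I)
  then have "word_act q (replicate n (Gen_b, True)) ((i * (q + 1)) mod q\<^sup>2, (j + 1) mod q)
      = (((i * (q + 1)) mod q\<^sup>2 * (q + 1) ^ n) mod q\<^sup>2, ((j + 1) mod q + n) mod q)"
    by (intro Suc.IH) auto
  also have "\<dots> = ((i * (q + 1) ^ Suc n) mod q\<^sup>2, (j + Suc n) mod q)"
    by (simp only: mod_mult_left_eq mod_add_left_eq power_Suc mult.assoc) simp
  finally show ?case by (simp add: word_act_def)
qed (simp add: word_act_def)

lemma Suc_power_cong: "[(q + 1) ^ j = 1 + j * q] (mod q\<^sup>2)" for q :: nat
proof (induction j)
  case (Suc j)
  have "[(q + 1) ^ Suc j = (q + 1) * (1 + j * q)] (mod q\<^sup>2)"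
    using cong_mult [OF cong_refl [of "q + 1"] Suc] by simp
  also have "(q + 1) * (1 + j * q) = (1 + Suc j * q) + q\<^sup>2 * j"
    by (simp add: algebra_simps power2_eq_square)
  also have "[(1 + Suc j * q) + q\<^sup>2 * j = 1 + Suc j * q] (mod q\<^sup>2)" by (simp add: cong_def)
  finally show ?case .
qed simp

text \<open>The letter b^-1 acts through the inverse of q + 1 modulo q^2, which is q^2 - q + 1
  because (q+1)(q^2 - q + 1) = q^3 + 1.\<close>

lemma Suc_mult_inverse_mod_square:
  fixes q :: nat
  assumes q: "q > 1"
  shows "(q + 1) * (q\<^sup>2 - q + 1) = 1 + q\<^sup>2 * q"
    and "(i * (q + 1) * (q\<^sup>2 - q + 1)) mod q\<^sup>2 = i mod q\<^sup>2"
proof -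
  obtain d where "q\<^sup>2 = q + d" using le_Suc_ex [of q "q\<^sup>2"] by (auto simp: power2_eq_square)
  then show 1: "(q + 1) * (q\<^sup>2 - q + 1) = 1 + q\<^sup>2 * q"
    by (simp add: algebra_simps power2_eq_square)
  have "i * (q + 1) * (q\<^sup>2 - q + 1) = i * ((q + 1) * (q\<^sup>2 - q + 1))" by (simp only: mult.assoc)
  also have "\<dots> = i + q\<^sup>2 * (q * i)" unfolding 1 by (simp add: algebra_simps)
  finally have "i * (q + 1) * (q\<^sup>2 - q + 1) = i + q\<^sup>2 * (q * i)" .
  then show "(i * (q + 1) * (q\<^sup>2 - q + 1)) mod q\<^sup>2 = i mod q\<^sup>2" by (simp only: mod_mult_self2)
qed

text \<open>The letter b acts by a^i b = b a^(i (q+1)), the third relation moved across. The word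
  b^q acts trivially because (q+1)^q = 1 + q^2 = 1 modulo q^2.\<close>

lemma word_act_rels:
  assumes q: "q > 1" and "(u, v) \<in> M_cubed_rels q" and ij: "i < q\<^sup>2" "j < q"
  shows "word_act q u (i, j) = word_act q v (i, j)"
proof -
  have nil: "word_act q [] (i, j) = (i, j)" by (simp add: word_act_def)
  consider "u = replicate (q ^ 2) (Gen_a, True)" "v = []" | "u = replicate q (Gen_b, True)" "v = []"
    | "u = [(Gen_b, False), (Gen_a, True), (Gen_b, True)]" "v = replicate (q + 1) (Gen_a, True)"
    using assms(2) unfolding M_cubed_rels_def by blast
  then show ?thesis
  proof cases
    case 1
    then show ?thesis using word_act_replicate_a [OF ij(1), of "q\<^sup>2" j] ij nil by simp
  next
    case 2
    have "[(q + 1) ^ q = 1 + q * q] (mod q\<^sup>2)" by (rule Suc_power_cong)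
    also have "[1 + q * q = 1] (mod q\<^sup>2)" 
      unfolding power2_eq_square cong_def by (rule mod_add_self2)
    finally have "[i * (q + 1) ^ q = i * 1] (mod q\<^sup>2)" by (intro cong_mult cong_refl)
    then have "(i * (q + 1) ^ q) mod q\<^sup>2 = i" using ij by (simp add: cong_def)
    then show ?thesis using 2 word_act_replicate_b [OF ij, of q] ij(2) nil by simp
  next
    case 3
    define r where "r = q\<^sup>2 - q + 1"
    have "word_act q u (i, j) = (((((i * r) mod q\<^sup>2 + 1) mod q\<^sup>2) * (q + 1)) mod q\<^sup>2, ((j + (q - 1)) mod q + 1) mod q)"
      unfolding 3 by (simp add: word_act_def r_def)
    also have "\<dots> = ((i * r + 1) * (q + 1) mod q\<^sup>2, (j + (q - 1) + 1) mod q)"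
      by (simp only: mod_mult_left_eq mod_add_left_eq)
    also have "(i * r + 1) * (q + 1) = i * ((q + 1) * r) + (q + 1)" by (simp add: algebra_simps)
    also have "\<dots> = (i + (q + 1)) + q\<^sup>2 * (q * i)"
      unfolding r_def Suc_mult_inverse_mod_square(1) [OF q] by (simp add: algebra_simps)
    also have "((i + (q + 1)) + q\<^sup>2 * (q * i)) mod q\<^sup>2 = (i + (q + 1)) mod q\<^sup>2" by (rule mod_mult_self2)
    also have "(j + (q - 1) + 1) mod q = j" using ij q by simp
    also have "((i + (q + 1)) mod q\<^sup>2, j) = word_act q v (i, j)"
      unfolding 3 by (rule word_act_replicate_a [OF ij(1), symmetric])
    finally show ?thesis .
  qed
qed

lemma word_act_cancel:
  assumes q: "q > 1" and ij: "i < q\<^sup>2" "j < q"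
  shows "word_act q [(g, e), (g, \<not> e)] (i, j) = (i, j)"
proof -
  define r where "r = q\<^sup>2 - q + 1"
  have q2: "q\<^sup>2 \<ge> 1" using q by simp
  have a: "i + 1 + (q\<^sup>2 - 1) = i + q\<^sup>2" "i + (q\<^sup>2 - 1) + 1 = i + q\<^sup>2"
    "j + 1 + (q - 1) = j + q" "j + (q - 1) + 1 = j + q" using q2 q by simp_all
  have inv: "(i * (q + 1) * r) mod q\<^sup>2 = i" "(i * r * (q + 1)) mod q\<^sup>2 = i"
    using Suc_mult_inverse_mod_square(2) [OF q, of i] ij(1) by (simp_all only: r_def mult_ac mod_less)
  have b: "((i + 1) mod q\<^sup>2 + (q\<^sup>2 - 1)) mod q\<^sup>2 = i" "((i + (q\<^sup>2 - 1)) mod q\<^sup>2 + 1) mod q\<^sup>2 = i"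
    "((j + 1) mod q + (q - 1)) mod q = j" "((j + (q - 1)) mod q + 1) mod q = j"
    unfolding mod_add_left_eq a using ij by simp_all
  have c: "((i * (q + 1)) mod q\<^sup>2 * r) mod q\<^sup>2 = i" "((i * r) mod q\<^sup>2 * (q + 1)) mod q\<^sup>2 = i"
    unfolding mod_mult_left_eq by (rule inv)+
  show ?thesis
    by (cases g; cases e)
      (simp_all only: word_act_def fold_simps o_apply id_apply letter_act.simps not_True_eq_False not_False_eq_True b c r_def [symmetric])
qed

text \<open>\<open>pres_cong\<close> is the least congruence containing the relations and
  cancellations, so it is enough to check those pairs. Words that act differently then represent
  different elements, which bounds the order of M(q^3) from below.\<close>

lemma pres_cong_word_act:
  assumes q: "q > 1" and "pres_cong (M_cubed_rels q) u v" and "x \<in> {..<q\<^sup>2} \<times> {..<q}"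
  shows "word_act q u x = word_act q v x"
  using assms(2,3)
proof (induction arbitrary: x rule: pres_cong.induct)
  case (rel u v)
  then show ?case using word_act_rels [OF q] by auto
next
  case (cancel g e)
  then show ?case using word_act_cancel [OF q] by (auto simp: word_act_def)
next
  case (append u u' v v')
  have "word_act q u x \<in> {..<q\<^sup>2} \<times> {..<q}" using word_act_mem append.prems q by simp
  then show ?case using append by (simp add: word_act_append)
qed simp_all

text \<open>The order is at most q^3 because every word can be rewritten as A^i C^j with C = b^-1,
  and at least q^3 because the words b^j a^i send (0, 0) to the distinct states (i, j).\<close>

lemma M_cubed_facts:
  fixes M (structure)
  assumes q: "q > 1" and M_def: "M = M_cubed q"
  shows "group M" "finite (carrier M)" "order M = q ^ 3"
    "\<exists>x\<in>carrier M. group.ord M x = q\<^sup>2" "\<not> cyclic_group M"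
proof -
  define R where "R = M_cubed_rels q"
  define cl where "cl = pres_class R"
  have M: "M = presented_group R" by (simp add: M_def R_def M_cubed_eq)
  interpret group M unfolding M by (rule group_presented_group)
  have car: "carrier M = range cl" by (simp add: M presented_group_def cl_def)
  have mult: "cl u \<otimes> cl v = cl (u @ v)" for u v by (simp add: M cl_def presented_group_mult)
  have one: "\<one> = cl []" by (simp add: M presented_group_def cl_def)
  have act: "word_act q u (0, 0) = word_act q v (0, 0)" if "cl u = cl v" for u v
    using pres_cong_word_act [OF q, of u v "(0, 0)"] that q
    by (simp add: cl_def R_def pres_class_eq_iff)
  have rel: "cl u = cl v" if "(u, v) \<in> R" for u v
    using that by (simp add: cl_def pres_class_eq_iff pres_cong.rel)
  define A B C where "A = cl [(Gen_a, True)]" and "B = cl [(Gen_b, True)]" and "C = cl [(Gen_b, False)]"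
  have mem: "A \<in> carrier M" "B \<in> carrier M" "C \<in> carrier M" by (auto simp: car A_def B_def C_def)
  have canc: "cl [(g, e)] \<otimes> cl [(g, \<not> e)] = \<one>" for g e
    unfolding mult one using pres_cong.cancel [of R g e] by (simp add: cl_def pres_class_eq_iff)
  have BC: "C \<otimes> B = \<one>" using canc [of Gen_b False] by (simp add: B_def C_def)
  have powA: "A [^] n = cl (replicate n (Gen_a, True))" for n :: nat
    by (induction n) (simp_all add: one mult A_def replicate_append_same)
  have powB: "B [^] n = cl (replicate n (Gen_b, True))" for n :: nat
    by (induction n) (simp_all add: one mult B_def replicate_append_same)
  have Aq: "A [^] (q\<^sup>2) = \<one>" unfolding powA one by (rule rel) (simp add: R_def M_cubed_rels_def)
  have Bq: "B [^] q = \<one>" unfolding powB one by (rule rel) (simp add: R_def M_cubed_rels_def)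
  have CB: "C = inv B" using BC mem by (metis inv_equality)
  have Cq: "C [^] q = \<one>" unfolding CB using mem Bq by (simp add: nat_pow_inv)
  have "C \<otimes> A \<otimes> B = A [^] (q + 1)"
    unfolding powA unfolding A_def B_def C_def mult by (rule rel) (simp add: R_def M_cubed_rels_def)
  \<comment> \<open>In this form the relation b^-1 a b = a^(q+1) lets \<open>pow_conj\<close> move
    powers of C to the right past powers of A.\<close>
  then have CA: "C \<otimes> A = A [^] (q + 1) \<otimes> C"
    unfolding CB using mem by (metis inv_closed inv_inv inv_solve_right m_closed nat_pow_closed)
  define T where "T = {A [^] i \<otimes> C [^] j | (i::nat) (j::nat). True}"
  have TA: "A [^] k \<otimes> x \<in> T" if "x \<in> T" for x and k :: nat
  proof -
    obtain i j :: nat where x: "x = A [^] i \<otimes> C [^] j" using \<open>x \<in> T\<close> by (auto simp: T_def)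
    have "A [^] k \<otimes> x = A [^] (k + i) \<otimes> C [^] j"
      unfolding x using mem by (simp add: m_assoc flip: nat_pow_mult)
    then show ?thesis by (auto simp: T_def)
  qed
  have TC: "C [^] k \<otimes> x \<in> T" if "x \<in> T" for x and k :: nat
  proof -
    obtain i j :: nat where x: "x = A [^] i \<otimes> C [^] j" using \<open>x \<in> T\<close> by (auto simp: T_def)
    have "C [^] k \<otimes> x = (C [^] k \<otimes> A [^] i) \<otimes> C [^] j"
      unfolding x using mem by (simp add: m_assoc)
    also have "\<dots> = A [^] ((q + 1) ^ k * i) \<otimes> C [^] (k + j)"
      unfolding pow_conj [OF mem(3,1) CA] using mem by (simp add: m_assoc flip: nat_pow_mult)
    finally show ?thesis by (auto simp: T_def)
  qed
  \<comment> \<open>A and C have finite order, so every letter, inverse or not, is a nonnegative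
    power of one of them. Hence T is stable under prepending letters.\<close>
  have letter: "\<exists>k::nat. cl [(Gen_a, e)] = A [^] k" "\<exists>k::nat. cl [(Gen_b, e)] = C [^] k" for e
  proof -
    have pred: "inv y = y [^] (n - 1)" if "y \<in> carrier M" "y [^] n = \<one>" "n > 0" for y and n :: nat
    proof -
      have "y [^] (n - 1) \<otimes> y = \<one>" using that by (metis Suc_diff_1 nat_pow_Suc)
      then show ?thesis using that by (metis inv_equality nat_pow_closed)
    qed
    have "cl [(Gen_a, False)] \<otimes> A = \<one>" using canc [of Gen_a False] by (simp add: A_def)
    then have "inv A = cl [(Gen_a, False)]" by (rule inv_equality) (use mem in \<open>simp_all add: car\<close>)
    then have "cl [(Gen_a, False)] = A [^] (q\<^sup>2 - 1)" using pred [OF mem(1) Aq] q by simp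
    moreover have "cl [(Gen_a, True)] = A [^] (1::nat)" using nat_pow_eone [OF mem(1)] by (simp only: A_def)
    ultimately have "cl [(Gen_a, e)] = A [^] (if e then 1 else q\<^sup>2 - 1)" by (cases e) (simp_all only: if_True if_False)
    then show "\<exists>k::nat. cl [(Gen_a, e)] = A [^] k" by (rule exI)
    have "inv C = B" using CB inv_inv [OF mem(2)] by (simp only:)
    then have "cl [(Gen_b, True)] = C [^] (q - 1)" using pred [OF mem(3) Cq] q B_def by simp
    moreover have "cl [(Gen_b, False)] = C [^] (1::nat)" using nat_pow_eone [OF mem(3)] by (simp only: C_def)
    ultimately have "cl [(Gen_b, e)] = C [^] (if e then q - 1 else 1)" by (cases e) (simp_all only: if_True if_False)
    then show "\<exists>k::nat. cl [(Gen_b, e)] = C [^] k" by (rule exI)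
  qed
  have "cl w \<in> T" for w
  proof (induction w)
    case Nil
    have "\<one> = A [^] (0::nat) \<otimes> C [^] (0::nat)" by simp
    then show ?case unfolding T_def one by blast
  next
    case (Cons l w)
    have e: "cl (l # w) = cl [l] \<otimes> cl w" by (simp add: mult)
    obtain g b where l: "l = (g, b)" by (cases l)
    show ?case
    proof (cases g)
      case Gen_a
      then show ?thesis using letter(1) [of b] TA [OF Cons] e l by metis
    next
      case Gen_b
      then show ?thesis using letter(2) [of b] TC [OF Cons] e l by metis
    qed
  qed
  then have sub: "carrier M \<subseteq> T" by (auto simp: car)
  have redA: "A [^] (i mod q\<^sup>2) = A [^] i" and redC: "C [^] (i mod q) = C [^] i" for i :: nat
  proof -
    have "y [^] (i mod n) = y [^] i" if "y \<in> carrier M" "y [^] n = \<one>" for y and n :: nat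
    proof -
      have "y [^] i = y [^] (n * (i div n) + i mod n)" by simp
      also have "\<dots> = (y [^] n) [^] (i div n) \<otimes> y [^] (i mod n)"
        using that(1) by (simp only: nat_pow_pow nat_pow_mult nat_pow_closed)
      finally show ?thesis using that by simp
    qed
    then show "A [^] (i mod q\<^sup>2) = A [^] i" "C [^] (i mod q) = C [^] i"
      using mem Aq Cq by blast+
  qed
  let ?X = "{..<q\<^sup>2} \<times> {..<q}"
  have "T \<subseteq> (\<lambda>(i, j). A [^] i \<otimes> C [^] j) ` ?X"
  proof
    fix x assume "x \<in> T"
    then obtain i j :: nat where "x = A [^] (i mod q\<^sup>2) \<otimes> C [^] (j mod q)"
      using redA redC by (auto simp: T_def)
    moreover have "(i mod q\<^sup>2, j mod q) \<in> ?X" using q by simp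
    ultimately show "x \<in> (\<lambda>(i, j). A [^] i \<otimes> C [^] j) ` ?X" by force
  qed
  then have sub': "carrier M \<subseteq> (\<lambda>(i, j). A [^] i \<otimes> C [^] j) ` ?X" using sub by blast
  then have finM: "finite (carrier M)" by (rule finite_subset) simp
  have "card (carrier M) \<le> card ?X" using sub' by (rule surj_card_le [rotated]) simp
  then have le: "order M \<le> q ^ 3" by (simp add: order_def card_cartesian_product power2_eq_square power3_eq_cube)
  define W where "W = (\<lambda>(i, j). replicate j (Gen_b, True) @ replicate i (Gen_a, True))"
  have actW: "word_act q (W (i, j)) (0, 0) = (i, j)" if "i < q\<^sup>2" "j < q" for i j
    using that q word_act_replicate_b [of 0 q 0 j] word_act_replicate_a [of 0 q i j]
    by (simp add: W_def word_act_append)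
  have inj: "inj_on (cl \<circ> W) ?X"
  proof (rule inj_onI)
    fix x y assume "x \<in> ?X" "y \<in> ?X" "(cl \<circ> W) x = (cl \<circ> W) y"
    then show "x = y" using act [of "W x" "W y"] actW by (cases x, cases y) simp
  qed
  have "card ?X \<le> card (carrier M)"
    using inj by (rule card_inj_on_le) (use finM car in auto)
  then have oM: "order M = q ^ 3" using le by (simp add: order_def card_cartesian_product power2_eq_square power3_eq_cube)
  have "ord A dvd q\<^sup>2" using Aq mem pow_eq_id by blast
  then have "ord A \<le> q\<^sup>2" using q by (intro dvd_imp_le) auto
  \<comment> \<open>The word a^(ord A) sends (0, 0) to (ord A mod q^2, 0) and represents 1, so an
    order below q^2 would have to be 0.\<close>
  moreover have "\<not> ord A < q\<^sup>2"
  proof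
    assume lt: "ord A < q\<^sup>2"
    have "cl (replicate (ord A) (Gen_a, True)) = cl []" using mem powA one by (metis pow_ord_eq_1)
    then have "word_act q (replicate (ord A) (Gen_a, True)) (0, 0) = word_act q [] (0, 0)" by (rule act)
    then have "word_act q (replicate (ord A) (Gen_a, True)) (0, 0) = (0, 0)" by (simp add: word_act_def)
    then have "ord A = 0" using word_act_replicate_a [of 0 q "ord A" 0] lt q by simp
    then show False using ord_ge_1 [OF finM mem(1)] by simp
  qed
  ultimately have oA: "ord A = q\<^sup>2" by simp
  have ncyc: "\<not> cyclic_group M"
  proof
    assume "cyclic_group M"
    then have "comm_group M" by (rule cyclic_imp_abelian_group)
    then have "A \<otimes> B = B \<otimes> A"
      using mem by (intro comm_monoid.m_comm comm_group.axioms(1))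
    then have "cl [(Gen_a, True), (Gen_b, True)] = cl [(Gen_b, True), (Gen_a, True)]"
      by (simp add: A_def B_def mult)
    \<comment> \<open>From (0, 0) the word a b leads to (q+1, 1), but b a leads to (1, 1).\<close>
    then have "word_act q [(Gen_a, True), (Gen_b, True)] (0, 0) = word_act q [(Gen_b, True), (Gen_a, True)] (0, 0)"
      by (rule act)
    then have "(1 mod q\<^sup>2 * (q + 1)) mod q\<^sup>2 = 1 mod q\<^sup>2" by (simp add: word_act_def)
    moreover have "q + 1 < q\<^sup>2"
    proof -
      have "2 * q \<le> q * q" using q by (intro mult_le_mono1) simp
      then show ?thesis using q unfolding power2_eq_square by linarith
    qed
    ultimately show False using q by simp
  qed
  show "group M" "finite (carrier M)" "order M = q ^ 3"
    "\<exists>x\<in>carrier M. group.ord M x = q\<^sup>2" "\<not> cyclic_group M"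
    using is_group finM oM oA mem(1) ncyc by blast+
qed

lemma psi_ratio_M_cubed:
  assumes q: "nprime q" "odd q"
  shows "psi_ratio (M_cubed q) (q ^ 3) = noncyc_bound q 3"
proof -
  have q1: "q > 1" using q prime_gt_1_nat by blast
  obtain x where x: "x \<in> carrier (M_cubed q)" "group.ord (M_cubed q) x = q\<^sup>2"
    using M_cubed_facts(4) [OF q1 HOL.refl] by blast
  have "psi_ratio (M_cubed q) (q ^ (1 + 2)) = noncyc_bound q (1 + 2)"
    by (rule psi_ratio_pgroup [OF M_cubed_facts(1,2) [OF q1 HOL.refl] q _ x(1) _ M_cubed_facts(5) [OF q1 HOL.refl]])
      (use M_cubed_facts(3) [OF q1 HOL.refl] x(2) in \<open>simp_all add: power2_eq_square power3_eq_cube\<close>)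
  moreover have "1 + 2 = (3 :: nat)" by simp
  ultimately show ?thesis by (simp only:)
qed

subsection \<open>Non-abelian groups of order 21\<close>

text \<open>The semidirect product of Z/7 by Z/3, whose generator acts as multiplication by 2, an
  element of order 3 modulo 7.\<close>

definition frobenius_21 :: "(nat \<times> nat) monoid" where
  "frobenius_21 = \<lparr>carrier = {..<7} \<times> {..<3},
     monoid.mult = (\<lambda>(a, b) (c, d). ((a + 2 ^ b * c) mod 7, (b + d) mod 3)), one = (0, 0)\<rparr>"

lemma two_power_mod_7: "(2::nat) ^ (n mod 3) mod 7 = 2 ^ n mod 7"
proof -
  have "(2::nat) ^ n = (2 ^ 3) ^ (n div 3) * 2 ^ (n mod 3)"
    by (metis mult_div_mod_eq power_add power_mult)
  moreover have "[(2 ^ 3) ^ (n div 3) * 2 ^ (n mod 3) = 1 ^ (n div 3) * 2 ^ (n mod 3)] (mod (7::nat))"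
    by (intro cong_mult cong_pow cong_refl) (simp add: cong_def)
  ultimately show ?thesis by (simp add: cong_def)
qed

lemma nonabelian_frobenius_21: "nonabelian_of_order_21 frobenius_21"
proof -
  have "group frobenius_21"
  proof (rule groupI)
    fix x y z assume "x \<in> carrier frobenius_21" "y \<in> carrier frobenius_21" "z \<in> carrier frobenius_21"
    obtain a b c d e f where xyz: "x = (a, b)" "y = (c, d)" "z = (e, f)" by (metis surj_pair)
    have "((a + 2 ^ b * c) mod 7 + 2 ^ ((b + d) mod 3) * e) mod 7 = (a + 2 ^ b * c + 2 ^ (b + d) * e) mod 7"
      by (metis mod_add_cong mod_mod_trivial mod_mult_left_eq two_power_mod_7)
    also have "\<dots> = (a + 2 ^ b * (c + 2 ^ d * e)) mod 7" by (simp add: algebra_simps power_add)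
    also have "\<dots> = (a + 2 ^ b * ((c + 2 ^ d * e) mod 7)) mod 7"
      by (metis mod_add_right_eq mod_mult_right_eq)
    finally show "x \<otimes>\<^bsub>frobenius_21\<^esub> y \<otimes>\<^bsub>frobenius_21\<^esub> z = x \<otimes>\<^bsub>frobenius_21\<^esub> (y \<otimes>\<^bsub>frobenius_21\<^esub> z)"
      by (simp add: frobenius_21_def xyz mod_add_left_eq mod_add_right_eq add.assoc)
  next
    fix x assume "x \<in> carrier frobenius_21"
    then obtain a b where x: "x = (a, b)" "a < 7" "b < 3" by (auto simp: frobenius_21_def)
    define d where "d = (3 - b) mod 3"
    have d: "d < 3" "(d + b) mod 3 = 0" using x(3) by (auto simp: d_def mod_add_left_eq)
    \<comment> \<open>6 stands for -1 modulo 7: the left inverse of (a, b) is (-2^d a, d) with d =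
      -b modulo 3.\<close>
    have "((6 * 2 ^ d * a) mod 7 + 2 ^ d * a) mod 7 = (6 * 2 ^ d * a + 2 ^ d * a) mod 7"
      by (rule mod_add_left_eq)
    also have "6 * 2 ^ d * a + 2 ^ d * a = 7 * (2 ^ d * a)" by simp
    finally have "((6 * 2 ^ d * a) mod 7 + 2 ^ d * a) mod 7 = 0" by simp
    then show "\<exists>y\<in>carrier frobenius_21. y \<otimes>\<^bsub>frobenius_21\<^esub> x = \<one>\<^bsub>frobenius_21\<^esub>"
      using d x(1) by (intro bexI [of _ "((6 * 2 ^ d * a) mod 7, d)"]) (auto simp: frobenius_21_def)
  qed (auto simp: frobenius_21_def)
  moreover have "order frobenius_21 = 21" by (simp add: order_def frobenius_21_def card_cartesian_product)
  moreover have "\<not> comm_group frobenius_21"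
  proof
    assume "comm_group frobenius_21"
    then have "(1, 0) \<otimes>\<^bsub>frobenius_21\<^esub> (0, 1) = (0, 1) \<otimes>\<^bsub>frobenius_21\<^esub> (1, 0)"
      by (intro comm_monoid.m_comm comm_group.axioms(1)) (auto simp: frobenius_21_def)
    then show False by (simp add: frobenius_21_def)
  qed
  ultimately show ?thesis by (simp add: nonabelian_of_order_21_def)
qed

lemma nonabelian_of_order_21_nat: "\<exists>H :: nat monoid. nonabelian_of_order_21 H"
proof -
  have F: "group frobenius_21" "order frobenius_21 = 21" "\<not> comm_group frobenius_21"
    using nonabelian_frobenius_21 by (auto simp: nonabelian_of_order_21_def)
  interpret F: group frobenius_21 by fact
  have "finite (carrier frobenius_21)" by (simp add: frobenius_21_def)
  then obtain H :: "nat monoid" and h where H: "group H" "h \<in> iso frobenius_21 H"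
    using F.finite_group_iso_nat by blast
  have iso: "H \<cong> frobenius_21" using H(2) by (intro F.iso_sym) (auto simp: is_iso_def)
  have "\<not> comm_group H" using comm_group.iso_imp_comm_group [OF _ iso F.is_monoid] F(3) by blast
  moreover have "order H = 21" using iso_same_order [OF H(2)] F(2) by simp
  ultimately show ?thesis using H(1) unfolding nonabelian_of_order_21_def by blast
qed

lemma next_prime_3_5: "next_prime 3 5"
proof -
  have "5 \<le> r" if r: "nprime r" "3 < r" for r
  proof -
    have "\<not> nprime 4" by simp
    then have "r \<noteq> 4" using r by metis
    then show ?thesis using r by linarith
  qed
  then show ?thesis by (simp add: next_prime_def)
qed

lemma cyc_psi_21: "cyc_psi 21 = 301"
proof -
  have "coprime (3::nat) 7" by (intro primes_coprime) simp_all
  then have "cyc_psi (3 * 7) = cyc_psi 3 * cyc_psi 7" by (rule cyc_psi_mult) simp_all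
  moreover have "real (cyc_psi 3) = 7" "real (cyc_psi 7) = 43"
    using cyc_psi_prime [of 3] cyc_psi_prime [of 7] by simp_all
  ultimately have "real (cyc_psi 21) = 301" by simp
  then show ?thesis by simp
qed

text \<open>The upper estimate is the general bound; counting elements gives the lower one.\<close>

lemma nonabelian_of_order_21_psi:
  assumes "nonabelian_of_order_21 H"
  shows "odd_noncyclic H 21 7 3 1" and "psi_ratio H 21 = 85 / 301"
proof -
  have H: "group H" "order H = 21" "\<not> comm_group H" using assms by (auto simp: nonabelian_of_order_21_def)
  interpret group H by fact
  have fin: "finite (carrier H)" using H(2) order_gt_0_iff_finite by simp
  have ncyc: "\<not> cyclic_group H" using H(3) cyclic_imp_abelian_group by blast
  have pr: "nprime 3" "nprime 7" by simp_all
  have "3 \<le> r" if "nprime r" "r dvd 21" for r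
  proof -
    have "r \<noteq> 2" using that(2) by auto
    then show ?thesis using prime_ge_2_nat [OF that(1)] by linarith
  qed
  then show on: "odd_noncyclic H 21 7 3 1"
    using H fin ncyc pr primes_coprime [of "7::nat" 3] by (simp add: odd_noncyclic_def smallest_prime_divisor_def)
  have "psi_ratio H 21 \<le> 85 / 301"
    using psi_ratio_le_main_bound [OF on next_prime_3_5] by (simp add: main_bound_def)
  moreover have "psi_ratio H 21 \<ge> 85 / 301"
  proof -
    \<comment> \<open>A Sylow 7-subgroup K supplies 1 and six elements of order 7; the other 14
      elements have odd order different from 1, hence at least 3. This makes 1 + 42 + 42 =
      85.\<close>
    have "order H = 7 ^ 1 * 3" using H(2) by simp
    then obtain K where K: "subgroup K H" "card K = 7 ^ 1"
      using sylow_thm [OF pr(2) is_group _ fin] by metis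
    have KH: "K \<subseteq> carrier H" using K(1) subgroup.subset by blast
    have finK: "finite K" using KH fin finite_subset by blast
    have oneK: "\<one>\<^bsub>H\<^esub> \<in> K" using subgroup.one_closed [OF K(1)] .
    have ord1: "ord x = 1 \<longleftrightarrow> x = \<one>\<^bsub>H\<^esub>" if "x \<in> carrier H" for x using ord_eq_1 [OF that] .
    have ord7: "7 \<le> ord x" if x: "x \<in> K - {\<one>\<^bsub>H\<^esub>}" for x
    proof -
      have "ord x dvd 7" using ord_dvd_card_subgroup [OF K(1), of x] x K(2) by simp
      moreover have "ord x \<noteq> 1" using ord1 x KH by blast
      ultimately have "ord x = 7" using pr(2) by (metis prime_nat_iff)
      then show ?thesis by simp
    qed
    have ord3: "3 \<le> ord x" if x: "x \<in> carrier H - K" for x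
    proof -
      have xH: "x \<in> carrier H" using x by blast
      have "ord x dvd 21" using ord_dvd_group_order [OF xH] H(2) by simp
      then have "odd (ord x)" using dvd_trans [of 2 "ord x" 21] by auto
      then have "ord x \<noteq> 0" "ord x \<noteq> 2" by (intro notI; simp)+
      moreover have "ord x \<noteq> 1" using ord1 [OF xH] x oneK by blast
      ultimately show ?thesis by linarith
    qed
    have "psi H = (\<Sum>x\<in>carrier H - K. ord x) + (\<Sum>x\<in>K. ord x)"
      unfolding psi_def by (rule sum.subset_diff [OF KH fin])
    also have "(\<Sum>x\<in>K. ord x) = ord \<one>\<^bsub>H\<^esub> + (\<Sum>x\<in>K - {\<one>\<^bsub>H\<^esub>}. ord x)"
      by (rule sum.remove [OF finK oneK])
    finally have "psi H = (\<Sum>x\<in>carrier H - K. ord x) + (1 + (\<Sum>x\<in>K - {\<one>\<^bsub>H\<^esub>}. ord x))" by simp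
    moreover have "card (carrier H - K) = 14"
      using card_Diff_subset [OF finK KH] K(2) H(2) by (simp add: order_def)
    then have "42 \<le> (\<Sum>x\<in>carrier H - K. ord x)"
      using sum_bounded_below [of "carrier H - K" 3 ord] ord3 by simp
    moreover have "card (K - {\<one>\<^bsub>H\<^esub>}) = 6" using K(2) finK oneK by simp
    then have "42 \<le> (\<Sum>x\<in>K - {\<one>\<^bsub>H\<^esub>}. ord x)"
      using sum_bounded_below [of "K - {\<one>\<^bsub>H\<^esub>}" 7 ord] ord7 by simp
    ultimately have "85 \<le> psi H" by linarith
    then show ?thesis by (simp add: psi_ratio_def psi_Cyc cyc_psi_21)
  qed
  ultimately show "psi_ratio H 21 = 85 / 301" by simp
qed

subsection \<open>Groups attaining the bounds\<close>

lemma psi_ratio_DirProd_Cyc_square: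
  assumes "nprime q" "odd q"
  shows "psi_ratio (Cyc q \<times>\<times> Cyc q) (q\<^sup>2) = noncyc_bound q 2"
proof -
  have "q ^ Suc 0 = q" "0 + 2 = (2::nat)" by simp_all
  then show ?thesis using psi_ratio_DirProd_Cyc [OF assms, of 0] by (simp only:)
qed

text \<open>The witness is the q-group C_q x C_(q^(a-1)), with m = 1.\<close>

lemma noncyc_bound_attained:
  assumes q: "nprime q" "odd q" and a: "a \<ge> 2"
  shows "\<exists>(G :: nat monoid) n m. odd_noncyclic G n m q a \<and> psi_ratio G n = noncyc_bound q a"
proof -
  obtain k where k: "a = k + 2" using a le_Suc_ex by (metis add.commute)
  let ?G = "Cyc q \<times>\<times> Cyc (q ^ Suc k)"
  have "odd_noncyclic ?G (q ^ (k + 2)) 1 q (k + 2)"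
    using DirProd_Cyc_facts [OF q(1), of k] q
    unfolding odd_noncyclic_def smallest_prime_divisor_def
    by (auto simp del: power_Suc dest: prime_dvd_power primes_dvd_imp_eq)
  then show ?thesis
    using odd_noncyclic_transfer_nat psi_ratio_DirProd_Cyc [OF q, of k] k by metis
qed

text \<open>As q has to divide n exactly once, the witness is C_q x C_p x C_p. Its coprime factor
  C_q cancels in the ratio and leaves the value for C_p x C_p.\<close>

lemma noncyc_bound_attained_next_prime:
  assumes q: "nprime q" "odd q" and p: "nprime p" "q < p"
  shows "\<exists>(G :: nat monoid) n m. odd_noncyclic G n m q 1 \<and> psi_ratio G n = noncyc_bound p 2"
proof -
  have q1: "q > 1" "p > 1" using q p prime_gt_1_nat by blast+
  have odd_p: "odd p" using p q1 primes_dvd_imp_eq [OF two_is_prime_nat p(1)] by auto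
  define K where "K = Cyc p \<times>\<times> Cyc (p ^ Suc 0)"
  define G where "G = Cyc q \<times>\<times> K"
  note K = DirProd_Cyc_facts [OF p(1), of 0, folded K_def]
  have cop: "coprime q p" using p q by (simp add: primes_coprime)
  have gG: "group G" unfolding G_def by (intro DirProd_group K) simp
  have finG: "finite (carrier G)" using K q1 by (simp add: G_def finite_Cyc)
  have oK: "order K = p\<^sup>2" using K(3) by (simp add: power2_eq_square)
  have oG: "order G = q * p\<^sup>2" using oK q1 by (simp add: G_def order_DirProd order_Cyc)
  have ncyc: "\<not> cyclic_group G"
  proof
    assume "cyclic_group G"
    then obtain x where x: "x \<in> carrier G" "group.ord G x = q * p\<^sup>2"
      using group.cyclic_group_imp_ord [OF gG finG] oG by metis
    obtain c d where cd: "x = (c, d)" "c \<in> carrier (Cyc q)" "d \<in> carrier K" using x(1) by (auto simp: G_def)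
    have "group.ord (Cyc q) c dvd q"
      using group.ord_dvd_group_order [OF _ cd(2)] q1 by (simp add: order_Cyc)
    moreover have "group.ord K d dvd p" using ord_DirProd_Cyc_dvd [of p d 0] cd(3) q1 by (simp add: K_def)
    ultimately have "group.ord G x dvd q * p"
      using cd K(1) by (simp add: G_def ord_DirProd lcm_least)
    then have "q * p\<^sup>2 \<le> q * p" using x(2) q1 by (simp add: dvd_imp_le)
    then show False using q1 by (simp add: power2_eq_square)
  qed
  have "q \<le> r" if "nprime r" "r dvd p\<^sup>2 * q" for r
  proof -
    have "r dvd p \<or> r dvd q" using that prime_dvd_mult_iff prime_dvd_power by metis
    then have "r = p \<or> r = q" using that(1) p(1) q(1) primes_dvd_imp_eq by blast
    then show ?thesis using p(2) by auto
  qed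
  then have on: "odd_noncyclic G (q * p\<^sup>2) (p\<^sup>2) q 1"
    using gG finG ncyc oG q odd_p cop
    by (simp add: odd_noncyclic_def smallest_prime_divisor_def coprime_commute mult.commute)
  have c2: "coprime q (p\<^sup>2)" using cop by simp
  have pos: "q * p\<^sup>2 > 0" "p\<^sup>2 > 0" "q > 0" using q1 by auto
  have "psi G = cyc_psi q * psi K"
    unfolding G_def using psi_DirProd [OF _ K(1), of "Cyc q"] c2 oK q1 by (simp add: order_Cyc psi_Cyc)
  then have "psi_ratio G (q * p\<^sup>2) = psi_ratio K (p\<^sup>2)"
    using cyc_psi_mult [OF c2 pos(3,2)] cyc_psi_pos [OF pos(3)] pos
    by (simp add: psi_ratio_def psi_Cyc)
  also have "\<dots> = noncyc_bound p 2"
    using psi_ratio_DirProd_Cyc_square [OF p(1) odd_p] by (simp add: K_def)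
  finally show ?thesis using odd_noncyclic_transfer_nat [OF on] by metis
qed

text \<open>The inequalities are stated for carriers of any type, the attaining groups on
  \<open>nat\<close>. The value 85/301 is asserted for every non-abelian group of order 21, and the
  existence of such a group separately, on \<open>nat\<close>.\<close>

theorem corollaryC:
  shows "(\<forall>(G :: 'a monoid) n m q p \<alpha>.
      odd_noncyclic G n m q \<alpha> \<and> next_prime q p \<longrightarrow>
        (\<alpha> = 1 \<and> q = 3 \<longrightarrow>
           psi_ratio G n \<le> 85 / 301 \<and>
           (\<exists>H :: nat monoid. nonabelian_of_order_21 H) \<and>
           (\<forall>H :: 'b monoid. nonabelian_of_order_21 H \<longrightarrow> 85 / 301 = psi_ratio H 21)) \<and>
        (\<alpha> = 1 \<and> q > 3 \<longrightarrow>
           psi_ratio G n \<le> (real p ^ 4 + real p ^ 3 - real p ^ 2 + 1) / (real p ^ 5 + 1) \<and>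
           (real p ^ 4 + real p ^ 3 - real p ^ 2 + 1) / (real p ^ 5 + 1)
             = psi_ratio (Cyc p \<times>\<times> Cyc p) (p ^ 2)) \<and>
        (\<alpha> = 2 \<longrightarrow>
           psi_ratio G n \<le> (real q ^ 4 + real q ^ 3 - real q ^ 2 + 1) / (real q ^ 5 + 1) \<and>
           (real q ^ 4 + real q ^ 3 - real q ^ 2 + 1) / (real q ^ 5 + 1)
             = psi_ratio (Cyc q \<times>\<times> Cyc q) (q ^ 2)) \<and>
        (\<alpha> = 3 \<longrightarrow>
           psi_ratio G n \<le> (real q ^ 6 + real q ^ 3 - real q ^ 2 + 1) / (real q ^ 7 + 1) \<and>
           (real q ^ 6 + real q ^ 3 - real q ^ 2 + 1) / (real q ^ 7 + 1)
             = psi_ratio (Cyc q \<times>\<times> Cyc (q ^ 2)) (q ^ 3) \<and>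
           psi_ratio (Cyc q \<times>\<times> Cyc (q ^ 2)) (q ^ 3) = psi_ratio (M_cubed q) (q ^ 3)) \<and>
        (\<alpha> \<ge> 4 \<longrightarrow>
           psi_ratio G n
             \<le> (real q ^ (2 * \<alpha>) + real q ^ 3 - real q ^ 2 + 1) / (real q ^ (2 * \<alpha> + 1) + 1) \<and>
           (real q ^ (2 * \<alpha>) + real q ^ 3 - real q ^ 2 + 1) / (real q ^ (2 * \<alpha> + 1) + 1)
             = psi_ratio (Cyc q \<times>\<times> Cyc (q ^ (\<alpha> - 1))) (q ^ \<alpha>))) \<and>
    (\<exists>(G :: nat monoid) n m. odd_noncyclic G n m 3 1 \<and> psi_ratio G n = 85 / 301) \<and>
    (\<forall>q p. Factorial_Ring.prime q \<and> q > 3 \<and> next_prime q p \<longrightarrow>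
       (\<exists>(G :: nat monoid) n m. odd_noncyclic G n m q 1 \<and>
          psi_ratio G n = (real p ^ 4 + real p ^ 3 - real p ^ 2 + 1) / (real p ^ 5 + 1))) \<and>
    (\<forall>q. Factorial_Ring.prime q \<and> odd q \<longrightarrow>
       (\<exists>(G :: nat monoid) n m. odd_noncyclic G n m q 2 \<and>
          psi_ratio G n = (real q ^ 4 + real q ^ 3 - real q ^ 2 + 1) / (real q ^ 5 + 1))) \<and>
    (\<forall>q. Factorial_Ring.prime q \<and> odd q \<longrightarrow>
       (\<exists>(G :: nat monoid) n m. odd_noncyclic G n m q 3 \<and>
          psi_ratio G n = (real q ^ 6 + real q ^ 3 - real q ^ 2 + 1) / (real q ^ 7 + 1))) \<and>
    (\<forall>q \<alpha>. Factorial_Ring.prime q \<and> odd q \<and> \<alpha> \<ge> 4 \<longrightarrow>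
       (\<exists>(G :: nat monoid) n m. odd_noncyclic G n m q \<alpha> \<and>
          psi_ratio G n
            = (real q ^ (2 * \<alpha>) + real q ^ 3 - real q ^ 2 + 1) / (real q ^ (2 * \<alpha> + 1) + 1)))"
proof (intro conjI allI impI)
  fix G :: "'a monoid" and n m q p \<alpha>
  assume "odd_noncyclic G n m q \<alpha> \<and> next_prime q p"
  then have on: "odd_noncyclic G n m q \<alpha>" and np: "next_prime q p" by auto
  then have q: "nprime q" "q dvd n" and odd_n: "odd n" and p: "nprime p" "q < p"
    by (auto simp: odd_noncyclic_def smallest_prime_divisor_def next_prime_def)
  have odd_q: "odd q" using q(2) odd_n dvd_trans by blast
  have odd_p: "odd p"
    using p prime_ge_2_nat [OF q(1)] primes_dvd_imp_eq [OF two_is_prime_nat p(1)] by auto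
  note le = psi_ratio_le_main_bound [OF on np]
  {
    assume a: "\<alpha> = 1 \<and> q = 3"
    then show "psi_ratio G n \<le> 85 / 301" using le by (simp add: main_bound_def)
    show "\<exists>H :: nat monoid. nonabelian_of_order_21 H" by (rule nonabelian_of_order_21_nat)
    fix H :: "'b monoid"
    assume "nonabelian_of_order_21 H"
    then show "85 / 301 = psi_ratio H 21" using nonabelian_of_order_21_psi(2) by metis
  }
  {
    assume a: "\<alpha> = 1 \<and> q > 3"
    then show "psi_ratio G n \<le> (real p ^ 4 + real p ^ 3 - real p ^ 2 + 1) / (real p ^ 5 + 1)"
      using le by (simp add: main_bound_def noncyc_bound_def)
    show "(real p ^ 4 + real p ^ 3 - real p ^ 2 + 1) / (real p ^ 5 + 1) = psi_ratio (Cyc p \<times>\<times> Cyc p) (p ^ 2)"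
      using psi_ratio_DirProd_Cyc_square [OF p(1) odd_p] by (simp add: noncyc_bound_def)
  }
  {
    assume a: "\<alpha> = 2"
    then show "psi_ratio G n \<le> (real q ^ 4 + real q ^ 3 - real q ^ 2 + 1) / (real q ^ 5 + 1)"
      using le by (simp add: main_bound_def noncyc_bound_def)
    show "(real q ^ 4 + real q ^ 3 - real q ^ 2 + 1) / (real q ^ 5 + 1) = psi_ratio (Cyc q \<times>\<times> Cyc q) (q ^ 2)"
      using psi_ratio_DirProd_Cyc_square [OF q(1) odd_q] by (simp add: noncyc_bound_def)
  }
  {
    assume a: "\<alpha> = 3"
    then show "psi_ratio G n \<le> (real q ^ 6 + real q ^ 3 - real q ^ 2 + 1) / (real q ^ 7 + 1)"
      using le by (simp add: main_bound_def noncyc_bound_def)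
    have "1 + 2 = (3::nat)" "Suc 1 = (2::nat)" by simp_all
    then have D: "psi_ratio (Cyc q \<times>\<times> Cyc (q ^ 2)) (q ^ 3) = noncyc_bound q 3"
      using psi_ratio_DirProd_Cyc [OF q(1) odd_q, of 1] by (simp only:)
    then show "(real q ^ 6 + real q ^ 3 - real q ^ 2 + 1) / (real q ^ 7 + 1) = psi_ratio (Cyc q \<times>\<times> Cyc (q ^ 2)) (q ^ 3)"
      by (simp add: noncyc_bound_def)
    show "psi_ratio (Cyc q \<times>\<times> Cyc (q ^ 2)) (q ^ 3) = psi_ratio (M_cubed q) (q ^ 3)"
      using D psi_ratio_M_cubed [OF q(1) odd_q] by simp
  }
  assume a: "4 \<le> \<alpha>"
  then show "psi_ratio G n
      \<le> (real q ^ (2 * \<alpha>) + real q ^ 3 - real q ^ 2 + 1) / (real q ^ (2 * \<alpha> + 1) + 1)"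
    using le by (simp add: main_bound_def noncyc_bound_def)
  have "Suc (\<alpha> - 2) = \<alpha> - 1" "\<alpha> - 2 + 2 = \<alpha>" using a by simp_all
  then have "psi_ratio (Cyc q \<times>\<times> Cyc (q ^ (\<alpha> - 1))) (q ^ \<alpha>) = noncyc_bound q \<alpha>"
    using psi_ratio_DirProd_Cyc [OF q(1) odd_q, of "\<alpha> - 2"] by (simp only:)
  then show "(real q ^ (2 * \<alpha>) + real q ^ 3 - real q ^ 2 + 1) / (real q ^ (2 * \<alpha> + 1) + 1)
      = psi_ratio (Cyc q \<times>\<times> Cyc (q ^ (\<alpha> - 1))) (q ^ \<alpha>)"
    by (simp add: noncyc_bound_def)
next
  show "\<exists>(G :: nat monoid) n m. odd_noncyclic G n m 3 1 \<and> psi_ratio G n = 85 / 301"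
    using odd_noncyclic_transfer_nat nonabelian_of_order_21_psi [OF nonabelian_frobenius_21] by metis
next
  fix q p :: nat
  assume "nprime q \<and> q > 3 \<and> next_prime q p"
  moreover then have "odd q" using primes_dvd_imp_eq [OF two_is_prime_nat, of q] by auto
  ultimately have "\<exists>(G :: nat monoid) n m. odd_noncyclic G n m q 1 \<and> psi_ratio G n = noncyc_bound p 2"
    by (intro noncyc_bound_attained_next_prime) (auto simp: next_prime_def)
  then show "\<exists>(G :: nat monoid) n m. odd_noncyclic G n m q 1 \<and>
      psi_ratio G n = (real p ^ 4 + real p ^ 3 - real p ^ 2 + 1) / (real p ^ 5 + 1)"
    by (simp add: noncyc_bound_def)
next
  fix q :: nat
  assume "nprime q \<and> odd q"
  then have "\<exists>(G :: nat monoid) n m. odd_noncyclic G n m q 2 \<and> psi_ratio G n = noncyc_bound q 2"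
    by (intro noncyc_bound_attained) auto
  then show "\<exists>(G :: nat monoid) n m. odd_noncyclic G n m q 2 \<and>
      psi_ratio G n = (real q ^ 4 + real q ^ 3 - real q ^ 2 + 1) / (real q ^ 5 + 1)"
    by (simp add: noncyc_bound_def)
next
  fix q :: nat
  assume "nprime q \<and> odd q"
  then have "\<exists>(G :: nat monoid) n m. odd_noncyclic G n m q 3 \<and> psi_ratio G n = noncyc_bound q 3"
    by (intro noncyc_bound_attained) auto
  then show "\<exists>(G :: nat monoid) n m. odd_noncyclic G n m q 3 \<and>
      psi_ratio G n = (real q ^ 6 + real q ^ 3 - real q ^ 2 + 1) / (real q ^ 7 + 1)"
    by (simp add: noncyc_bound_def)
next
  fix q \<alpha> :: nat
  assume "nprime q \<and> odd q \<and> 4 \<le> \<alpha>"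
  then have "\<exists>(G :: nat monoid) n m. odd_noncyclic G n m q \<alpha> \<and> psi_ratio G n = noncyc_bound q \<alpha>"
    by (intro noncyc_bound_attained) auto
  then show "\<exists>(G :: nat monoid) n m. odd_noncyclic G n m q \<alpha> \<and>
      psi_ratio G n = (real q ^ (2 * \<alpha>) + real q ^ 3 - real q ^ 2 + 1) / (real q ^ (2 * \<alpha> + 1) + 1)"
    by (simp add: noncyc_bound_def)
qed

end
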